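(* For all $n\in\mathbb{N}$, \[ B_{2n}^{*}\!\left(-\tfrac32\right)+B_{2n}^{*}=2\sum_{m=1}^{\infty}\left((-1)^{n}\pi Y_{2n}(8\pi m)+\frac{1}{2\sqrt{2m}}\right)-n-\frac12\left(U_{2n-1}\!\left(\tfrac14\right)+U_{2n-1}\!\left(\tfrac34\right)\right)-\frac{1}{\sqrt2}\zeta\!\left(\tfrac12\right)+\frac{1}{2^{4n-1}}\sum_{m=1}^{\infty}\frac{\left(m+4-\sqrt{m(m+8)}\right)^{2n}}{\sqrt{m(m+8)}}. \]
   Context: $B_r(x)$ denotes the Bernoulli polynomials. The Zagier polynomials are $B_{n}^{*}(x)=\sum_{r=0}^{n}\binom{n+r}{2r}\frac{B_r(x)}{n+r}$ for $n\ge1$, and $B_n^*:=B_n^*(0)$. $Y_{n}$ is the Bessel function of the second kind of integer order $n$, $U_k$ the Chebyshev polynomial of the second kind, and $\zeta$ the Riemann zeta function. *)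

theory Defs
  imports "HOL-Analysis.Analysis"
begin

text \<open>Bernoulli numbers (convention B_1 = -1/2), via the standard recurrence
  sum_{k=0}^{m} (m+1 choose k) B_k = 0 for m >= 1.\<close>
fun bernoulli_num :: "nat \<Rightarrow> real" where
  "bernoulli_num m =
     (if m = 0 then 1
      else - (\<Sum>k<m. real ((m + 1) choose k) * bernoulli_num k) / real (m + 1))"

definition bernoulli_poly :: "nat \<Rightarrow> real \<Rightarrow> real" where
  "bernoulli_poly r x = (\<Sum>k\<le>r. real (r choose k) * bernoulli_num k * x ^ (r - k))"

definition zagier_poly :: "nat \<Rightarrow> real \<Rightarrow> real" where
  "zagier_poly n x = (\<Sum>r\<le>n. real ((n + r) choose (2 * r)) * bernoulli_poly r x / real (n + r))"

fun chebyshev_U :: "nat \<Rightarrow> real \<Rightarrow> real" where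
  "chebyshev_U 0 x = 1"
| "chebyshev_U (Suc 0) x = 2 * x"
| "chebyshev_U (Suc (Suc n)) x = 2 * x * chebyshev_U (Suc n) x - chebyshev_U n x"

text \<open>Bessel function of the first kind of real order nu, for x > 0
  (rGamma = 1/Gamma, which is 0 at the poles).\<close>
definition bessel_J :: "real \<Rightarrow> real \<Rightarrow> real" where
  "bessel_J nu x = (\<Sum>k. (-1) ^ k * rGamma (real k + nu + 1) / fact k * (x / 2) powr (2 * real k + nu))"

text \<open>Bessel function of the second kind of integer order n (x > 0), defined as
  the limit of Weber's formula (J_nu cos(nu pi) - J_{-nu}) / sin(nu pi) as nu -> n.\<close>
definition bessel_Y :: "nat \<Rightarrow> real \<Rightarrow> real" where
  "bessel_Y n x = Lim (at (real n))
     (\<lambda>nu. (bessel_J nu x * cos (nu * pi) - bessel_J (- nu) x) / sin (nu * pi))"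

text \<open>Riemann zeta function on real s > 0, s ~= 1, via the Dirichlet eta function
  (this is the analytic continuation of zeta to that range).\<close>
definition zeta_real :: "real \<Rightarrow> real" where
  "zeta_real s = (\<Sum>k. (-1) ^ k / real (k + 1) powr s) / (1 - 2 powr (1 - s))"

end

(* The Zagier polynomial is (1/N) T_N(1 + (B + x)/2) in umbral notation, where T_N is the Chebyshev
   polynomial. The duplication formula turns the left-hand side, up to the two U-terms, into twice
   the Bernoulli functional of q(y) = T_N(1 + y/4)/N, N = 2n. By Fourier expansion of the sawtooth
   this functional is q(0) - q'(0)/2 + sum_m E_m(q), where E_m(q) is an explicit linear form in the
   derivatives of q at 0 and powers of 1/(2 pi m).

   On the other side, Hankel's integral for 1/Gamma gives Schlaefli's integral for J_nu and, in the
   limit of Weber's formula, for Y_N. A contour shift for exp(ix cosh w), after splitting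
   cosh(Nw) = exp(-Nw) + sinh(Nw), gives at x = 8 pi m
     (-1)^n pi Y_N(x) = E_m(q) - 2 int_0^oo cos(x cosh u) exp(-Nu) du.
   In the variable y = 4(cosh u - 1) the last integral is a cosine integral at frequency m of
   G(y) = 4 v^N / sqrt(y(y+8)), v = exp(-u), and the sum over m is an Euler-Maclaurin (Poisson)
   summation of G. The singularity G(y) ~ sqrt 2 / sqrt y at 0 produces, through the Fresnel
   integral, the terms 1/(2 sqrt(2m)), and through sum_{k<=K} k^(-1/2) - 2 sqrt K -> zeta(1/2) the
   zeta value. *)
theory Submission
  imports Defs "HOL-Complex_Analysis.Complex_Analysis" "HOL-Real_Asymp.Real_Asymp"
begin

section \<open>Integrals over half-lines and rectangles\<close>

text \<open>The argument 8 pi m is the right one because y = 4 (z - 1) turns exp(i x z) into exp(i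
  x) exp(2 pi i m y) with exp(i x) = 1: the Bessel function then sees q at exactly the Fourier
  frequencies of the Bernoulli functional. Since \<open>bessel_Y\<close> is a limit over
  non-integral orders, Schlaefli's integrals are established for those orders first; what is left of
  Weber's numerator then carries the factor sin(nu pi), and the limit becomes a matter of
  continuity. The splitting of cosh(Nw) is forced: exp(-Nw) decays and can be moved to the real
  axis, whereas sinh(Nw) grows but is the derivative of a polynomial in cosh w, so that it has an
  elementary primitive against exp(i x cosh w). Sums over m are exchanged with integrals through the
  uniformly bounded partial sums of the sawtooth series, which asks only for an integrable
  derivative; hence the subtraction of the singularity of G. The integral of that derivative against
  the sawtooth is never evaluated: it enters the Bessel series with weight 1/4, the sum of G with
  weight -1, and cancels. The term -n is half q'(0), half the value -2n at 0 of the regular part of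
  G.\<close>

lemma integral_halfline_tendsto:
  fixes f :: "real \<Rightarrow> 'a::euclidean_space"
  assumes "f absolutely_integrable_on {a..}"
  shows "((\<lambda>R. integral {a..R} f) \<longlongrightarrow> integral {a..} f) at_top"
proof -
  have sub: "f absolutely_integrable_on {a..R}" for R
    by (rule set_integrable_subset[OF assms]) auto
  have "((\<lambda>R. LINT x:{a..R}|lebesgue. f x) \<longlongrightarrow> (LINT x:{a..}|lebesgue. f x)) at_top"
    by (rule tendsto_set_lebesgue_integral_at_top) (use assms in auto)
  thus ?thesis
    using sub assms by (simp add: set_lebesgue_integral_eq_integral)
qed

lemma absolutely_integrable_exp_decay:
  fixes f :: "real \<Rightarrow> 'a::euclidean_space"
  assumes "continuous_on {a..} f" and "\<And>t. t \<ge> a \<Longrightarrow> norm (f t) \<le> K * exp (- t)"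
  shows "f absolutely_integrable_on {a..}"
proof (rule measurable_bounded_by_integrable_imp_absolutely_integrable)
  show "f \<in> borel_measurable (lebesgue_on {a..})"
    by (rule continuous_imp_measurable_on_sets_lebesgue[OF assms(1)]) auto
  show "(\<lambda>t. K * exp (- t)) integrable_on {a..}"
    using integrable_on_exp_minus_to_infinity[of 1 a] by (intro integrable_on_mult_right) auto
qed (use assms in auto)

lemma integral_halfline_FTC:
  fixes f :: "real \<Rightarrow> 'a::euclidean_space"
  assumes "f absolutely_integrable_on {a..}"
    and "\<And>t. t \<ge> a \<Longrightarrow> (F has_vector_derivative f t) (at t within {a..})"
    and "(F \<longlongrightarrow> l) at_top"
  shows "integral {a..} f = l - F a"
proof (rule tendsto_unique[OF _ integral_halfline_tendsto[OF assms(1)]])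
  have "integral {a..R} f = F R - F a" if "R \<ge> a" for R
    by (rule integral_unique, rule fundamental_theorem_of_calculus[OF that])
       (auto intro: has_vector_derivative_within_subset[OF assms(2)])
  moreover have "((\<lambda>R. F R - F a) \<longlongrightarrow> l - F a) at_top"
    by (intro tendsto_intros assms)
  ultimately show "((\<lambda>R. integral {a..R} f) \<longlongrightarrow> l - F a) at_top"
    by (elim Lim_transform_eventually) (auto intro: eventually_mono[OF eventually_ge_at_top[of a]])
qed simp

lemma Re_integral: "f integrable_on S \<Longrightarrow> Re (integral S f) = integral S (\<lambda>x. Re (f x))"
  by (drule integral_linear[OF _ bounded_linear_Re]) (simp add: o_def)

lemma Im_integral: "f integrable_on S \<Longrightarrow> Im (integral S f) = integral S (\<lambda>x. Im (f x))"
  by (drule integral_linear[OF _ bounded_linear_Im]) (simp add: o_def)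

section \<open>Contour integrals of entire functions through a primitive\<close>

lemma entire_primitive:
  assumes "f holomorphic_on UNIV"
  obtains F where "\<And>z. (F has_field_derivative f z) (at z)"
  using holomorphic_convex_primitive'[of UNIV f] assms by auto

lemma has_integral_curve:
  fixes F :: "complex \<Rightarrow> complex"
  assumes "a \<le> b" and "\<And>z. (F has_field_derivative f z) (at z)"
    and "\<And>t. t \<in> {a..b} \<Longrightarrow> (g has_vector_derivative g' t) (at t within {a..b})"
  shows "((\<lambda>t. g' t * f (g t)) has_integral (F (g b) - F (g a))) {a..b}"
proof (rule fundamental_theorem_of_calculus[OF assms(1)])
  fix t assume "t \<in> {a..b}"
  from field_vector_diff_chain_within[OF assms(3)[OF this] has_field_derivative_at_within[OF assms(2)]]
  show "((\<lambda>t. F (g t)) has_vector_derivative g' t * f (g t)) (at t within {a..b})"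
    by (simp add: o_def)
qed

text \<open>Both sides are the increment of a global primitive from the corner (a, c) to the corner
  (b, d), along the two broken paths. Every contour shift below is an instance, with one side of the
  rectangle sent to infinity.\<close>

lemma entire_rectangle:
  assumes "f holomorphic_on UNIV" "a \<le> b" "c \<le> d"
  shows "integral {a..b} (\<lambda>t. f (Complex t c)) + \<i> * integral {c..d} (\<lambda>t. f (Complex b t))
       = integral {a..b} (\<lambda>t. f (Complex t d)) + \<i> * integral {c..d} (\<lambda>t. f (Complex a t))"
proof -
  obtain F where F: "\<And>z. (F has_field_derivative f z) (at z)"
    using entire_primitive[OF assms(1)] by blast
  have cd: "((\<lambda>t. Complex t y) has_vector_derivative 1) (at t within S)" for t y S
    unfolding Complex_eq by (auto intro!: derivative_eq_intros)
  have cd': "((\<lambda>t. Complex x t) has_vector_derivative \<i>) (at t within S)" for t x S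
    unfolding Complex_eq by (auto intro!: derivative_eq_intros)
  have h: "integral {a..b} (\<lambda>t. f (Complex t y)) = F (Complex b y) - F (Complex a y)" for y
    using has_integral_curve[OF assms(2) F, of "\<lambda>t. Complex t y" "\<lambda>_. 1"] cd by (simp add: integral_unique)
  have v: "\<i> * integral {c..d} (\<lambda>t. f (Complex x t)) = F (Complex x d) - F (Complex x c)" for x
    using has_integral_curve[OF assms(3) F, of "\<lambda>t. Complex x t" "\<lambda>_. \<i>"] cd' by (simp flip: integral_mult_right add: integral_unique)
  show ?thesis unfolding h v by simp
qed

section \<open>Hankel's integral for the reciprocal Gamma function\<close>

text \<open>With \<open>hankel_ray\<close>, the pieces of Hankel's loop for 1/Gamma(\<mu> + 1) with
  integrand exp(z) z^(-\<mu> - 1), each stripped of the factor r^(-\<mu>). The circle |z| = r is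
  folded onto its upper half z = r exp(i \<theta>); the rays are the two sides of the cut, |z| = r
  exp t.\<close>

definition hankel_arc :: "real \<Rightarrow> real \<Rightarrow> real" where
  "hankel_arc r \<mu> = integral {0..pi} (\<lambda>\<theta>. exp (r * cos \<theta>) * cos (r * sin \<theta> - \<mu> * \<theta>))"

definition hankel_ray :: "real \<Rightarrow> real \<Rightarrow> real" where
  "hankel_ray r \<mu> = integral {0..} (\<lambda>t. exp (- r * exp t - \<mu> * t))"

text \<open>From exp t >= t^2/2; the constant (1 - \<mu>)^2 / (2r) is the maximum over t of (1 -
  \<mu>) t - r t^2/2. The bound holds for every real \<mu>, in particular for negative ones.\<close>

lemma double_exp_bound:
  assumes "r > 0" "t \<ge> 0"
  shows "exp (- r * exp t - \<mu> * t) \<le> exp ((1 - \<mu>)\<^sup>2 / (2 * r)) * exp (- t :: real)"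
proof -
  have "r * exp t \<ge> r * (t\<^sup>2 / 2)"
    using exp_lower_Taylor_quadratic[OF assms(2)] assms by (intro mult_left_mono) auto
  moreover have "(1 - \<mu>)\<^sup>2 / (2 * r) - (1 - \<mu>) * t + r * (t\<^sup>2 / 2) = (1 - \<mu> - r * t)\<^sup>2 / (2 * r)"
    using assms by (simp add: field_simps power2_eq_square)
  moreover have "(1 - \<mu> - r * t)\<^sup>2 / (2 * r) \<ge> 0"
    using assms by simp
  ultimately have "- r * exp t - \<mu> * t \<le> (1 - \<mu>)\<^sup>2 / (2 * r) + - t"
    by (simp add: algebra_simps)
  thus ?thesis by (simp flip: exp_add)
qed

lemma hankel_ray_absolutely_integrable:
  assumes "r > 0"
  shows "(\<lambda>t. exp (- r * exp t - \<mu> * t)) absolutely_integrable_on {0::real..}"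
  by (rule absolutely_integrable_exp_decay[where K = "exp ((1 - \<mu>)\<^sup>2 / (2 * r))"])
     (use double_exp_bound[OF assms] in \<open>auto intro!: continuous_intros\<close>)

text \<open>Integration of d/d\<theta> of the imaginary part of exp(z) z^(-\<mu>) over the half
  circle, up to a power of r. The boundary term at \<theta> = pi is the one that
  \<open>hankel_ray_rec\<close> produces, multiplied by sin(\<mu> pi), so the combination of arc and
  rays obeys the functional equation of \<open>rGamma\<close>.\<close>

lemma hankel_arc_rec: "\<mu> * hankel_arc r \<mu> - r * hankel_arc r (\<mu> - 1) = exp (- r) * sin (\<mu> * pi)"
proof -
  let ?F = "\<lambda>\<theta>. exp (r * cos \<theta>) * sin (r * sin \<theta> - \<mu> * \<theta>)"
  let ?g = "\<lambda>\<mu> \<theta>. exp (r * cos \<theta>) * cos (r * sin \<theta> - \<mu> * \<theta>)"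
  have "((\<lambda>\<theta>. r * ?g (\<mu> - 1) \<theta> - \<mu> * ?g \<mu> \<theta>) has_integral (?F pi - ?F 0)) {0..pi}"
  proof (rule fundamental_theorem_of_calculus)
    fix \<theta> assume "\<theta> \<in> {0..pi}"
    have eq: "cos (r * sin \<theta> - (\<mu> - 1) * \<theta>)
        = cos \<theta> * cos (r * sin \<theta> - \<mu> * \<theta>) - sin \<theta> * sin (r * sin \<theta> - \<mu> * \<theta>)"
      using cos_add[of \<theta> "r * sin \<theta> - \<mu> * \<theta>"] by (simp add: algebra_simps)
    show "(?F has_vector_derivative r * ?g (\<mu> - 1) \<theta> - \<mu> * ?g \<mu> \<theta>) (at \<theta> within {0..pi})"
      unfolding eq has_real_derivative_iff_has_vector_derivative[symmetric]
      by (auto intro!: derivative_eq_intros simp: algebra_simps)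
  qed simp
  moreover have "((\<lambda>\<theta>. r * ?g (\<mu> - 1) \<theta> - \<mu> * ?g \<mu> \<theta>) has_integral
     (r * hankel_arc r (\<mu> - 1) - \<mu> * hankel_arc r \<mu>)) {0..pi}"
    unfolding hankel_arc_def
    by (intro has_integral_diff has_integral_mult_right integrable_integral
        integrable_continuous_interval continuous_intros)
  ultimately have "r * hankel_arc r (\<mu> - 1) - \<mu> * hankel_arc r \<mu> = ?F pi - ?F 0"
    using has_integral_unique by blast
  thus ?thesis by simp
qed

lemma hankel_ray_rec:
  assumes "r > 0"
  shows "\<mu> * hankel_ray r \<mu> = exp (- r) - r * hankel_ray r (\<mu> - 1)"
proof -
  let ?g = "\<lambda>\<mu> t. exp (- r * exp t - \<mu> * t)"
  note ai = hankel_ray_absolutely_integrable[OF assms]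
  have eq: "?g (\<mu> - 1) t = exp t * ?g \<mu> t" for t
    by (simp flip: exp_add add: algebra_simps)
  have "integral {0..} (\<lambda>t. r * ?g (\<mu> - 1) t + \<mu> * ?g \<mu> t) = - 0 - (- ?g \<mu> 0)"
  proof (rule integral_halfline_FTC)
    show "(\<lambda>t. r * ?g (\<mu> - 1) t + \<mu> * ?g \<mu> t) absolutely_integrable_on {0..}"
      by (intro set_integral_add set_integrable_mult_right ai)
    show "((\<lambda>t. - ?g \<mu> t) has_vector_derivative r * ?g (\<mu> - 1) t + \<mu> * ?g \<mu> t) (at t within {0..})" for t
      unfolding eq has_real_derivative_iff_has_vector_derivative[symmetric]
      by (auto intro!: derivative_eq_intros simp: algebra_simps)
    have "((\<lambda>t. exp ((1 - \<mu>)\<^sup>2 / (2 * r)) * exp (- t :: real)) \<longlongrightarrow> 0) at_top"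
      by (intro tendsto_mult_right_zero) real_asymp
    hence "(?g \<mu> \<longlongrightarrow> 0) at_top"
      by (rule Lim_null_comparison[rotated])
         (use double_exp_bound[OF assms] in \<open>auto intro!: eventually_mono[OF eventually_ge_at_top[of 0]]\<close>)
    thus "((\<lambda>t. - ?g \<mu> t) \<longlongrightarrow> - 0) at_top" by (rule tendsto_minus)
  qed
  also have "integral {0..} (\<lambda>t. r * ?g (\<mu> - 1) t + \<mu> * ?g \<mu> t) =
     r * hankel_ray r (\<mu> - 1) + \<mu> * hankel_ray r \<mu>"
    unfolding hankel_ray_def
    by (subst integral_add) (use ai[THEN set_lebesgue_integral_eq_integral(1)] in \<open>auto intro!: integrable_on_mult_right\<close>)
  finally show ?thesis by simp
qed

lemma has_integral_split:
  fixes f :: "real \<Rightarrow> real"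
  assumes "r > 0" "\<And>x. x > 0 \<Longrightarrow> f x \<ge> 0" "(f has_integral I) {0..}"
  shows "f absolutely_integrable_on {0<..r}" "f absolutely_integrable_on {r..}"
        "integral {0<..r} f + integral {r..} f = I"
proof -
  have hi: "(f has_integral I) {0<..}"
    by (rule iffD1[OF has_integral_spike_set_eq assms(3)]) (auto intro: negligible_subset[of "{0}"])
  have ai: "f absolutely_integrable_on {0<..}"
    by (rule nonnegative_absolutely_integrable_1) (use assms hi in auto)
  show ai1: "f absolutely_integrable_on {0<..r}" and ai2: "f absolutely_integrable_on {r..}"
    by (rule set_integrable_subset[OF ai]; use assms in force)+
  have "integral ({0<..r} \<union> {r..}) f = integral {0<..r} f + integral {r..} f"
    by (intro integral_Un set_lebesgue_integral_eq_integral(1) ai1 ai2)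
       (auto intro: negligible_subset[of "{r}"])
  moreover have "{0<..r} \<union> {r..} = {0<..}" using assms(1) by auto
  ultimately show "integral {0<..r} f + integral {r..} f = I"
    using hi by (simp add: integral_unique)
qed

text \<open>For \<mu> < 0 Euler's integral for Gamma(-\<mu>) converges at 0. It is cut at u = r and
  both halves are written in a logarithmic variable, u = r exp(-t) and u = r exp t; the outer half
  is the Hankel ray.\<close>

lemma Gamma_split:
  assumes "r > 0" "\<mu> < 0"
  shows "(\<lambda>t. exp (- r * exp (- t) + \<mu> * t)) absolutely_integrable_on {0..}"
    and "integral {0..} (\<lambda>t. exp (- r * exp (- t) + \<mu> * t)) + hankel_ray r \<mu> = r powr \<mu> * Gamma (- \<mu>)"
proof -
  define f where "f = (\<lambda>u::real. u powr (- \<mu> - 1) / exp u)"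
  have G: "(f has_integral Gamma (- \<mu>)) {0..}"
    unfolding f_def using Gamma_integral_real[of "- \<mu>"] assms by simp
  note sp = has_integral_split[OF assms(1) _ G]
  have f_step: "u * f u = u powr (- \<mu>) * exp (- u)" if "u > 0" for u
    using that by (simp add: f_def powr_diff exp_minus divide_simps)
  have img1: "(\<lambda>t. r * exp (- t)) ` {0..} = {0<..r}"
  proof (intro equalityI subsetI)
    fix u assume "u \<in> {0<..r}"
    hence "u = r * exp (- ln (r / u))" "ln (r / u) \<ge> 0"
      using assms by (auto simp: exp_minus)
    thus "u \<in> (\<lambda>t. r * exp (- t)) ` {0..}" by blast
  qed (use assms in auto)
  have img2: "(\<lambda>t. r * exp t) ` {0..} = {r..}"
  proof (intro equalityI subsetI)
    fix u assume "u \<in> {r..}"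
    hence "u = r * exp (ln (u / r))" "ln (u / r) \<ge> 0"
      using assms by auto
    thus "u \<in> (\<lambda>t. r * exp t) ` {0..}" by blast
  qed (use assms in auto)
  have "(\<lambda>t. \<bar>- r * exp (- t)\<bar> * f (r * exp (- t))) absolutely_integrable_on {0..} \<and>
        integral {0..} (\<lambda>t. \<bar>- r * exp (- t)\<bar> * f (r * exp (- t))) = integral {0<..r} f"
    by (subst has_absolute_integral_change_of_variables_1'[where S = "{0..}" and g' = "\<lambda>t. - r * exp (- t)"])
       (use assms img1 sp in \<open>auto intro!: derivative_eq_intros injI simp: inj_on_def f_def\<close>)
  moreover have "\<bar>- r * exp (- t)\<bar> * f (r * exp (- t)) = r powr (- \<mu>) * exp (- r * exp (- t) + \<mu> * t)" for t
    using f_step[of "r * exp (- t)"] assms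
    by (simp add: powr_mult exp_powr_real abs_mult algebra_simps flip: exp_add)
  ultimately have 1: "(\<lambda>t. r powr (- \<mu>) * exp (- r * exp (- t) + \<mu> * t)) absolutely_integrable_on {0..}"
       "r powr (- \<mu>) * integral {0..} (\<lambda>t. exp (- r * exp (- t) + \<mu> * t)) = integral {0<..r} f"
    by simp_all
  have "(\<lambda>t. \<bar>r * exp t\<bar> * f (r * exp t)) absolutely_integrable_on {0..} \<and>
        integral {0..} (\<lambda>t. \<bar>r * exp t\<bar> * f (r * exp t)) = integral {r..} f"
    by (subst has_absolute_integral_change_of_variables_1'[where S = "{0..}" and g' = "\<lambda>t. r * exp t"])
       (use assms img2 sp in \<open>auto intro!: derivative_eq_intros injI simp: inj_on_def f_def\<close>)
  moreover have "\<bar>r * exp t\<bar> * f (r * exp t) = r powr (- \<mu>) * exp (- r * exp t - \<mu> * t)" for t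
    using f_step[of "r * exp t"] assms
    by (simp add: powr_mult exp_powr_real exp_diff exp_minus divide_simps mult.commute)
  ultimately have 2: "r powr (- \<mu>) * hankel_ray r \<mu> = integral {r..} f"
    by (simp add: hankel_ray_def)
  show "(\<lambda>t. exp (- r * exp (- t) + \<mu> * t)) absolutely_integrable_on {0..}"
    using set_integrable_mult_right[OF 1(1), of "r powr \<mu>"] assms
    by (simp flip: mult.assoc powr_add)
  have "r powr (- \<mu>) * (integral {0..} (\<lambda>t. exp (- r * exp (- t) + \<mu> * t)) + hankel_ray r \<mu>) = Gamma (- \<mu>)"
    using 1(2) 2 sp(3) by (simp add: ring_distribs f_def)
  hence "r powr \<mu> * r powr (- \<mu>) * (integral {0..} (\<lambda>t. exp (- r * exp (- t) + \<mu> * t)) + hankel_ray r \<mu>)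
     = r powr \<mu> * Gamma (- \<mu>)"
    by simp
  thus "integral {0..} (\<lambda>t. exp (- r * exp (- t) + \<mu> * t)) + hankel_ray r \<mu> = r powr \<mu> * Gamma (- \<mu>)"
    using assms by (simp flip: powr_add)
qed

text \<open>For \<mu> < 0 the circle may be contracted to the origin. With z = r exp(-w) this sends
  Re w to infinity in the strip -pi <= Im w <= 0, where the factor exp(\<mu> T) kills the far side.
  Only the cut remains: together with the ray it gives the full Euler integral, and the reflection
  formula turns sin(\<mu> pi) Gamma(-\<mu>) into a multiple of 1/Gamma(\<mu> + 1).\<close>

lemma hankel_rGamma_neg:
  assumes r: "r > 0" and mu: "\<mu> < 0"
  shows "hankel_arc r \<mu> - sin (\<mu> * pi) * hankel_ray r \<mu> = pi * (r powr \<mu> * rGamma (\<mu> + 1))"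
proof -
  let ?f = "\<lambda>w. exp (of_real r * exp (- w) + of_real \<mu> * w) :: complex"
  let ?g = "\<lambda>t. exp (- r * exp (- t) + \<mu> * t)"
  define E where "E = (\<lambda>T. integral {-pi..0} (\<lambda>\<theta>. Re (?f (Complex T \<theta>))))"
  have hol: "?f holomorphic_on UNIV" by (intro holomorphic_intros)
  have arc: "integral {-pi..0} (\<lambda>\<theta>. Re (?f (Complex 0 \<theta>))) = hankel_arc r \<mu>"
  proof -
    have "Re (?f (Complex 0 \<theta>)) = exp (r * cos (- \<theta>)) * cos (r * sin (- \<theta>) - \<mu> * (- \<theta>))" for \<theta>
      by (simp add: Re_exp Im_exp cos_diff cos_add sin_minus)
    thus ?thesis unfolding hankel_arc_def
      by (subst Henstock_Kurzweil_Integration.integral_reflect_real[symmetric]) simp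
  qed
  have eq: "hankel_arc r \<mu> = E T - sin (\<mu> * pi) * integral {0..T} ?g" if "T \<ge> 0" for T
  proof -
    have io1: "(\<lambda>t. ?f (Complex t y)) integrable_on {0..T}" for y
      unfolding Complex_eq by (intro integrable_continuous_interval continuous_intros)
    have io2: "(\<lambda>\<theta>. ?f (Complex T \<theta>)) integrable_on {-pi..0}" for T
      unfolding Complex_eq by (intro integrable_continuous_interval continuous_intros)
    have i1: "Im (integral {0..T} (\<lambda>t. ?f (Complex t 0))) = 0"
      unfolding Im_integral[OF io1] by (simp add: Im_exp)
    have i2: "Im (integral {0..T} (\<lambda>t. ?f (Complex t (-pi)))) = - sin (\<mu> * pi) * integral {0..T} ?g"
      unfolding Im_integral[OF io1] by (simp add: Im_exp Re_exp mult.commute)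
    note i3 = Re_integral[OF io2]
    show ?thesis
      using arg_cong[OF entire_rectangle[OF hol that, of "-pi" 0], of Im]
      by (simp add: i1 i2 i3 arc E_def)
  qed
  have Elim: "(E \<longlongrightarrow> 0) at_top"
  proof (rule Lim_null_comparison)
    show "((\<lambda>T. pi * exp (r + \<mu> * T)) \<longlongrightarrow> 0) at_top"
      using mu by real_asymp
    have "norm (E T) \<le> (exp (r + \<mu> * T)) * (0 - (-pi))" if "T \<ge> 0" for T
      unfolding E_def
    proof (rule integral_bound)
      show "continuous_on {-pi..0} (\<lambda>\<theta>. Re (?f (Complex T \<theta>)))"
        unfolding Complex_eq by (intro continuous_intros)
      fix \<theta> assume "\<theta> \<in> {- pi..0}"
      have "Re (of_real r * exp (- Complex T \<theta>) + of_real \<mu> * Complex T \<theta>) \<le> r + \<mu> * T"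
      proof -
        have "exp (- T) * cos \<theta> \<le> 1 * 1"
          using that mult_left_mono[OF cos_le_one, of "exp (- T)" \<theta>] exp_le_one_iff[of "- T"]
          by (smt (verit) exp_ge_zero)
        thus ?thesis using r by (simp add: Re_exp)
      qed
      hence "norm (?f (Complex T \<theta>)) \<le> exp (r + \<mu> * T)"
        by simp
      thus "norm (Re (?f (Complex T \<theta>))) \<le> exp (r + \<mu> * T)"
        unfolding real_norm_def by (rule order_trans[OF abs_Re_le_cmod])
    qed simp
    thus "\<forall>\<^sub>F T in at_top. norm (E T) \<le> pi * exp (r + \<mu> * T)"
      by (intro eventually_mono[OF eventually_ge_at_top[of 0]]) (simp add: mult.commute)
  qed
  have lim: "((\<lambda>T. E T - sin (\<mu> * pi) * integral {0..T} ?g) \<longlongrightarrow> 0 - sin (\<mu> * pi) * integral {0..} ?g) at_top"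
    by (intro tendsto_intros Elim integral_halfline_tendsto Gamma_split(1) r mu)
  have ev: "\<forall>\<^sub>F T in at_top. E T - sin (\<mu> * pi) * integral {0..T} ?g = hankel_arc r \<mu>"
    by (rule eventually_mono[OF eventually_ge_at_top[of 0]]) (use eq in auto)
  have "((\<lambda>T::real. hankel_arc r \<mu>) \<longlongrightarrow> 0 - sin (\<mu> * pi) * integral {0..} ?g) at_top"
    using lim unfolding tendsto_cong[OF ev] .
  hence "hankel_arc r \<mu> = - sin (\<mu> * pi) * integral {0..} ?g"
    by (simp add: tendsto_const_iff)
  hence "hankel_arc r \<mu> - sin (\<mu> * pi) * hankel_ray r \<mu> = - sin (\<mu> * pi) * (r powr \<mu> * Gamma (- \<mu>))"
    unfolding Gamma_split(2)[OF r mu, symmetric] by (simp add: ring_distribs)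
  also have "\<dots> = r powr \<mu> * (- sin (\<mu> * pi) * Gamma (- \<mu>))"
    by simp
  also have "- sin (\<mu> * pi) * Gamma (- \<mu>) = pi * rGamma (\<mu> + 1)"
  proof -
    have "rGamma (complex_of_real (- \<mu>)) * rGamma (1 - complex_of_real (- \<mu>)) = of_real (sin (pi * (- \<mu>)) / pi)"
      by (subst rGamma_reflection_complex) (simp flip: sin_of_real)
    also have "1 - complex_of_real (- \<mu>) = of_real (\<mu> + 1)" by simp
    finally have "rGamma (- \<mu>) * rGamma (\<mu> + 1) = - sin (\<mu> * pi) / pi"
      unfolding rGamma_complex_of_real of_real_mult[symmetric] of_real_eq_iff by (simp add: mult.commute)
    moreover have "rGamma (- \<mu>) \<noteq> 0"
      using mu by (auto simp: rGamma_eq_zero_iff elim!: nonpos_Ints_cases')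
    ultimately show ?thesis by (simp add: Gamma_def field_simps)
  qed
  finally show ?thesis by (simp only: mult.left_commute)
qed

text \<open>Induction along the recurrences takes the place of analytic continuation: both sides
  satisfy \<mu> g(\<mu>) = r g(\<mu> - 1), which carries the case \<mu> < 0 upwards one unit at a
  time. Non-integrality keeps every \<mu> that is divided by away from 0.\<close>

lemma hankel_rGamma:
  assumes r: "r > 0" and mu: "\<mu> \<notin> \<int>"
  shows "hankel_arc r \<mu> - sin (\<mu> * pi) * hankel_ray r \<mu> = pi * (r powr \<mu> * rGamma (\<mu> + 1))"
proof -
  have "hankel_arc r \<mu> - sin (\<mu> * pi) * hankel_ray r \<mu> = pi * (r powr \<mu> * rGamma (\<mu> + 1))"
    if "\<mu> < real k" "\<mu> \<notin> \<int>" for k \<mu>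
    using that
  proof (induction k arbitrary: \<mu>)
    case 0
    thus ?case using hankel_rGamma_neg[OF r] by simp
  next
    case (Suc k)
    have "\<mu> - 1 \<notin> \<int>" using Suc.prems(2) by (metis Ints_1 Ints_add diff_add_cancel)
    with Suc.IH[of "\<mu> - 1"] Suc.prems
    have IH: "hankel_arc r (\<mu> - 1) - sin ((\<mu> - 1) * pi) * hankel_ray r (\<mu> - 1)
        = pi * (r powr (\<mu> - 1) * rGamma \<mu>)" by simp
    have [simp]: "sin ((\<mu> - 1) * pi) = - sin (\<mu> * pi)"
      by (simp add: left_diff_distrib sin_diff)
    have "\<mu> * (hankel_arc r \<mu> - sin (\<mu> * pi) * hankel_ray r \<mu>)
        = r * (hankel_arc r (\<mu> - 1) - sin ((\<mu> - 1) * pi) * hankel_ray r (\<mu> - 1))"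
    proof -
      have "\<mu> * (sin (\<mu> * pi) * hankel_ray r \<mu>) = sin (\<mu> * pi) * (exp (- r) - r * hankel_ray r (\<mu> - 1))"
        unfolding hankel_ray_rec[OF r, of \<mu>, symmetric] by simp
      thus ?thesis using hankel_arc_rec[of \<mu> r] by (simp add: algebra_simps)
    qed
    also have "\<dots> = pi * ((r * r powr (\<mu> - 1)) * rGamma \<mu>)"
      unfolding IH by simp
    also have "r * r powr (\<mu> - 1) = r powr \<mu>"
      using r by (simp add: powr_diff)
    also have "rGamma \<mu> = \<mu> * rGamma (\<mu> + 1)" by (simp add: rGamma_plus1)
    also have "pi * (r powr \<mu> * (\<mu> * rGamma (\<mu> + 1))) = \<mu> * (pi * (r powr \<mu> * rGamma (\<mu> + 1)))"
      by simp
    finally show ?case using Suc.prems(2) by (subst (asm) mult_left_cancel) auto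
  qed
  from this[of \<mu> "nat \<lceil>\<mu>\<rceil> + 1"] mu show ?thesis by linarith
qed

section \<open>Schlaefli integrals for Bessel functions\<close>

lemma integral_sums:
  fixes f :: "nat \<Rightarrow> real \<Rightarrow> real"
  assumes "\<And>k. f k integrable_on S" "h integrable_on S"
    and "\<And>n x. x \<in> S \<Longrightarrow> norm (\<Sum>k<n. f k x) \<le> h x"
    and "\<And>x. x \<in> S \<Longrightarrow> (\<lambda>k. f k x) sums g x"
  shows "g integrable_on S" "(\<lambda>k. integral S (f k)) sums integral S g"
proof -
  have "(\<lambda>x. \<Sum>k<n. f k x) integrable_on S" for n
    using assms(1) by (intro integrable_sum) auto
  note dc = dominated_convergence[OF this assms(2,3) assms(4)[unfolded sums_def]]
  show "g integrable_on S" by (rule dc)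
  show "(\<lambda>k. integral S (f k)) sums integral S g"
    using dc(2) assms(1) by (simp add: sums_def integral_sum)
qed

lemma Re_mult_cis: "Re (of_real c * cis a) = c * cos a"
  by simp

text \<open>The sum over k of (-r exp(-i \<theta>))^k / k! is exp(-r exp(-i \<theta>)), and r exp(i
  \<theta>) - r exp(-i \<theta>) = 2 i r sin \<theta>: the two exponentials merge into a pure phase.
  Partial sums are dominated by exp(r)^2.\<close>

lemma integral_exp_convolution_arc:
  assumes "r > 0"
  shows "(\<lambda>k. (-r) ^ k / fact k * hankel_arc r (\<nu> + real k)) sums
           integral {0..pi} (\<lambda>\<theta>. cos (2 * r * sin \<theta> - \<nu> * \<theta>))"
proof -
  let ?f = "\<lambda>k \<theta>. (-r) ^ k / fact k * (exp (r * cos \<theta>) * cos (r * sin \<theta> - (\<nu> + real k) * \<theta>))"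
  have eq: "?f k \<theta> = Re (exp (Complex (r * cos \<theta>) (r * sin \<theta> - \<nu> * \<theta>)) * ((of_real (-r) * cis (-\<theta>)) ^ k /\<^sub>R fact k))" for k \<theta>
  proof -
    have "(of_real (-r) * cis (-\<theta>)) ^ k = of_real ((-r) ^ k) * cis (real k * (-\<theta>))"
      by (simp only: power_mult_distrib Complex.DeMoivre of_real_power)
    also have "exp (Complex (r * cos \<theta>) (r * sin \<theta> - \<nu> * \<theta>)) * (\<dots> /\<^sub>R fact k)
      = of_real ((-r) ^ k / fact k * exp (r * cos \<theta>)) * (cis (r * sin \<theta> - \<nu> * \<theta>) * cis (real k * (-\<theta>)))"
      by (simp add: exp_eq_polar scaleR_conv_of_real field_simps)
    also have "cis (r * sin \<theta> - \<nu> * \<theta>) * cis (real k * (-\<theta>)) = cis (r * sin \<theta> - (\<nu> + real k) * \<theta>)"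
      by (simp add: cis_mult algebra_simps)
    finally show ?thesis by (simp only: Re_mult_cis mult.assoc)
  qed
  have sums: "(\<lambda>k. ?f k \<theta>) sums cos (2 * r * sin \<theta> - \<nu> * \<theta>)" for \<theta>
  proof -
    have "(\<lambda>k. exp (Complex (r * cos \<theta>) (r * sin \<theta> - \<nu> * \<theta>)) * ((of_real (-r) * cis (-\<theta>)) ^ k /\<^sub>R fact k))
        sums (exp (Complex (r * cos \<theta>) (r * sin \<theta> - \<nu> * \<theta>)) * exp (of_real (-r) * cis (-\<theta>)))"
      by (intro sums_mult exp_converges)
    note bounded_linear.sums[OF bounded_linear_Re this]
    moreover have "Complex (r * cos \<theta>) (r * sin \<theta> - \<nu> * \<theta>) + of_real (-r) * cis (-\<theta>)
        = Complex 0 (2 * r * sin \<theta> - \<nu> * \<theta>)"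
      by (simp add: complex_eq_iff)
    ultimately show ?thesis unfolding eq exp_add[symmetric] by (simp add: Re_exp mult.assoc)
  qed
  have bound: "norm (\<Sum>k<n. ?f k \<theta>) \<le> exp r * exp r" for n \<theta>
  proof -
    have "norm (\<Sum>k<n. ?f k \<theta>) \<le> (\<Sum>k<n. exp r * (r ^ k /\<^sub>R fact k))"
    proof (rule sum_norm_le)
      fix k
      have "exp (r * cos \<theta>) * \<bar>cos (r * sin \<theta> - (\<nu> + real k) * \<theta>)\<bar> \<le> exp r * 1"
        using assms by (intro mult_mono) auto
      hence "r ^ k / fact k * (exp (r * cos \<theta>) * \<bar>cos (r * sin \<theta> - (\<nu> + real k) * \<theta>)\<bar>) \<le> r ^ k / fact k * (exp r * 1)"
        using assms by (intro mult_left_mono) auto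
      thus "norm (?f k \<theta>) \<le> exp r * (r ^ k /\<^sub>R fact k)"
        using assms by (simp add: abs_mult power_abs divide_inverse mult_ac)
    qed
    also have "\<dots> = exp r * (\<Sum>k<n. r ^ k /\<^sub>R fact k)"
      by (simp add: sum_distrib_left)
    also have "(\<Sum>k<n. r ^ k /\<^sub>R fact k) \<le> exp r"
      using sum_le_suminf[of "\<lambda>k. r ^ k /\<^sub>R fact k" "{..<n}"] exp_converges[of r] assms
      by (auto simp: sums_iff)
    finally show ?thesis by simp
  qed
  have "(\<lambda>k. integral {0..pi} (?f k)) sums integral {0..pi} (\<lambda>\<theta>. cos (2 * r * sin \<theta> - \<nu> * \<theta>))"
    by (rule integral_sums[where h = "\<lambda>_. exp r * exp r"])
       (use sums bound in \<open>auto intro!: integrable_continuous_interval continuous_intros\<close>)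
  thus ?thesis by (simp add: hankel_arc_def)
qed

lemma exp_sinh_eq: "exp (- x * sinh t - \<nu> * t) = exp (- (x / 2) * exp t - \<nu> * t) * exp (x / 2 * exp (- t))" for x t :: real
  by (simp add: sinh_def algebra_simps flip: exp_add)

lemma exp_sinh_bound:
  assumes "x > 0" "t \<ge> 0"
  shows "exp (- x * sinh t - \<nu> * t) \<le> exp (x / 2) * exp ((1 - \<nu>)\<^sup>2 / x) * exp (- t :: real)"
proof -
  have "exp (- x * sinh t - \<nu> * t) \<le> (exp ((1 - \<nu>)\<^sup>2 / (2 * (x / 2))) * exp (- t)) * exp (x / 2)"
    unfolding exp_sinh_eq using assms
    by (intro mult_mono double_exp_bound) auto
  thus ?thesis by (simp add: mult_ac)
qed

lemma exp_sinh_absolutely_integrable: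
  assumes "x > 0"
  shows "(\<lambda>t. exp (- x * sinh t - \<nu> * t)) absolutely_integrable_on {0::real..}"
  by (rule absolutely_integrable_exp_decay[where K = "exp (x / 2) * exp ((1 - \<nu>)\<^sup>2 / x)"])
     (use exp_sinh_bound[OF assms] in \<open>auto intro!: continuous_intros\<close>)

text \<open>Here the exponents combine to r exp(-t) - r exp t = -2r sinh t. All terms are positive,
  so the limit itself dominates the partial sums.\<close>

lemma integral_exp_convolution_ray:
  assumes "r > 0"
  shows "(\<lambda>k. r ^ k / fact k * hankel_ray r (\<nu> + real k)) sums
           integral {0..} (\<lambda>t. exp (- (2 * r) * sinh t - \<nu> * t))"
proof -
  let ?f = "\<lambda>k t. r ^ k / fact k * exp (- r * exp t - (\<nu> + real k) * t)"
  have eq: "?f k t = exp (- r * exp t - \<nu> * t) * ((r * exp (- t)) ^ k /\<^sub>R fact k)" for k t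
    by (simp add: power_mult_distrib divide_inverse mult_ac exp_of_nat_mult[symmetric] algebra_simps flip: exp_add)
  have sums: "(\<lambda>k. ?f k t) sums exp (- (2 * r) * sinh t - \<nu> * t)" for t
    unfolding eq exp_sinh_eq using sums_mult[OF exp_converges[of "r * exp (- t)"]] by simp
  have bound: "norm (\<Sum>k<n. ?f k t) \<le> exp (- (2 * r) * sinh t - \<nu> * t)" for n t
    using sum_le_suminf[of "\<lambda>k. ?f k t" "{..<n}"] sums[of t] assms
    by (auto simp: sums_iff sum_nonneg)
  have "(\<lambda>k. integral {0..} (?f k)) sums integral {0..} (\<lambda>t. exp (- (2 * r) * sinh t - \<nu> * t))"
  proof (rule integral_sums(2)[OF _ _ bound sums])
    show "?f k integrable_on {0..}" for k
      using hankel_ray_absolutely_integrable[OF assms]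
      by (intro integrable_on_mult_right set_lebesgue_integral_eq_integral(1))
    show "(\<lambda>t. exp (- (2 * r) * sinh t - \<nu> * t)) integrable_on {0..}"
      using assms by (intro set_lebesgue_integral_eq_integral(1) exp_sinh_absolutely_integrable) auto
  qed
  thus ?thesis by (simp add: hankel_ray_def)
qed

lemma bessel_J_Schlaefli:
  assumes x: "x > 0" and nu: "\<nu> \<notin> \<int>"
  shows "pi * bessel_J \<nu> x = integral {0..pi} (\<lambda>\<theta>. cos (x * sin \<theta> - \<nu> * \<theta>))
            - sin (\<nu> * pi) * integral {0..} (\<lambda>t. exp (- x * sinh t - \<nu> * t))"
proof -
  \<comment> \<open>The radius of Hankel's contour is free. With x/2 the factor r^(\<nu> + k) of
    Hankel's formula accounts for the power (x/2)^(2k + \<nu>) up to r^k, which is the coefficient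
    of the exponential series.\<close>
  define r where "r = x / 2"
  have r: "r > 0" and x_eq: "x = 2 * r" using x by (simp_all add: r_def)
  let ?t = "\<lambda>k. (-1) ^ k * rGamma (real k + \<nu> + 1) / fact k * r powr (2 * real k + \<nu>)"
  have "pi * ?t k = (-r) ^ k / fact k * hankel_arc r (\<nu> + real k)
          - sin (\<nu> * pi) * (r ^ k / fact k * hankel_ray r (\<nu> + real k))" for k
  proof -
    have "\<nu> + real k \<notin> \<int>" using nu by (metis Ints_diff Ints_of_nat add_diff_cancel_right')
    note H = hankel_rGamma[OF r this]
    \<comment> \<open>This sign cancels the (-1)^k of the Bessel series, which is why the ray series
      has coefficients r^k/k! and the arc series (-r)^k/k!.\<close>
    have s: "sin ((\<nu> + real k) * pi) = (-1) ^ k * sin (\<nu> * pi)"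
      by (simp add: ring_distribs sin_add)
    have "r powr (2 * real k + \<nu>) = r ^ k * r powr (\<nu> + real k)"
      using r by (simp add: powr_add powr_realpow[symmetric] mult_ac)
        (simp flip: powr_add add: mult.commute)
    hence "pi * ?t k = (-1) ^ k * r ^ k / fact k * (pi * (r powr (\<nu> + real k) * rGamma (\<nu> + real k + 1)))"
      by (simp add: add_ac mult_ac)
    also have "\<dots> = (-1) ^ k * r ^ k / fact k * (hankel_arc r (\<nu> + real k) - (-1) ^ k * sin (\<nu> * pi) * hankel_ray r (\<nu> + real k))"
      unfolding H[symmetric] s ..
    also have "\<dots> = (-r) ^ k / fact k * hankel_arc r (\<nu> + real k)
          - ((-1) ^ k * (-1) ^ k) * sin (\<nu> * pi) * (r ^ k / fact k * hankel_ray r (\<nu> + real k))"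
      by (simp add: power_minus[of r] algebra_simps)
    finally show ?thesis by (simp flip: power_mult_distrib)
  qed
  hence "(\<lambda>k. pi * ?t k) sums (integral {0..pi} (\<lambda>\<theta>. cos (2 * r * sin \<theta> - \<nu> * \<theta>))
            - sin (\<nu> * pi) * integral {0..} (\<lambda>t. exp (- (2 * r) * sinh t - \<nu> * t)))"
    using sums_diff[OF integral_exp_convolution_arc[OF r] sums_mult[OF integral_exp_convolution_ray[OF r]]]
    by presburger
  moreover have "summable ?t"
    using sums_summable[OF calculation] by (simp only: summable_cmult_iff) simp
  hence "pi * bessel_J \<nu> x = (\<Sum>k. pi * ?t k)"
    unfolding bessel_J_def r_def[symmetric] by (rule suminf_mult[symmetric])
  ultimately show ?thesis by (simp add: sums_iff x_eq)
qed

section \<open>Weber's quotient and its limit at integer order\<close>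

lemma integral_flip:
  fixes f :: "real \<Rightarrow> real"
  assumes "f integrable_on {0..b}"
  shows "integral {0..b} (\<lambda>x. f (b - x)) = integral {0..b} f"
proof -
  have "((\<lambda>x. f (- x)) has_integral integral {0..b} f) {-b..-0}"
    using has_integral_reflect_real[of f "integral {0..b} f" b 0] assms by (simp add: integrable_integral)
  from has_integral_shift_real_ivl[OF this, of "- b"] show ?thesis
    by (simp add: integral_unique)
qed

definition schlaefli_sin :: "real \<Rightarrow> real \<Rightarrow> real" where
  "schlaefli_sin x \<nu> = integral {0..pi} (\<lambda>\<theta>. sin (x * sin \<theta> - \<nu> * \<theta>))"

definition schlaefli_exp :: "real \<Rightarrow> real \<Rightarrow> real" where
  "schlaefli_exp x \<nu> = integral {0..} (\<lambda>t. exp (- x * sinh t - \<nu> * t))"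

text \<open>Reflecting \<theta> to pi - \<theta> in the arc integral of order -\<nu> adds \<nu> pi
  to the phase, so the cosine integrals cancel in the numerator and the sine integral appears. Every
  surviving term has the factor sin(\<nu> pi), and the right-hand side makes sense at integers
  too.\<close>

lemma Weber_Schlaefli:
  assumes x: "x > 0" and nu: "\<nu> \<notin> \<int>"
  shows "(bessel_J \<nu> x * cos (\<nu> * pi) - bessel_J (- \<nu>) x) / sin (\<nu> * pi) =
           (schlaefli_sin x \<nu> - (schlaefli_exp x (- \<nu>) + cos (\<nu> * pi) * schlaefli_exp x \<nu>)) / pi"
proof -
  let ?C = "\<lambda>\<nu>. integral {0..pi} (\<lambda>\<theta>. cos (x * sin \<theta> - \<nu> * \<theta>))"
  have "- \<nu> \<notin> \<int>" using nu by (metis Ints_minus minus_minus)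
  note J = bessel_J_Schlaefli[OF x nu] bessel_J_Schlaefli[OF x this]
  have "?C (- \<nu>) = integral {0..pi} (\<lambda>\<theta>. cos (x * sin (pi - \<theta>) - (- \<nu>) * (pi - \<theta>)))"
    by (rule integral_flip[symmetric]) (intro integrable_continuous_interval continuous_intros)
  also have "(\<lambda>\<theta>. cos (x * sin (pi - \<theta>) - (- \<nu>) * (pi - \<theta>)))
      = (\<lambda>\<theta>. cos (\<nu> * pi) * cos (x * sin \<theta> - \<nu> * \<theta>) - sin (\<nu> * pi) * sin (x * sin \<theta> - \<nu> * \<theta>))"
    by (rule ext, subst cos_add[symmetric]) (simp add: algebra_simps)
  also have "integral {0..pi} \<dots> = cos (\<nu> * pi) * ?C \<nu> - sin (\<nu> * pi) * schlaefli_sin x \<nu>"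
    unfolding schlaefli_sin_def
    by (subst integral_diff) (auto intro!: integrable_continuous_interval continuous_intros)
  finally have C: "?C (- \<nu>) = cos (\<nu> * pi) * ?C \<nu> - sin (\<nu> * pi) * schlaefli_sin x \<nu>" .
  have "sin (\<nu> * pi) \<noteq> 0"
    using nu by (auto simp: sin_zero_iff_int2)
  moreover have "pi * (bessel_J \<nu> x * cos (\<nu> * pi) - bessel_J (- \<nu>) x) =
     sin (\<nu> * pi) * (schlaefli_sin x \<nu> - (schlaefli_exp x (- \<nu>) + cos (\<nu> * pi) * schlaefli_exp x \<nu>))"
    using J C by (simp add: schlaefli_exp_def right_diff_distrib ring_distribs flip: mult.assoc)
  ultimately show ?thesis by (simp add: field_simps)
qed

lemma isCont_schlaefli_sin: "isCont (schlaefli_sin x) \<nu>"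
  unfolding continuous_at_sequentially schlaefli_sin_def o_def
proof (intro allI impI)
  fix s assume s: "s \<longlonglongrightarrow> \<nu>"
  show "(\<lambda>n. integral {0..pi} (\<lambda>\<theta>. sin (x * sin \<theta> - s n * \<theta>))) \<longlonglongrightarrow> integral {0..pi} (\<lambda>\<theta>. sin (x * sin \<theta> - \<nu> * \<theta>))"
    by (rule dominated_convergence(2)[where h = "\<lambda>_. 1"])
       (auto intro!: integrable_continuous_interval continuous_intros tendsto_intros s)
qed

lemma isCont_schlaefli_exp:
  assumes "x > 0"
  shows "isCont (schlaefli_exp x) \<nu>"
  unfolding continuous_at_sequentially schlaefli_exp_def o_def
proof (intro allI impI)
  fix s assume s: "s \<longlonglongrightarrow> \<nu>"
  then obtain M where M: "\<And>n. norm (s n) \<le> M"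
    by (metis BseqE convergentI convergent_imp_Bseq)
  show "(\<lambda>n. integral {0..} (\<lambda>t. exp (- x * sinh t - s n * t))) \<longlonglongrightarrow> integral {0..} (\<lambda>t. exp (- x * sinh t - \<nu> * t))"
  proof (rule dominated_convergence(2)[where h = "\<lambda>t. exp (- x * sinh t - (- M) * t)"])
    show int: "(\<lambda>t. exp (- x * sinh t - c * t)) integrable_on {0..}" for c
      by (intro set_lebesgue_integral_eq_integral(1) exp_sinh_absolutely_integrable assms)
    show "norm (exp (- x * sinh t - s n * t)) \<le> exp (- x * sinh t - (- M) * t)" if "t \<in> {0..}" for n t
      using mult_right_mono[of "- s n" M t] M[of n] that by (simp add: abs_le_iff)
    show "(\<lambda>t. exp (- x * sinh t - (- M) * t)) integrable_on {0..}" by (rule int)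
  qed (intro tendsto_intros s)
qed

text \<open>Within distance 1 of N the only integer is N itself, so on a punctured neighbourhood
  Weber's quotient agrees with an expression that is continuous at N.\<close>

lemma bessel_Y_Schlaefli:
  assumes x: "x > 0"
  shows "pi * bessel_Y N x = schlaefli_sin x (real N) - (schlaefli_exp x (- real N) + (-1) ^ N * schlaefli_exp x (real N))"
proof -
  let ?R = "\<lambda>\<nu>. (schlaefli_sin x \<nu> - (schlaefli_exp x (- \<nu>) + cos (\<nu> * pi) * schlaefli_exp x \<nu>)) / pi"
  let ?W = "\<lambda>\<nu>. (bessel_J \<nu> x * cos (\<nu> * pi) - bessel_J (- \<nu>) x) / sin (\<nu> * pi)"
  have "isCont (\<lambda>\<nu>. schlaefli_exp x (- \<nu>)) (real N)"
    using isCont_o2[OF _ isCont_schlaefli_exp[OF x], of "real N" "\<lambda>\<nu>. - \<nu>"] by auto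
  hence "isCont ?R (real N)"
    by (intro continuous_intros isCont_schlaefli_sin isCont_schlaefli_exp x) auto
  hence "(?R \<longlongrightarrow> ?R (real N)) (at (real N))"
    by (simp add: isCont_def)
  moreover have "\<forall>\<^sub>F \<nu> in at (real N). ?R \<nu> = ?W \<nu>"
  proof -
    have "\<nu> \<notin> \<int>" if "\<nu> \<noteq> real N" "dist \<nu> (real N) < 1" for \<nu>
    proof
      assume "\<nu> \<in> \<int>"
      then obtain k where "\<nu> = of_int k" by (auto elim: Ints_cases)
      hence "\<nu> = of_int k" "\<bar>of_int (k - int N)\<bar> < (1::real)"
        using that by (simp_all add: dist_real_def)
      hence "\<bar>k - int N\<bar> < 1" by linarith
      thus False using that \<open>\<nu> = of_int k\<close> by simp
    qed
    thus ?thesis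
      unfolding eventually_at using Weber_Schlaefli[OF x] by (intro exI[of _ 1]) auto
  qed
  ultimately have "(?W \<longlongrightarrow> ?R (real N)) (at (real N))"
    by (rule Lim_transform_eventually)
  hence "bessel_Y N x = ?R (real N)"
    unfolding bessel_Y_def by (intro tendsto_Lim) auto
  thus ?thesis by simp
qed

section \<open>Contour shift for Bessel functions of even order\<close>

lemma sinh_complex_of_real: "sinh (complex_of_real a) = of_real (sinh a)"
  by (simp add: sinh_def scaleR_conv_of_real flip: exp_of_real)

lemma cosh_complex_of_real: "cosh (complex_of_real a) = of_real (cosh a)"
  by (simp add: cosh_def scaleR_conv_of_real flip: exp_of_real)

lemma cosh_i_of_real: "cosh (\<i> * of_real a) = of_real (cos a)"
  by (simp add: cosh_def cos_exp_eq scaleR_conv_of_real mult.commute flip: cos_of_real)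

lemma sinh_i_of_real: "sinh (\<i> * of_real a) = \<i> * of_real (sin a)"
  by (simp add: sinh_conv_sin flip: sin_of_real mult.assoc)

text \<open>Shift of exp(i x cosh w - 2nw) from the real axis to Im w = pi/2. There cosh w = i sinh
  t gives the decaying exponential and exp(-n i pi) gives the sign; on the segment from 0 to i pi/2
  one has cosh w = cos \<phi>. In the strip |exp(i x cosh w)| <= 1, so the far side is at most of
  size exp(-2nT).\<close>

lemma integral_exp_i_cosh:
  assumes x: "x > 0" and n: "n \<ge> 1"
  shows "(\<lambda>u. cos (x * cosh u) * exp (- 2 * real n * u)) absolutely_integrable_on {0..}"
    and "integral {0..} (\<lambda>u. cos (x * cosh u) * exp (- 2 * real n * u)) =
         (-1) ^ n * schlaefli_exp x (2 * real n) - integral {0..pi/2} (\<lambda>\<phi>. sin (x * cos \<phi> - 2 * real n * \<phi>))"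
proof -
  let ?f = "\<lambda>w. exp (\<i> * of_real x * cosh w - 2 * of_nat n * w) :: complex"
  let ?c = "\<lambda>u. cos (x * cosh u) * exp (- 2 * real n * u)"
  define E where "E = (\<lambda>T. integral {0..pi/2} (\<lambda>\<phi>. Im (?f (Complex T \<phi>))))"
  have hol: "?f holomorphic_on UNIV"
    unfolding cosh_def by (intro holomorphic_intros)
  have cont: "continuous_on A ?f" for A
    using hol holomorphic_on_imp_continuous_on continuous_on_subset by blast
  have cosh_C: "cosh (Complex t \<phi>) = Complex (cosh t * cos \<phi>) (sinh t * sin \<phi>)" for t \<phi>
    by (simp add: Complex_eq cosh_add cosh_complex_of_real sinh_complex_of_real cosh_i_of_real sinh_i_of_real mult.left_commute)
  show ai: "?c absolutely_integrable_on {0..}"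
  proof (rule absolutely_integrable_exp_decay[where K = 1])
    fix t :: real assume "t \<ge> 0"
    hence "exp (- 2 * real n * t) \<le> exp (- t)"
      using n mult_right_mono[of 1 "2 * real n" t] by simp
    moreover have "\<bar>cos (x * cosh t)\<bar> * exp (- 2 * real n * t) \<le> 1 * exp (- 2 * real n * t)"
      by (intro mult_right_mono) auto
    ultimately have "\<bar>cos (x * cosh t)\<bar> * exp (- 2 * real n * t) \<le> 1 * exp (- t)"
      by linarith
    thus "norm (?c t) \<le> 1 * exp (- t)"
      by (simp only: real_norm_def abs_mult abs_exp_cancel)
  qed (intro continuous_intros)
  have eq: "integral {0..T} ?c = (-1) ^ n * integral {0..T} (\<lambda>t. exp (- x * sinh t - 2 * real n * t))
     - integral {0..pi/2} (\<lambda>\<phi>. sin (x * cos \<phi> - 2 * real n * \<phi>)) + E T" if "T \<ge> 0" for T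
  proof -
    have io1: "(\<lambda>t. ?f (Complex t y)) integrable_on {0..T}" for y
      by (intro integrable_continuous_interval continuous_on_compose2[OF cont])
         (auto simp: Complex_eq intro!: continuous_intros)
    have io2: "(\<lambda>\<theta>. ?f (Complex T \<theta>)) integrable_on {0..pi/2}" for T
      by (intro integrable_continuous_interval continuous_on_compose2[OF cont])
         (auto simp: Complex_eq intro!: continuous_intros)
    have i1: "Re (integral {0..T} (\<lambda>t. ?f (Complex t 0))) = integral {0..T} ?c"
      unfolding Re_integral[OF io1] by (simp add: cosh_C Re_exp mult.commute)
    have i2: "Re (integral {0..T} (\<lambda>t. ?f (Complex t (pi/2)))) = (-1) ^ n * integral {0..T} (\<lambda>t. exp (- x * sinh t - 2 * real n * t))"
      unfolding Re_integral[OF io1] by (simp add: cosh_C Re_exp mult.commute[of _ "(-1) ^ n"])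
    have i3: "Im (integral {0..pi/2} (\<lambda>\<phi>. ?f (Complex 0 \<phi>))) = integral {0..pi/2} (\<lambda>\<phi>. sin (x * cos \<phi> - 2 * real n * \<phi>))"
      unfolding Im_integral[OF io2] by (simp add: cosh_C Im_exp)
    show ?thesis
      using arg_cong[OF entire_rectangle[OF hol that, of 0 "pi/2"], of Re]
      by (simp add: i1 i2 i3 Im_integral[OF io2] E_def)
  qed
  have Elim: "(E \<longlongrightarrow> 0) at_top"
  proof (rule Lim_null_comparison)
    show "((\<lambda>T. (pi / 2) * exp (- 2 * real n * T)) \<longlongrightarrow> 0) at_top"
      using n by real_asymp
    have "norm (E T) \<le> (exp (- 2 * real n * T)) * (pi / 2 - 0)" if "T \<ge> 0" for T
      unfolding E_def
    proof (rule integral_bound)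
      show "continuous_on {0..pi/2} (\<lambda>\<phi>. Im (?f (Complex T \<phi>)))"
        by (intro continuous_on_Im continuous_on_compose2[OF cont])
           (auto simp: Complex_eq intro!: continuous_intros)
      fix \<phi> assume \<phi>: "\<phi> \<in> {0..pi/2}"
      have "sin \<phi> \<ge> 0" using \<phi> by (intro sin_ge_zero) auto
      hence "norm (?f (Complex T \<phi>)) \<le> exp (- 2 * real n * T)"
        unfolding cosh_C using x that by (simp add: mult_nonneg_nonneg)
      thus "norm (Im (?f (Complex T \<phi>))) \<le> exp (- 2 * real n * T)"
        unfolding real_norm_def by (rule order_trans[OF abs_Im_le_cmod])
    qed simp
    thus "\<forall>\<^sub>F T in at_top. norm (E T) \<le> (pi / 2) * exp (- 2 * real n * T)"
      by (intro eventually_mono[OF eventually_ge_at_top[of 0]]) (simp add: mult.commute)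
  qed
  have "((\<lambda>T. (-1) ^ n * integral {0..T} (\<lambda>t. exp (- x * sinh t - 2 * real n * t))
     - integral {0..pi/2} (\<lambda>\<phi>. sin (x * cos \<phi> - 2 * real n * \<phi>)) + E T) \<longlongrightarrow>
        (-1) ^ n * schlaefli_exp x (2 * real n) - integral {0..pi/2} (\<lambda>\<phi>. sin (x * cos \<phi> - 2 * real n * \<phi>)) + 0) at_top"
    unfolding schlaefli_exp_def
    by (intro tendsto_intros Elim integral_halfline_tendsto exp_sinh_absolutely_integrable x)
  moreover have "\<forall>\<^sub>F T in at_top. (-1) ^ n * integral {0..T} (\<lambda>t. exp (- x * sinh t - 2 * real n * t))
     - integral {0..pi/2} (\<lambda>\<phi>. sin (x * cos \<phi> - 2 * real n * \<phi>)) + E T = integral {0..T} ?c"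
    by (rule eventually_mono[OF eventually_ge_at_top[of 0]]) (use eq in auto)
  ultimately have "((\<lambda>T. integral {0..T} ?c) \<longlongrightarrow> (-1) ^ n * schlaefli_exp x (2 * real n)
      - integral {0..pi/2} (\<lambda>\<phi>. sin (x * cos \<phi> - 2 * real n * \<phi>)) + 0) at_top"
    by (rule Lim_transform_eventually)
  from tendsto_unique[OF _ integral_halfline_tendsto[OF ai] this]
  show "integral {0..} ?c = (-1) ^ n * schlaefli_exp x (2 * real n) - integral {0..pi/2} (\<lambda>\<phi>. sin (x * cos \<phi> - 2 * real n * \<phi>))"
    by simp
qed

text \<open>The interval is halved at pi/2 and \<theta> = pi/2 - \<phi>, pi/2 + \<phi> is
  substituted, which turns sin \<theta> into cos \<phi> as in \<open>integral_exp_i_cosh\<close>.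
  For order 2n the phase shift is n pi, a mere sign.\<close>

lemma schlaefli_sin_even:
  "schlaefli_sin x (2 * real n) = (-1) ^ n * (integral {0..pi/2} (\<lambda>\<phi>. sin (x * cos \<phi> + 2 * real n * \<phi>))
     + integral {0..pi/2} (\<lambda>\<phi>. sin (x * cos \<phi> - 2 * real n * \<phi>)))"
proof -
  let ?h = "\<lambda>\<theta>. sin (x * sin \<theta> - 2 * real n * \<theta>)"
  have io: "?h integrable_on {a..b}" for a b
    by (intro integrable_continuous_interval continuous_intros)
  have n1: "sin (y - real n * pi) = (-1) ^ n * sin y" for y
    by (simp add: sin_diff)
  have "integral {0..pi/2} ?h = integral {0..pi/2} (\<lambda>\<phi>. ?h (pi/2 - \<phi>))"
    by (rule integral_flip[symmetric, OF io])
  also have "(\<lambda>\<phi>. ?h (pi/2 - \<phi>)) = (\<lambda>\<phi>. (-1) ^ n * sin (x * cos \<phi> + 2 * real n * \<phi>))"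
    by (rule ext, subst n1[symmetric]) (simp add: sin_diff algebra_simps)
  finally have 1: "integral {0..pi/2} ?h = (-1) ^ n * integral {0..pi/2} (\<lambda>\<phi>. sin (x * cos \<phi> + 2 * real n * \<phi>))"
    by simp
  have "integral {pi/2..pi} ?h = integral {0..pi/2} (\<lambda>\<phi>. ?h (\<phi> + pi/2))"
  proof -
    have "((\<lambda>\<phi>. ?h (\<phi> + pi/2)) has_integral integral {pi/2..pi} ?h) {pi/2 - pi/2..pi - pi/2}"
      by (rule has_integral_shift_real_ivl[OF integrable_integral[OF io]])
    moreover have "{pi/2 - pi/2..pi - pi/2} = {0..pi/2}" by simp
    ultimately show ?thesis
      by (intro integral_unique[symmetric]) (simp only:)
  qed
  also have "(\<lambda>\<phi>. ?h (\<phi> + pi/2)) = (\<lambda>\<phi>. (-1) ^ n * sin (x * cos \<phi> - 2 * real n * \<phi>))"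
    by (rule ext, subst n1[symmetric]) (simp add: sin_add algebra_simps)
  finally have 2: "integral {pi/2..pi} ?h = (-1) ^ n * integral {0..pi/2} (\<lambda>\<phi>. sin (x * cos \<phi> - 2 * real n * \<phi>))"
    by simp
  have "schlaefli_sin x (2 * real n) = integral {0..pi/2} ?h + integral {pi/2..pi} ?h"
    unfolding schlaefli_sin_def by (rule Henstock_Kurzweil_Integration.integral_combine[symmetric]) (auto intro: io)
  thus ?thesis unfolding 1 2 by (simp add: ring_distribs)
qed

text \<open>The part \<open>sinh (2nw)\<close> of \<open>cosh (2nw) = exp (-2nw) + sinh (2nw)\<close> has the elementary
  primitive \<open>F (cosh w)\<close>; the part \<open>exp (-2nw)\<close> is moved to the real axis.\<close>
lemma bessel_Y_even:
  assumes x: "x > 0" and n: "n \<ge> 1"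
    and U: "\<And>w. U (cosh w) * sinh w = sinh (2 * of_nat n * w)"
    and F: "\<And>z. (F has_field_derivative exp (\<i> * of_real x * z) * U z) (at z)"
    and F0: "((\<lambda>s. F (\<i> * of_real s)) \<longlongrightarrow> 0) at_top"
  shows "(-1) ^ n * pi * bessel_Y (2 * n) x =
     2 * Re (F 1) - 2 * integral {0..} (\<lambda>u. cos (x * cosh u) * exp (- 2 * real n * u))"
proof -
  have dF: "((\<lambda>w. F (cosh w)) has_field_derivative exp (\<i> * of_real x * cosh w) * sinh (2 * of_nat n * w)) (at w)" for w
  proof -
    have "(cosh has_field_derivative sinh w) (at w)" by (auto intro!: derivative_eq_intros)
    from DERIV_chain'[OF this F] show ?thesis by (simp only: mult.assoc U)
  qed
  \<comment> \<open>Along w = i \<phi> the value cosh w runs from 1 to 0, so this piece contributes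
    F 0 - F 1. The piece along w = t + i pi/2, treated next, runs from 0 to i times infinity, where
    F vanishes by \<open>F0\<close>.\<close>
  have "((\<lambda>\<phi>. \<i> * (exp (\<i> * of_real x * cosh (\<i> * of_real \<phi>)) * sinh (2 * of_nat n * (\<i> * of_real \<phi>)))) has_integral
      F (cosh (\<i> * of_real (pi/2))) - F (cosh (\<i> * of_real 0))) {0..pi/2}"
    by (rule has_integral_curve[OF _ dF]) (auto intro!: derivative_eq_intros)
  moreover have "\<i> * (exp (\<i> * of_real x * cosh (\<i> * of_real \<phi>)) * sinh (2 * of_nat n * (\<i> * of_real \<phi>)))
      = - (exp (\<i> * of_real (x * cos \<phi>)) * of_real (sin (2 * real n * \<phi>)))" for \<phi>
  proof -
    have "sinh (2 * of_nat n * (\<i> * of_real \<phi>)) = \<i> * of_real (sin (2 * real n * \<phi>))"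
      using sinh_i_of_real[of "2 * real n * \<phi>"] by (simp add: mult_ac)
    thus ?thesis by (simp add: cosh_i_of_real mult_ac)
  qed
  ultimately have "((\<lambda>\<phi>. - (exp (\<i> * of_real (x * cos \<phi>)) * of_real (sin (2 * real n * \<phi>)))) has_integral F 0 - F 1) {0..pi/2}"
    by (simp only: cosh_i_of_real) simp
  from has_integral_linear[OF has_integral_neg[OF this] bounded_linear_Re]
  have arc: "integral {0..pi/2} (\<lambda>\<phi>. cos (x * cos \<phi>) * sin (2 * real n * \<phi>)) = Re (F 1) - Re (F 0)"
    by (auto simp: o_def Re_exp dest!: integral_unique)
  let ?g = "\<lambda>t. (-1) ^ n * (exp (- x * sinh t - (- 2 * real n) * t) - exp (- x * sinh t - 2 * real n * t)) / 2"
  note ai = exp_sinh_absolutely_integrable[OF x]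
  note io = ai[THEN set_lebesgue_integral_eq_integral(1)]
  have ai': "?g absolutely_integrable_on {0..}"
    by (intro set_integrable_divide set_integrable_mult_right set_integral_diff ai)
  have int_g: "integral {0..} ?g = (-1) ^ n * (schlaefli_exp x (- 2 * real n) - schlaefli_exp x (2 * real n)) / 2"
    unfolding schlaefli_exp_def by (simp add: integral_diff io[of "- 2 * real n", simplified] io[of "2 * real n", simplified])
  have aiC: "(\<lambda>t. complex_of_real (?g t)) absolutely_integrable_on {0..}"
    by (rule absolutely_integrable_linear[OF ai' bounded_linear_of_real, unfolded o_def])
  have "integral {0..} (\<lambda>t. complex_of_real (?g t)) = 0 - F (\<i> * of_real (sinh 0))"
  proof (rule integral_halfline_FTC)
    show "(\<lambda>t. complex_of_real (?g t)) absolutely_integrable_on {0..}" by (rule aiC)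
    show "((\<lambda>t. F (\<i> * of_real (sinh t))) \<longlongrightarrow> 0) at_top"
      by (rule filterlim_compose[OF F0]) real_asymp
    fix t :: real
    have 1: "cosh (of_real t + \<i> * of_real (pi / 2)) = \<i> * of_real (sinh t)" for t
      by (simp only: cosh_add cosh_complex_of_real sinh_complex_of_real cosh_i_of_real sinh_i_of_real) simp
    have 2: "sinh (2 * of_nat n * (of_real t + \<i> * of_real (pi / 2))) = of_real ((-1) ^ n * sinh (2 * real n * t))" for t
    proof -
      have "2 * of_nat n * (of_real t + \<i> * of_real (pi / 2)) = of_real (2 * real n * t) + \<i> * of_real (real n * pi)"
        by (simp add: algebra_simps)
      also have "sinh \<dots> = of_real ((-1) ^ n * sinh (2 * real n * t))"
        by (simp only: sinh_add cosh_complex_of_real sinh_complex_of_real cosh_i_of_real sinh_i_of_real) simp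
      finally show ?thesis .
    qed
    have "((\<lambda>t. of_real t + \<i> * of_real (pi / 2)) has_vector_derivative 1) (at t within {0..})"
      by (auto intro!: derivative_eq_intros)
    from field_vector_diff_chain_within[OF this has_field_derivative_at_within[OF dF]]
    have "((\<lambda>t. F (\<i> * of_real (sinh t))) has_vector_derivative
       exp (\<i> * of_real x * (\<i> * of_real (sinh t))) * of_real ((-1) ^ n * sinh (2 * real n * t))) (at t within {0..})"
      unfolding o_def 1 2 by simp
    also have "exp (\<i> * of_real x * (\<i> * of_real (sinh t))) * of_real ((-1) ^ n * sinh (2 * real n * t)) = complex_of_real (?g t)"
    proof -
      have "exp (\<i> * of_real x * (\<i> * of_real (sinh t))) = of_real (exp (- x * sinh t))"
      proof -
        have "\<i> * of_real x * (\<i> * of_real (sinh t)) = complex_of_real (- x * sinh t)"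
          by (simp add: complex_eq_iff)
        thus ?thesis by (simp only: exp_of_real)
      qed
      moreover have e: "exp (- x * sinh t - (- 2 * real n) * t) = exp (- x * sinh t) * exp (2 * real n * t)"
        "exp (- x * sinh t - 2 * real n * t) = exp (- x * sinh t) * exp (- (2 * real n * t))"
        by (simp_all flip: exp_add)
      have "exp (- x * sinh t) * ((-1) ^ n * sinh (2 * real n * t)) = ?g t"
        unfolding e sinh_def[of "2 * real n * t"] by (simp add: algebra_simps)
      ultimately show ?thesis by (metis of_real_mult)
    qed
    finally show "((\<lambda>t. F (\<i> * of_real (sinh t))) has_vector_derivative complex_of_real (?g t)) (at t within {0..})" .
  qed
  from arg_cong[OF this, of Re]
  have ray: "integral {0..} ?g = - Re (F 0)"
    unfolding Re_integral[OF set_lebesgue_integral_eq_integral(1)[OF aiC]] by simp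
  let ?P = "integral {0..pi/2} (\<lambda>\<phi>. sin (x * cos \<phi> + 2 * real n * \<phi>))"
  let ?M = "integral {0..pi/2} (\<lambda>\<phi>. sin (x * cos \<phi> - 2 * real n * \<phi>))"
  have PM: "?P - ?M = 2 * integral {0..pi/2} (\<lambda>\<phi>. cos (x * cos \<phi>) * sin (2 * real n * \<phi>))"
  proof -
    have "?P - ?M = integral {0..pi/2} (\<lambda>\<phi>. sin (x * cos \<phi> + 2 * real n * \<phi>) - sin (x * cos \<phi> - 2 * real n * \<phi>))"
      by (intro integral_diff[symmetric] integrable_continuous_interval continuous_intros)
    also have "(\<lambda>\<phi>. sin (x * cos \<phi> + 2 * real n * \<phi>) - sin (x * cos \<phi> - 2 * real n * \<phi>))
        = (\<lambda>\<phi>. 2 * (cos (x * cos \<phi>) * sin (2 * real n * \<phi>)))"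
      by (simp add: sin_add sin_diff)
    finally show ?thesis by simp
  qed
  have "(-1) ^ n * (pi * bessel_Y (2 * n) x) = (-1) ^ n * ((-1) ^ n * (?P + ?M) - (schlaefli_exp x (- 2 * real n) + schlaefli_exp x (2 * real n)))"
    using bessel_Y_Schlaefli[OF x, of "2 * n"] schlaefli_sin_even[of x n] by simp
  also have "\<dots> = ((-1) ^ n * (-1) ^ n) * (?P + ?M) - (-1) ^ n * (schlaefli_exp x (- 2 * real n) + schlaefli_exp x (2 * real n))"
    by (simp add: algebra_simps)
  also have "(-1) ^ n * (-1) ^ n = (1::real)"
    by (simp flip: power_mult_distrib)
  \<comment> \<open>Writing e for \<open>schlaefli_exp x\<close>, the right-hand side is (P - M) -
    (-1)^n (e(-2n) - e(2n)) + 2 (M - (-1)^n e(2n)). By \<open>arc\<close> and \<open>ray\<close> the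
    first two terms are 2 Re (F 1 - F 0) and 2 Re (F 0); the last is -2 times the cosine
    integral.\<close>
  finally show ?thesis
    using integral_exp_i_cosh(2)[OF x n] int_g ray arc PM by (simp add: field_simps)
qed

section \<open>Fourier series of the sawtooth\<close>

definition sawtooth_sum :: "nat \<Rightarrow> real \<Rightarrow> real" where
  "sawtooth_sum L y = (\<Sum>m<L. sin (2 * pi * real (Suc m) * y) / (pi * real (Suc m)))"

text \<open>The value at integers is the midpoint of the jump, hence the limit of the sine series
  there.\<close>

definition sawtooth :: "real \<Rightarrow> real" where
  "sawtooth y = (if y \<in> \<int> then 0 else 1/2 - frac y)"

text \<open>A weak Jordan inequality: with w = z/2, sin w >= w cos w gives sin z >= 2w cos^2 w = w
  (1 + cos z) >= w.\<close>

lemma sin_ge_half: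
  assumes "0 \<le> z" "z \<le> pi / 2"
  shows "sin z \<ge> z / 2"
proof -
  define w where "w = z / 2"
  have w: "0 \<le> w" "w \<le> pi / 2" using assms by (auto simp: w_def)
  have "(\<lambda>w. sin w - w * cos w) 0 \<le> (\<lambda>w. sin w - w * cos w) w"
  proof (rule DERIV_nonneg_imp_nondecreasing[OF w(1)])
    fix t assume "0 \<le> t" "t \<le> w"
    hence "t * sin t \<ge> 0" using w by (intro mult_nonneg_nonneg sin_ge_zero) auto
    thus "\<exists>d. ((\<lambda>w. sin w - w * cos w) has_real_derivative d) (at t) \<and> 0 \<le> d"
      by (intro exI[of _ "t * sin t"]) (auto intro!: derivative_eq_intros)
  qed
  hence "w * cos w \<le> sin w" by simp
  hence "(w * cos w) * cos w \<le> sin w * cos w"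
    using w by (intro mult_right_mono cos_ge_zero) auto
  moreover have "w * 1 \<le> w * (2 * (cos w)\<^sup>2)"
    using w cos_double_cos[of w] cos_ge_zero[of "2 * w"] assms
    by (intro mult_left_mono) (auto simp: w_def)
  ultimately have "w \<le> 2 * (sin w * cos w)" by (simp add: power2_eq_square)
  also have "\<dots> = sin z" using sin_double[of w] by (simp add: w_def)
  finally show ?thesis by (simp add: w_def)
qed

lemma Dirichlet_kernel:
  "(1 + 2 * (\<Sum>m<L. cos (2 * pi * real (Suc m) * u))) * sin (pi * u) = sin ((2 * real L + 1) * pi * u)"
proof (induction L)
  case (Suc L)
  have "2 * cos (2 * pi * real (Suc L) * u) * sin (pi * u)
      = sin ((2 * real (Suc L) + 1) * pi * u) - sin ((2 * real L + 1) * pi * u)"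
    using sin_times_cos[of "pi * u" "2 * pi * real (Suc L) * u"]
      sin_minus[of "(2 * real L + 1) * pi * u"]
    by (simp add: algebra_simps)
  with Suc show ?case by (simp add: algebra_simps)
qed simp

text \<open>The difference vanishes at 1/2 and its derivative is the Dirichlet kernel sin(\<kappa>
  u) / sin(pi u). One integration by parts gains the factor 1/\<kappa>; it is built into
  \<open>h\<close> as the added quotient, whose derivative cancels the kernel and leaves
  \<open>h'\<close>.\<close>

lemma sawtooth_sum_approx:
  assumes "0 < y" "y \<le> 1/2"
  shows "\<bar>sawtooth_sum L y - (1/2 - y)\<bar> \<le> 2 / ((2 * real L + 1) * pi * sin (pi * y))"
proof -
  define \<kappa> where "\<kappa> = (2 * real L + 1) * pi"
  have k: "\<kappa> > 0" unfolding \<kappa>_def by simp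
  define h where "h = (\<lambda>u. sawtooth_sum L u - (1/2 - u) + cos (\<kappa> * u) / (\<kappa> * sin (pi * u)))"
  define h' where "h' = (\<lambda>u. - (pi * cos (\<kappa> * u) * cos (pi * u) / (\<kappa> * (sin (pi * u))\<^sup>2)))"
  have sin_pos: "sin (pi * u) > 0" if "u \<in> {y..1/2}" for u
    using that assms by (intro sin_gt_zero) auto
  have cos_nonneg: "cos (pi * u) \<ge> 0" if "u \<in> {y..1/2}" for u
    using that assms by (intro cos_ge_zero) (auto intro: order_trans[of _ 0])
  have dh: "(h has_real_derivative h' u) (at u)" if "u \<in> {y..1/2}" for u
  proof -
    have "(sawtooth_sum L has_real_derivative (\<Sum>m<L. 2 * cos (2 * pi * real (Suc m) * u))) (at u)"
      unfolding sawtooth_sum_def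
    proof (rule DERIV_sum)
      fix m
      have "((\<lambda>y. sin (2 * pi * s * y) / (pi * s)) has_real_derivative 2 * cos (2 * pi * s * u)) (at u)"
        if "s > 0" for s
        using that by (auto intro!: derivative_eq_intros simp: field_simps)
      thus "((\<lambda>y. sin (2 * pi * real (Suc m) * y) / (pi * real (Suc m))) has_real_derivative
          2 * cos (2 * pi * real (Suc m) * u)) (at u)" by simp
    qed
    moreover have "((\<lambda>u. cos (\<kappa> * u) / (\<kappa> * sin (pi * u))) has_real_derivative
        - sin (\<kappa> * u) / sin (pi * u) + h' u) (at u)"
      using sin_pos[OF that] k unfolding h'_def
      by (auto intro!: derivative_eq_intros simp: field_simps power2_eq_square)
    ultimately have "(h has_real_derivative (\<Sum>m<L. 2 * cos (2 * pi * real (Suc m) * u)) - (0 - 1)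
         + (- sin (\<kappa> * u) / sin (pi * u) + h' u)) (at u)"
      unfolding h_def by (intro derivative_intros) auto
    moreover have "sin (\<kappa> * u) / sin (pi * u) = 1 + (\<Sum>m<L. 2 * cos (2 * pi * real (Suc m) * u))"
      using Dirichlet_kernel[where L = L and u = u] sin_pos[OF that] unfolding \<kappa>_def
      by (simp add: field_simps sum_distrib_left)
    ultimately show ?thesis by simp
  qed
  \<comment> \<open>The derivative of \<open>g\<close> majorizes |h'|, so g + h and g - h both
    increase on [y, 1/2]. This bounds |h y| without integrating.\<close>
  define g where "g = (\<lambda>u. - 1 / (\<kappa> * sin (pi * u)))"
  have dg: "(g has_real_derivative pi * cos (pi * u) / (\<kappa> * (sin (pi * u))\<^sup>2)) (at u)" if "u \<in> {y..1/2}" for u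
    using sin_pos[OF that] k unfolding g_def
    by (auto intro!: derivative_eq_intros simp: field_simps power2_eq_square)
  have bnd: "\<bar>h' u\<bar> \<le> pi * cos (pi * u) / (\<kappa> * (sin (pi * u))\<^sup>2)" if "u \<in> {y..1/2}" for u
  proof -
    have "\<bar>cos (\<kappa> * u)\<bar> * (pi * cos (pi * u) / (\<kappa> * (sin (pi * u))\<^sup>2)) \<le> 1 * (pi * cos (pi * u) / (\<kappa> * (sin (pi * u))\<^sup>2))"
      using cos_nonneg[OF that] k by (intro mult_right_mono) auto
    thus ?thesis using cos_nonneg[OF that] k by (simp add: h'_def abs_mult mult_ac)
  qed
  have "(\<lambda>u. g u + h u) y \<le> (\<lambda>u. g u + h u) (1/2)"
    using assms(2)
    by (rule DERIV_nonneg_imp_nondecreasing)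
       (use bnd in \<open>force intro!: exI derivative_intros dg dh simp: abs_le_iff\<close>)
  moreover have "(\<lambda>u. g u - h u) y \<le> (\<lambda>u. g u - h u) (1/2)"
    using assms(2)
    by (rule DERIV_nonneg_imp_nondecreasing)
       (use bnd in \<open>force intro!: exI derivative_intros dg dh simp: abs_le_iff\<close>)
  moreover have "h (1/2) = 0"
  proof -
    have "sin (2 * pi * real (Suc m) * (1/2)) = 0" for m
      using sin_npi2[of "Suc m"] by (simp del: of_nat_Suc)
    hence "sawtooth_sum L (1/2) = 0"
      unfolding sawtooth_sum_def by (simp only:) simp
    moreover have "cos (\<kappa> / 2) = 0"
      unfolding \<kappa>_def by (simp add: distrib_right cos_add add_divide_distrib mult.commute[of "real L"])
    ultimately show ?thesis by (simp add: h_def)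
  qed
  moreover have "g (1/2) \<le> 0" using k by (simp add: g_def)
  moreover have "g y = - (1 / (\<kappa> * sin (pi * y)))" by (simp add: g_def)
  ultimately have hy: "\<bar>h y\<bar> \<le> 1 / (\<kappa> * sin (pi * y))" by linarith
  have "\<bar>cos (\<kappa> * y) / (\<kappa> * sin (pi * y))\<bar> \<le> 1 / (\<kappa> * sin (pi * y))"
    using sin_pos[of y] assms k by (simp add: abs_mult divide_right_mono)
  with hy have "\<bar>sawtooth_sum L y - (1/2 - y)\<bar> \<le> 1 / (\<kappa> * sin (pi * y)) + 1 / (\<kappa> * sin (pi * y))"
    unfolding h_def by linarith
  thus ?thesis unfolding \<kappa>_def[symmetric] by simp
qed

section \<open>Uniform bound and pointwise limit of the sawtooth sums\<close>

lemma sawtooth_sum_minus: "sawtooth_sum L (- y) = - sawtooth_sum L y"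
  by (simp add: sawtooth_sum_def sum_negf)

lemma sawtooth_sum_plus_int: "sawtooth_sum L (y + of_int k) = sawtooth_sum L y"
proof -
  have "sin (2 * pi * real (Suc m) * (y + of_int k)) = sin (2 * pi * real (Suc m) * y)" for m
  proof -
    have "2 * pi * real (Suc m) * (y + of_int k) = 2 * pi * real (Suc m) * y + 2 * pi * of_int (int (Suc m) * k)"
      by (simp add: algebra_simps)
    thus ?thesis by (simp only: sin_add sin_int_2pin cos_int_2pin mult_1_right mult_zero_right add_0_right)
  qed
  thus ?thesis by (simp add: sawtooth_sum_def)
qed

text \<open>If L y <= 1, each of the L terms is at most 2y because |sin t| <= |t|. Otherwise the
  denominator in \<open>sawtooth_sum_approx\<close> is at least pi^2 L y >= 3, so the error is at
  most 2/3 while |1/2 - y| < 1/2.\<close>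

lemma sawtooth_sum_bounded_aux:
  assumes "0 < y" "y \<le> 1/2"
  shows "\<bar>sawtooth_sum L y\<bar> \<le> 2"
proof (cases "real L * y \<le> 1")
  case True
  have "\<bar>sawtooth_sum L y\<bar> \<le> (\<Sum>m<L. 2 * y)"
    unfolding sawtooth_sum_def
  proof (rule order_trans[OF sum_abs sum_mono])
    fix m
    have "\<bar>sin (2 * pi * real (Suc m) * y)\<bar> \<le> 2 * pi * real (Suc m) * y"
      using abs_sin_x_le_abs_x[of "2 * pi * real (Suc m) * y"] assms by simp
    hence "\<bar>sin (2 * pi * real (Suc m) * y)\<bar> / (pi * real (Suc m)) \<le> 2 * pi * real (Suc m) * y / (pi * real (Suc m))"
      by (intro divide_right_mono) auto
    moreover have "2 * pi * real (Suc m) * y / (pi * real (Suc m)) = 2 * y" by (simp del: of_nat_Suc)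
    ultimately show "\<bar>sin (2 * pi * real (Suc m) * y) / (pi * real (Suc m))\<bar> \<le> 2 * y"
      by (simp add: abs_mult)
  qed
  also have "\<dots> \<le> 2" using True by simp
  finally show ?thesis .
next
  case False
  have "sin (pi * y) \<ge> pi * y / 2" using assms by (intro sin_ge_half) auto
  hence "(2 * real L) * pi * (pi * y / 2) \<le> (2 * real L + 1) * pi * sin (pi * y)"
    using assms by (intro mult_mono) auto
  moreover have "(2 * real L) * pi * (pi * y / 2) = pi * pi * (real L * y)" by simp
  moreover have "3 * 1 \<le> (pi * pi) * (real L * y)"
    using False pi_gt3 mult_mono[of 3 pi 1 pi] by (intro mult_mono) auto
  ultimately have "3 \<le> (2 * real L + 1) * pi * sin (pi * y)"
    by linarith
  hence "2 / ((2 * real L + 1) * pi * sin (pi * y)) \<le> 2 / 3"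
    by (intro frac_le) auto
  thus ?thesis using sawtooth_sum_approx[OF assms, of L] assms by linarith
qed

lemma sawtooth_sum_int_minus: "sawtooth_sum L (of_int k - y) = - sawtooth_sum L y"
  using sawtooth_sum_plus_int[of L "- y" k] by (simp add: sawtooth_sum_minus)

text \<open>Periodicity and oddness reduce all non-integral points to (0, 1/2], where the estimates
  above apply.\<close>

lemma sawtooth_cases:
  fixes y :: real
  obtains (int) "y \<in> \<int>" | (low) k z where "y = z + of_int k" "0 < z" "z \<le> 1/2"
    | (high) k z where "y = - z + of_int k" "0 < z" "z < 1/2"
proof -
  consider "frac y = 0" | "0 < frac y" "frac y \<le> 1/2" | "frac y > 1/2"
    using frac_ge_0[of y] by linarith
  thus ?thesis
  proof cases
    case 1 thus ?thesis using int by (simp add: frac_eq_0_iff)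
  next
    case 2
    thus ?thesis using low[of "frac y" "\<lfloor>y\<rfloor>"] by (simp add: frac_def)
  next
    case 3
    thus ?thesis using high[of "1 - frac y" "\<lfloor>y\<rfloor> + 1"] frac_lt_1[of y] by (simp add: frac_def)
  qed
qed

lemma sawtooth_sum_Ints: "y \<in> \<int> \<Longrightarrow> sawtooth_sum L y = 0"
  using sawtooth_sum_plus_int[of L 0] by (auto elim!: Ints_cases simp: sawtooth_sum_def)

lemma sawtooth_sum_bounded: "\<bar>sawtooth_sum L y\<bar> \<le> 2"
  using sawtooth_sum_bounded_aux[of _ L]
  by (cases y rule: sawtooth_cases)
     (auto simp: sawtooth_sum_Ints sawtooth_sum_plus_int sawtooth_sum_int_minus)

lemma sawtooth_sum_tendsto: "(\<lambda>L. sawtooth_sum L y) \<longlonglongrightarrow> sawtooth y"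
proof -
  have lim: "(\<lambda>L. sawtooth_sum L z) \<longlonglongrightarrow> 1/2 - z" if "0 < z" "z \<le> 1/2" for z
  proof (subst LIM_zero_iff[symmetric], rule Lim_null_comparison)
    have "sin (pi * z) > 0" using that by (intro sin_gt_zero) auto
    thus "(\<lambda>L. 2 / ((2 * real L + 1) * pi * sin (pi * z))) \<longlonglongrightarrow> 0"
      by real_asymp
  qed (use sawtooth_sum_approx[OF that] in auto)
  show ?thesis
  proof (cases y rule: sawtooth_cases)
    case int
    thus ?thesis by (simp add: sawtooth_sum_Ints sawtooth_def)
  next
    case (low k z)
    hence "frac y = z" using frac_unique_iff[of y z] by auto
    moreover from this have "y \<notin> \<int>" using low by (auto simp flip: frac_eq_0_iff)
    ultimately show ?thesis using lim[of z] low by (simp add: sawtooth_sum_plus_int sawtooth_def)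
  next
    case (high k z)
    hence "frac y = 1 - z" using frac_unique_iff[of y "1 - z"] by auto
    moreover from this have "y \<notin> \<int>" using high by (auto simp flip: frac_eq_0_iff)
    ultimately show ?thesis using tendsto_minus[OF lim[of z]] high
      by (simp add: sawtooth_sum_plus_int sawtooth_sum_int_minus sawtooth_def)
  qed
qed

text \<open>Dominated convergence with majorant 2|f|, by the uniform bound on the partial sums. It
  is applied on [0, 1] for the Bernoulli functional and on the half-line for the kernel.\<close>

lemma integral_sawtooth_sums:
  assumes f: "f absolutely_integrable_on S" and S: "S \<in> sets lebesgue"
  shows "(\<lambda>m. integral S (\<lambda>y. f y * sin (2 * pi * real (Suc m) * y)) / (pi * real (Suc m)))
           sums integral S (\<lambda>y. f y * sawtooth y)"
    and "(\<lambda>y. f y * sin (a * y)) absolutely_integrable_on S"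
    and "(\<lambda>y. f y * sawtooth y) absolutely_integrable_on S"
proof -
  have prod: "(\<lambda>y. f y * s y) absolutely_integrable_on S" if "continuous_on UNIV s" "bounded (s ` S)" for s
    unfolding mult.commute[of "f _"]
    by (rule absolutely_integrable_bounded_measurable_product_real[OF _ S that(2) f])
       (use that(1) S in \<open>auto intro: continuous_imp_measurable_on_sets_lebesgue continuous_on_subset\<close>)
  have sin: "(\<lambda>y. f y * sin (a * y)) absolutely_integrable_on S" for a
    by (rule prod) (auto intro!: continuous_intros boundedI[where B = 1])
  show "(\<lambda>y. f y * sin (a * y)) absolutely_integrable_on S" by (rule sin)
  have saw: "(\<lambda>y. f y * sawtooth_sum L y) absolutely_integrable_on S" for L
    unfolding sawtooth_sum_def
    by (rule prod) (use sawtooth_sum_bounded[of L] in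
        \<open>auto intro!: continuous_intros boundedI[where B = 2] simp: sawtooth_sum_def\<close>)
  have bnd: "norm (f y * sawtooth_sum L y) \<le> 2 * norm (f y)" for L y
    using mult_left_mono[OF sawtooth_sum_bounded[of L y], of "\<bar>f y\<bar>"] by (simp add: abs_mult)
  have int2: "(\<lambda>y. 2 * norm (f y)) integrable_on S"
    using f by (intro integrable_on_mult_right) (simp add: absolutely_integrable_on_def)
  have lim: "(\<lambda>L. f y * sawtooth_sum L y) \<longlonglongrightarrow> f y * sawtooth y" for y
    by (intro tendsto_intros sawtooth_sum_tendsto)
  note dc = dominated_convergence[OF set_lebesgue_integral_eq_integral(1)[OF saw] int2 bnd lim]
  have "\<bar>sawtooth y\<bar> \<le> 2" for y
    by (rule tendsto_upperbound[OF tendsto_rabs[OF sawtooth_sum_tendsto]]) (use sawtooth_sum_bounded in auto)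
  hence "norm (f y * sawtooth y) \<le> 2 * norm (f y)" for y
    using mult_left_mono[of "\<bar>sawtooth y\<bar>" 2 "\<bar>f y\<bar>"] by (simp add: abs_mult)
  thus "(\<lambda>y. f y * sawtooth y) absolutely_integrable_on S"
    by (intro absolutely_integrable_integrable_bound[OF _ dc(1) int2])
  have "integral S (\<lambda>y. f y * sawtooth_sum L y) =
      (\<Sum>m<L. integral S (\<lambda>y. f y * sin (2 * pi * real (Suc m) * y)) / (pi * real (Suc m)))" for L
    unfolding sawtooth_sum_def sum_distrib_left times_divide_eq_right
    using set_lebesgue_integral_eq_integral(1)[OF sin[of "2 * pi * real (Suc _)"]]
    by (subst integral_sum) (auto intro!: integrable_on_divide)
  thus "(\<lambda>m. integral S (\<lambda>y. f y * sin (2 * pi * real (Suc m) * y)) / (pi * real (Suc m)))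
           sums integral S (\<lambda>y. f y * sawtooth y)"
    using dc(2) by (simp add: sums_def)
qed

text \<open>Euler-Maclaurin of first order on one unit interval. Differentiability is asked in the
  open interval only, because the kernel below behaves like a constant plus a multiple of sqrt y at
  0.\<close>

lemma integral_sawtooth_unit:
  assumes cont: "continuous_on {real k..real k + 1} f"
    and deriv: "\<And>y. real k < y \<Longrightarrow> y < real k + 1 \<Longrightarrow> (f has_real_derivative f' y) (at y)"
    and int: "f' absolutely_integrable_on {real k..real k + 1}"
  shows "integral {real k..real k + 1} (\<lambda>y. f' y * sawtooth y) =
           integral {real k..real k + 1} f - (f (real k) + f (real k + 1)) / 2"
proof -
  let ?I = "{real k..real k + 1}"
  let ?g = "\<lambda>y. f y * (1/2 - (y - real k))"
  have io: "(\<lambda>y. f' y * sawtooth y) integrable_on ?I"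
    by (intro set_lebesgue_integral_eq_integral(1) integral_sawtooth_sums(3) int) auto
  have I: "((\<lambda>y. f' y * (1/2 - (y - real k)) + f y * (-1)) has_integral (?g (real k + 1) - ?g (real k))) ?I"
  proof (rule fundamental_theorem_of_calculus_interior)
    show "continuous_on ?I ?g" by (intro continuous_intros cont)
    fix y assume y: "y \<in> {real k<..<real k + 1}"
    show "(?g has_vector_derivative f' y * (1/2 - (y - real k)) + f y * (-1)) (at y)"
      unfolding has_real_derivative_iff_has_vector_derivative[symmetric]
      using y by (auto intro!: derivative_eq_intros deriv)
  qed simp
  have "sawtooth y = 1/2 - (y - real k)" if "real k < y" "y < real k + 1" for y
  proof -
    have "frac y = y - real k"
      using that by (subst frac_unique_iff) auto
    moreover from this have "y \<notin> \<int>" using that by (auto simp flip: frac_eq_0_iff)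
    ultimately show ?thesis by (simp add: sawtooth_def)
  qed
  hence E: "f' y * sawtooth y + f y * (-1) = f' y * (1/2 - (y - real k)) + f y * (-1)"
    if "y \<in> ?I - {real k, real k + 1}" for y
    using that by force
  have "((\<lambda>y. f' y * sawtooth y + f y * (-1)) has_integral (?g (real k + 1) - ?g (real k))) ?I"
    by (rule has_integral_spike_finite[where S = "{real k, real k + 1}", OF _ E I]) simp_all
  moreover have "((\<lambda>y. f' y * sawtooth y + f y * (-1)) has_integral
      integral ?I (\<lambda>y. f' y * sawtooth y) + integral ?I f * (-1)) ?I"
    by (intro has_integral_add has_integral_mult_left integrable_integral io integrable_continuous_interval[OF cont])
  ultimately have "?g (real k + 1) - ?g (real k) = integral ?I (\<lambda>y. f' y * sawtooth y) + integral ?I f * (-1)"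
    by (rule has_integral_unique)
  thus ?thesis by (simp add: field_simps)
qed

text \<open>Integration by parts, whose boundary terms contain sin(2 pi m) = 0, turns each cosine
  coefficient of f into a sine coefficient of f', and the sawtooth series sums these.\<close>

lemma cos_integral_sums:
  assumes deriv: "\<And>y. (f has_real_derivative f' y) (at y)" and cont: "continuous_on UNIV f'"
  shows "(\<lambda>m. 2 * integral {0..1} (\<lambda>y. f y * cos (2 * pi * real (Suc m) * y)))
           sums ((f 0 + f 1) / 2 - integral {0..1} f)"
proof -
  have contf: "continuous_on A f" for A
    by (intro continuous_at_imp_continuous_on ballI DERIV_isCont[OF deriv])
  have contf': "continuous_on A f'" for A
    using cont continuous_on_subset by blast
  have ai: "f' absolutely_integrable_on {0..1}"
    by (intro absolutely_integrable_continuous_real contf')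
  have parts: "2 * integral {0..1} (\<lambda>y. f y * cos (2 * pi * s * y))
      = - (integral {0..1} (\<lambda>y. f' y * sin (2 * pi * s * y)) / (pi * s))"
    if s: "s = real (Suc m)" for s m
  proof -
    have s0: "s > 0" using s by simp
    have "sin (2 * pi * s) = 0"
      unfolding s using sin_int_2pin[of "int (Suc m)"] by simp
    moreover have "((\<lambda>y. f' y * sin (2 * pi * s * y) + f y * (cos (2 * pi * s * y) * (2 * pi * s))) has_integral
        (f 1 * sin (2 * pi * s * 1) - f 0 * sin (2 * pi * s * 0))) {0..1}"
      by (rule fundamental_theorem_of_calculus)
         (auto intro!: derivative_eq_intros has_field_derivative_at_within[OF deriv]
           simp flip: has_real_derivative_iff_has_vector_derivative)
    ultimately have "((\<lambda>y. f' y * sin (2 * pi * s * y) + f y * (cos (2 * pi * s * y) * (2 * pi * s))) has_integral 0) {0..1}"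
      by simp
    moreover have "((\<lambda>y. f' y * sin (2 * pi * s * y) + f y * cos (2 * pi * s * y) * (2 * pi * s)) has_integral
        integral {0..1} (\<lambda>y. f' y * sin (2 * pi * s * y)) + integral {0..1} (\<lambda>y. f y * cos (2 * pi * s * y)) * (2 * pi * s)) {0..1}"
      by (intro has_integral_add has_integral_mult_left integrable_integral integrable_continuous_interval
          continuous_intros contf contf')
    ultimately have "integral {0..1} (\<lambda>y. f' y * sin (2 * pi * s * y)) + integral {0..1} (\<lambda>y. f y * cos (2 * pi * s * y)) * (2 * pi * s) = 0"
      by (simp only: mult.assoc has_integral_unique)
    thus ?thesis using s0 by (simp add: field_simps)
  qed
  have "(\<lambda>m. - (integral {0..1} (\<lambda>y. f' y * sin (2 * pi * real (Suc m) * y)) / (pi * real (Suc m))))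
      sums - integral {0..1} (\<lambda>y. f' y * sawtooth y)"
    by (intro sums_minus integral_sawtooth_sums(1) ai) auto
  moreover have "- integral {0..1} (\<lambda>y. f' y * sawtooth y) = (f 0 + f 1) / 2 - integral {0..1} f"
    using integral_sawtooth_unit[of 0 f f'] contf ai deriv by simp
  ultimately show ?thesis by (simp only: parts[OF refl])
qed

section \<open>The Bernoulli functional and Zagier polynomials\<close>

text \<open>The umbral substitution of b_i for y^i.\<close>

definition poly_lin :: "(nat \<Rightarrow> real) \<Rightarrow> real poly \<Rightarrow> real" where
  "poly_lin b q = (\<Sum>i\<le>degree q. coeff q i * b i)"

lemma poly_lin_altdef: "degree q \<le> N \<Longrightarrow> poly_lin b q = (\<Sum>i\<le>N. coeff q i * b i)"
  unfolding poly_lin_def by (rule sum.mono_neutral_left) (auto simp: coeff_eq_0)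

lemma poly_lin_add: "poly_lin b (p + q) = poly_lin b p + poly_lin b q"
  using degree_add_le_max[of p q]
  by (simp add: poly_lin_altdef[of _ "max (degree p) (degree q)"] ring_distribs sum.distrib)

lemma poly_lin_smult: "poly_lin b (smult c p) = c * poly_lin b p"
  using degree_smult_le[of c p]
  by (simp add: poly_lin_altdef[of _ "degree p"] sum_distrib_left mult.assoc)

lemma poly_lin_monom: "poly_lin b (monom c n) = c * b n"
  by (simp add: poly_lin_altdef[OF degree_monom_le] if_distrib[of "\<lambda>x. x * _"] sum.delta cong: if_cong)

lemma poly_lin_0 [simp]: "poly_lin b 0 = 0"
  by (simp add: poly_lin_def)

lemma poly_lin_sum: "poly_lin b (sum f A) = (\<Sum>x\<in>A. poly_lin b (f x))"
  by (induction A rule: infinite_finite_induct) (simp_all add: poly_lin_add)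

lemma poly_lin_unique:
  assumes add: "\<And>p q. \<Lambda> (p + q) = \<Lambda> p + \<Lambda> q" and smult: "\<And>c p. \<Lambda> (smult c p) = c * \<Lambda> p"
    and monom: "\<And>n. \<Lambda> (monom 1 n) = b n"
  shows "\<Lambda> q = poly_lin b q"
proof -
  have "\<Lambda> 0 = 0" using smult[of 0 0] by simp
  hence sum: "\<Lambda> (sum f A) = (\<Sum>x\<in>A. \<Lambda> (f x))" for f :: "nat \<Rightarrow> real poly" and A
    by (induction A rule: infinite_finite_induct) (simp_all add: add)
  have "\<Lambda> (monom c n) = c * b n" for c n
    using smult[of c "monom 1 n"] by (simp add: smult_monom monom)
  thus ?thesis
    by (subst poly_as_sum_of_monoms[symmetric]) (simp add: sum poly_lin_def)
qed

lemma poly_pderiv_lin: "poly (pderiv q) y = poly_lin (\<lambda>r. real r * y ^ (r - 1)) q"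
  by (rule poly_lin_unique) (simp_all add: pderiv_add pderiv_smult pderiv_monom poly_monom)

lemma linear_power_expand: "[:c, 1:] ^ r = (\<Sum>k\<le>r. monom (real (r choose k) * c ^ (r - k)) k)"
proof -
  have "[:c, 1:] ^ r = ([:0, 1:] + [:c:]) ^ r" by simp
  also have "\<dots> = (\<Sum>k\<le>r. of_nat (r choose k) * [:0, 1:] ^ k * [:c:] ^ (r - k))"
    by (rule binomial_ring)
  also have "\<dots> = (\<Sum>k\<le>r. monom (real (r choose k) * c ^ (r - k)) k)"
    by (intro sum.cong refl)
       (simp add: monom_altdef of_nat_poly poly_const_pow mult.commute)
  finally show ?thesis .
qed

lemma pcompose_monom: "pcompose (monom 1 r) q = q ^ r"
  by (induction r) (simp_all add: monom_Suc pcompose_pCons pcompose_1)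

lemma poly_lin_shift:
  "poly_lin b (pcompose (monom 1 r) [:1, 1:]) = (\<Sum>k\<le>r. real (r choose k) * b k)"
  unfolding pcompose_monom linear_power_expand by (simp add: poly_lin_sum poly_lin_monom)

section \<open>The difference equation of the Bernoulli functional and duplication\<close>

declare bernoulli_num.simps [simp del]

lemma bernoulli_num_rec: "(\<Sum>k\<le>m. real (Suc m choose k) * bernoulli_num k) = (if m = 0 then 1 else 0)"
proof -
  have "real (Suc m) * bernoulli_num m = (if m = 0 then 1 else - (\<Sum>k<m. real (Suc m choose k) * bernoulli_num k))"
    by (subst bernoulli_num.simps) (simp del: of_nat_Suc)
  moreover have "{..m} = insert m {..<m}" by auto
  ultimately show ?thesis by simp
qed

lemma bernoulli_num_unique:
  assumes "\<And>m. (\<Sum>k\<le>m. real (Suc m choose k) * b k) = (if m = 0 then 1 else 0)"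
  shows "b m = bernoulli_num m"
proof (induction m rule: less_induct)
  case (less m)
  have *: "(\<Sum>k\<le>m. real (Suc m choose k) * c k) = real (Suc m) * c m + (\<Sum>k<m. real (Suc m choose k) * c k)" for c
    by (simp add: add.commute del: of_nat_Suc flip: lessThan_Suc_atMost)
  have "(\<Sum>k<m. real (Suc m choose k) * b k) = (\<Sum>k<m. real (Suc m choose k) * bernoulli_num k)"
    using less by (intro sum.cong) auto
  with assms[of m] bernoulli_num_rec[of m] have "real (Suc m) * b m = real (Suc m) * bernoulli_num m"
    unfolding * by linarith
  thus ?case by (simp del: of_nat_Suc)
qed

abbreviation bernoulli_lin :: "real poly \<Rightarrow> real" where
  "bernoulli_lin \<equiv> poly_lin bernoulli_num"

lemma bernoulli_lin_shift: "bernoulli_lin (pcompose q [:1, 1:]) = bernoulli_lin q + poly (pderiv q) 0"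
proof -
  define b where "b = (\<lambda>n::nat. if n = 1 then 1 else 0 :: real)"
  have "bernoulli_lin (pcompose q [:1, 1:]) - bernoulli_lin q = poly_lin b q" for q
  proof (rule poly_lin_unique)
    fix n
    show "bernoulli_lin (pcompose (monom 1 n) [:1, 1:]) - bernoulli_lin (monom 1 n) = b n"
      using bernoulli_num_rec[of "n - 1"]
      by (cases n) (auto simp: poly_lin_shift poly_lin_monom b_def pcompose_1)
  qed (simp_all add: pcompose_add pcompose_smult poly_lin_add poly_lin_smult algebra_simps)
  moreover have "poly (pderiv q) 0 = poly_lin b q" for q
    by (rule poly_lin_unique)
       (auto simp: pderiv_add pderiv_smult pderiv_monom poly_monom b_def)
  ultimately show ?thesis by (simp add: algebra_simps)
qed

text \<open>On the monomial y^(m+1) the shift equation is the recurrence of the Bernoulli numbers,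
  so it determines the functional. Identities for Bernoulli numbers thereby reduce to checking one
  shift.\<close>

lemma bernoulli_lin_unique:
  assumes add: "\<And>p q. \<Lambda> (p + q) = \<Lambda> p + \<Lambda> q" and smult: "\<And>c p. \<Lambda> (smult c p) = c * \<Lambda> p"
    and shift: "\<And>q. \<Lambda> (pcompose q [:1, 1:]) = \<Lambda> q + poly (pderiv q) 0"
  shows "\<Lambda> q = bernoulli_lin q"
proof -
  define b where "b = (\<lambda>n. \<Lambda> (monom 1 n))"
  have L: "\<Lambda> q = poly_lin b q" for q
    by (rule poly_lin_unique[OF add smult]) (simp add: b_def)
  have "b n = bernoulli_num n" for n
  proof (rule bernoulli_num_unique)
    fix m
    have "poly_lin b (pcompose (monom 1 (Suc m)) [:1, 1:]) = b (Suc m) + poly (pderiv (monom 1 (Suc m))) 0"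
      using shift[of "monom 1 (Suc m)"] unfolding L by (simp add: poly_lin_monom)
    thus "(\<Sum>k\<le>m. real (Suc m choose k) * b k) = (if m = 0 then 1 else 0)"
      unfolding poly_lin_shift by (auto simp: pderiv_monom poly_monom)
  qed
  thus ?thesis unfolding L by (simp add: poly_lin_def)
qed

text \<open>The mean of the values at q(2y) and q(2y + 1) satisfies the shift equation: replacing
  q(y) by q(y + 1) turns q(2y) into q(2y + 1), and q(2y + 1) into q(2y) shifted by one, which adds 2
  q'(0).\<close>

lemma bernoulli_lin_duplication:
  "bernoulli_lin (pcompose q [:0, 2:]) + bernoulli_lin (pcompose q [:1, 2:]) = 2 * bernoulli_lin q"
proof -
  let ?L = "\<lambda>q. (bernoulli_lin (pcompose q [:0, 2:]) + bernoulli_lin (pcompose q [:1, 2:])) / 2"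
  have "?L q = bernoulli_lin q"
  proof (rule bernoulli_lin_unique)
    fix q :: "real poly"
    have 1: "pcompose (pcompose q [:1, 1:]) [:0, 2:] = pcompose q [:1, 2:]"
      by (simp add: pcompose_assoc[symmetric] pcompose_pCons)
    have 2: "pcompose (pcompose q [:1, 1:]) [:1, 2:] = pcompose (pcompose q [:0, 2:]) [:1, 1:]"
      by (simp add: pcompose_assoc[symmetric] pcompose_pCons)
    have 3: "poly (pderiv (pcompose q [:0, 2:])) 0 = 2 * poly (pderiv q) 0"
      by (simp add: pderiv_pcompose poly_pcompose pderiv_pCons)
    show "?L (pcompose q [:1, 1:]) = ?L q + poly (pderiv q) 0"
      unfolding 1 2 bernoulli_lin_shift 3 by simp
  qed (simp_all add: pcompose_add pcompose_smult poly_lin_add poly_lin_smult field_simps)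
  thus ?thesis by simp
qed

text \<open>\<open>zpoly N\<close> is \<open>T\<^sub>N (1 + y/2) / N\<close> for the Chebyshev polynomial \<open>T\<^sub>N\<close> of the first kind.\<close>

definition zpoly :: "nat \<Rightarrow> real poly" where
  "zpoly N = (\<Sum>r\<le>N. monom (real ((N + r) choose (2 * r)) / real (N + r)) r)"

lemma coeff_zpoly: "coeff (zpoly N) r = (if r \<le> N then real ((N + r) choose (2 * r)) / real (N + r) else 0)"
  by (simp add: zpoly_def coeff_sum coeff_monom)

lemma bernoulli_poly_lin: "bernoulli_poly r x = bernoulli_lin ([:x, 1:] ^ r)"
  unfolding linear_power_expand bernoulli_poly_def
  by (simp add: poly_lin_sum poly_lin_monom mult_ac)

lemma zagier_poly_lin: "zagier_poly N x = bernoulli_lin (pcompose (zpoly N) [:x, 1:])"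
proof -
  have m: "monom c r = smult c (monom 1 r)" for c :: real and r
    by (simp add: smult_monom)
  have "pcompose (zpoly N) [:x, 1:] = (\<Sum>r\<le>N. smult (real ((N + r) choose (2 * r)) / real (N + r)) ([:x, 1:] ^ r))"
    unfolding zpoly_def pcompose_sum by (subst m) (simp add: pcompose_smult pcompose_monom)
  thus ?thesis
    by (simp add: zagier_poly_def poly_lin_sum poly_lin_smult bernoulli_poly_lin)
qed

text \<open>The duplication formula merges the two shifts by \<open>1/2\<close> into one Bernoulli functional of step \<open>1/2\<close>.\<close>
lemma zagier_poly_pair:
  "zagier_poly N (-3/2) + zagier_poly N 0 = 2 * bernoulli_lin (pcompose (zpoly N) [:0, 1/2:])
     - poly (pderiv (zpoly N)) (-1/2) - poly (pderiv (zpoly N)) (-3/2)"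
proof -
  \<comment> \<open>Writing p and q for these, q is chosen so that q(2y) = p(y - 1/2) and q(2y + 1)
    = p(y). Passing from the shift -3/2 to -1/2 costs p'(-3/2), and from q(y) to q(y + 1) = p(y/2)
    costs p'(-1/2)/2; these are the source of the two Chebyshev values.\<close>
  let ?p = "zpoly N" and ?q = "pcompose (zpoly N) [:-1/2, 1/2:]"
  have 1: "pcompose ?q [:0, 2:] = pcompose (pcompose ?p [:-3/2, 1:]) [:1, 1:]"
    by (simp add: pcompose_assoc[symmetric] pcompose_pCons)
  have 2: "pcompose ?q [:1, 2:] = pcompose ?p [:0, 1:]"
    by (simp add: pcompose_assoc[symmetric] pcompose_pCons)
  have 3: "pcompose ?p [:0, 1/2:] = pcompose ?q [:1, 1:]"
    by (simp add: pcompose_assoc[symmetric] pcompose_pCons)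
  have 4: "poly (pderiv (pcompose ?p [:-3/2, 1:])) 0 = poly (pderiv ?p) (-3/2)"
    by (simp add: pderiv_pcompose poly_pcompose pderiv_pCons)
  have 5: "poly (pderiv ?q) 0 = poly (pderiv ?p) (-1/2) / 2"
    by (simp add: pderiv_pcompose poly_pcompose pderiv_pCons)
  show ?thesis
    using bernoulli_lin_duplication[of ?q]
    unfolding zagier_poly_lin 1 2 3 bernoulli_lin_shift 4 5 by simp
qed

section \<open>Chebyshev polynomials of the second kind and the derivative of
  \<open>zpoly\<close>\<close>

fun cheb_U :: "nat \<Rightarrow> 'a :: comm_ring_1 \<Rightarrow> 'a" where
  "cheb_U 0 x = 1"
| "cheb_U (Suc 0) x = 2 * x"
| "cheb_U (Suc (Suc n)) x = 2 * x * cheb_U (Suc n) x - cheb_U n x"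

text \<open>The copy over a general ring exists because the contour argument evaluates these
  polynomials at complex points.\<close>

lemma chebyshev_U_eq: "chebyshev_U n x = cheb_U n x"
  by (induction n x rule: chebyshev_U.induct) simp_all

lemma cheb_U_1: "cheb_U n (1 :: 'a :: comm_ring_1) = of_nat (Suc n)"
  by (induction n "1::'a" rule: cheb_U.induct) (simp_all add: algebra_simps)

lemma cheb_U_cosh: "cheb_U n (cosh w) * sinh w = sinh (of_nat (Suc n) * w :: complex)"
proof (induction n "cosh w" rule: cheb_U.induct)
  case 2
  show ?case using sinh_double[of w] by (simp add: mult_ac)
next
  case (3 n)
  have "sinh (of_nat (Suc (Suc (Suc n))) * w) + sinh (of_nat (Suc n) * w) = 2 * cosh w * sinh (of_nat (Suc (Suc n)) * w)"
  proof -
    have "of_nat (Suc (Suc (Suc n))) * w = of_nat (Suc (Suc n)) * w + w"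
         "of_nat (Suc n) * w = of_nat (Suc (Suc n)) * w - w"
      by (simp_all add: algebra_simps)
    thus ?thesis by (simp only: sinh_add sinh_diff) simp
  qed
  with 3 show ?case by (simp add: left_diff_distrib mult.assoc del: of_nat_Suc) (simp add: algebra_simps)
qed simp

text \<open>With z = 2c - 2 the three-term recurrence reads U_(N+2) + U_N = (2 + z) U_(N+1), which
  is a double Pascal identity on coefficients. The free upper limit M gives the sums of the
  induction step a common range; the binomials vanish for r > N.\<close>

lemma cheb_U_expand:
  fixes c :: "'a :: comm_ring_1"
  shows "N \<le> M \<Longrightarrow> (\<Sum>r\<le>M. of_nat ((N + 1 + r) choose (2 * r + 1)) * (2 * c - 2) ^ r) = cheb_U N c"
proof (induction N arbitrary: M rule: induct_nat_012)
  case 0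
  have z: "Suc r choose Suc (2 * r) = 0" if "0 < r" for r
    by (rule binomial_eq_0) (use that in simp)
  have "(\<Sum>r\<le>M. of_nat ((0 + 1 + r) choose (2 * r + 1)) * (2 * c - 2) ^ r) =
        (\<Sum>r\<in>{0}. of_nat ((0 + 1 + r) choose (2 * r + 1)) * (2 * c - 2) ^ r)"
    by (intro sum.mono_neutral_right ballI) (auto simp: z simp del: binomial_Suc_Suc)
  thus ?case by simp
next
  case 1
  have z: "Suc (Suc r) choose Suc (2 * r) = 0" if "0 < r" "r \<noteq> Suc 0" for r
    by (rule binomial_eq_0) (use that in auto)
  have "(\<Sum>r\<le>M. of_nat ((Suc 0 + 1 + r) choose (2 * r + 1)) * (2 * c - 2) ^ r) =
        (\<Sum>r\<in>{0,1}. of_nat ((Suc 0 + 1 + r) choose (2 * r + 1)) * (2 * c - 2) ^ r)"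
    using 1 by (intro sum.mono_neutral_right ballI) (auto simp: z simp del: binomial_Suc_Suc)
  thus ?case by (simp add: numeral_2_eq_2)
next
  case (ge2 n)
  define z where "z = 2 * c - 2"
  define a where "a = (\<lambda>N r. (N + 1 + r) choose (2 * r + 1))"
  obtain M' where M: "M = Suc M'" using ge2.prems by (cases M) auto
  have rec0: "a (n + 2) 0 + a n 0 = 2 * a (n + 1) 0"
    by (simp add: a_def)
  have rec: "a (n + 2) (Suc r) + a n (Suc r) = 2 * a (n + 1) (Suc r) + a (n + 1) r" for r
    by (simp add: a_def)
  have "(\<Sum>r\<le>M. of_nat (a (n + 2) r) * z ^ r) + (\<Sum>r\<le>M. of_nat (a n r) * z ^ r)
      = (\<Sum>r\<le>M. of_nat (a (n + 2) r + a n r) * z ^ r)"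
    by (simp add: sum.distrib ring_distribs)
  also have "\<dots> = of_nat (2 * a (n + 1) 0) + (\<Sum>r\<le>M'. of_nat (2 * a (n + 1) (Suc r) + a (n + 1) r) * z ^ Suc r)"
    unfolding M sum.atMost_Suc_shift rec rec0 by simp
  also have "\<dots> = 2 * (of_nat (a (n + 1) 0) + (\<Sum>r\<le>M'. of_nat (a (n + 1) (Suc r)) * z ^ Suc r))
      + z * (\<Sum>r\<le>M'. of_nat (a (n + 1) r) * z ^ r)"
    by (simp add: sum.distrib ring_distribs sum_distrib_left mult_ac)
  also have "of_nat (a (n + 1) 0) + (\<Sum>r\<le>M'. of_nat (a (n + 1) (Suc r)) * z ^ Suc r) = (\<Sum>r\<le>M. of_nat (a (n + 1) r) * z ^ r)"
    unfolding M sum.atMost_Suc_shift by simp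
  finally have "(\<Sum>r\<le>M. of_nat (a (n + 2) r) * z ^ r) + cheb_U n c = 2 * cheb_U (n + 1) c + z * cheb_U (n + 1) c"
    using ge2.IH(1)[of M] ge2.IH(2)[of M] ge2.IH(2)[of M'] ge2.prems M by (simp add: a_def z_def)
  thus ?case by (simp add: a_def z_def algebra_simps)
qed

text \<open>The absorption identity for binomials; in coefficients this is T_N' = N U_(N-1).\<close>

lemma zpoly_coeff_deriv:
  assumes "N \<ge> 1" "r < N"
  shows "real (Suc r) * coeff (zpoly N) (Suc r) = real (((N - 1) + 1 + r) choose (2 * r + 1)) / 2"
proof -
  have "real (Suc (2 * r + 1)) * real (Suc (N + r) choose Suc (2 * r + 1)) = real (Suc (N + r)) * real ((N + r) choose (2 * r + 1))"
    by (metis Suc_times_binomial of_nat_mult)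
  moreover have "real (Suc (2 * r + 1)) = 2 * real (Suc r)" "Suc (2 * r + 1) = 2 * Suc r" by simp_all
  ultimately have "2 * real (Suc r) * real (Suc (N + r) choose (2 * Suc r)) = real (Suc (N + r)) * real ((N + r) choose (2 * r + 1))"
    by metis
  thus ?thesis using assms by (simp add: coeff_zpoly field_simps del: of_nat_Suc binomial_Suc_Suc)
qed

lemma degree_zpoly: "degree (zpoly N) \<le> N"
  by (rule degree_le) (auto simp: coeff_zpoly)

lemma zpoly_deriv_expand:
  fixes y :: "'a :: real_field"
  assumes N: "N \<ge> 1"
  shows "(\<Sum>r\<le>N. of_real (coeff (zpoly N) r) * (of_nat r * y ^ (r - 1))) =
           (\<Sum>r\<le>N - 1. of_nat (((N - 1) + 1 + r) choose (2 * r + 1)) * y ^ r) / 2"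
proof -
  obtain K where K: "N = Suc K" using N by (cases N) auto
  have "(\<Sum>r\<le>N. of_real (coeff (zpoly N) r) * (of_nat r * y ^ (r - 1))) =
        (\<Sum>r\<le>K. of_real (real (Suc r) * coeff (zpoly N) (Suc r)) * y ^ r)"
    unfolding K sum.atMost_Suc_shift by (simp add: mult_ac del: of_nat_Suc)
  also have "\<dots> = (\<Sum>r\<le>K. of_nat (((N - 1) + 1 + r) choose (2 * r + 1)) * y ^ r / 2)"
    by (intro sum.cong refl, subst zpoly_coeff_deriv) (use K in auto)
  finally show ?thesis by (simp add: K sum_divide_distrib)
qed

lemma pderiv_zpoly:
  assumes "N \<ge> 1"
  shows "poly (pderiv (zpoly N)) (2 * c - 2) = chebyshev_U (N - 1) c / 2"
proof -
  have "poly (pderiv (zpoly N)) y = (\<Sum>r\<le>N. of_real (coeff (zpoly N) r) * (of_nat r * y ^ (r - 1)))" for y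
    by (simp add: poly_pderiv_lin poly_lin_altdef[OF degree_zpoly])
  thus ?thesis
    by (simp only: chebyshev_U_eq zpoly_deriv_expand[OF assms] cheb_U_expand[OF order.refl])
qed

section \<open>Fourier expansion of the Bernoulli functional\<close>

text \<open>\<open>exp (i a y) osc a r y\<close> is a primitive of \<open>exp (i a y) r y\<^sup>r\<^sup>-\<^sup>1\<close>.\<close>

fun osc :: "real \<Rightarrow> nat \<Rightarrow> complex \<Rightarrow> complex" where
  "osc a 0 y = 0"
| "osc a (Suc r) y = of_nat (Suc r) / (\<i> * of_real a) * (y ^ r - osc a r y)"

lemma osc_deriv:
  assumes "a \<noteq> 0"
  shows "(osc a r has_field_derivative (of_nat r * y ^ (r - 1) - \<i> * of_real a * osc a r y)) (at y)"
proof (induction r)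
  case (Suc r)
  have "((\<lambda>y. of_nat (Suc r) / (\<i> * of_real a) * (y ^ r - osc a r y)) has_field_derivative
     of_nat (Suc r) / (\<i> * of_real a) * (of_nat r * y ^ (r - 1) - (of_nat r * y ^ (r - 1) - \<i> * of_real a * osc a r y))) (at y)"
    by (rule DERIV_cmult[OF DERIV_diff[OF _ Suc]]) (auto intro!: derivative_eq_intros)
  also have "of_nat (Suc r) / (\<i> * of_real a) * (of_nat r * y ^ (r - 1) - (of_nat r * y ^ (r - 1) - \<i> * of_real a * osc a r y))
     = of_nat (Suc r) * y ^ (Suc r - 1) - \<i> * of_real a * osc a (Suc r) y"
    using assms by (simp add: field_simps del: of_nat_Suc)
  finally show ?case by simp
qed simp

text \<open>Like the powers y^r, the functions \<open>osc a r\<close> form an Appell sequence: the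
  recursion inherits the binomial shift from y^r by absorption. This is what produces the Bernoulli
  recurrence after summation over frequencies.\<close>

lemma osc_shift: "osc a r (y + 1) = (\<Sum>k\<le>r. of_nat (r choose k) * osc a k y)"
proof (induction r)
  case (Suc r)
  have "osc a (Suc r) (y + 1) = of_nat (Suc r) / (\<i> * of_real a) *
      ((\<Sum>k\<le>r. of_nat (r choose k) * y ^ k) - (\<Sum>k\<le>r. of_nat (r choose k) * osc a k y))"
    by (simp add: Suc binomial_ring del: of_nat_Suc)
  also have "\<dots> = (\<Sum>k\<le>r. of_nat (Suc r * (r choose k)) / (\<i> * of_real a) * (y ^ k - osc a k y))"
    unfolding sum_subtractf[symmetric] sum_distrib_left
    by (intro sum.cong refl) (simp add: right_diff_distrib diff_divide_distrib mult_ac del: of_nat_Suc mult_Suc mult_Suc_right binomial_Suc_Suc)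
  also have "\<dots> = (\<Sum>k\<le>r. of_nat (Suc r choose Suc k) * osc a (Suc k) y)"
    by (intro sum.cong refl, subst Suc_times_binomial[symmetric]) (simp add: mult_ac del: of_nat_Suc mult_Suc mult_Suc_right binomial_Suc_Suc)
  also have "\<dots> = (\<Sum>k\<le>Suc r. of_nat (Suc r choose k) * osc a k y)"
    unfolding sum.atMost_Suc_shift by simp
  finally show ?case .
qed simp

text \<open>For a = 2 pi m these are the classical terms -r! / (2 pi i k)^r of the series for the
  Bernoulli number, with k = -m; taking twice the real part pairs k with -k.\<close>

lemma osc_0: "osc a (Suc r) 0 = - fact (Suc r) * (\<i> / of_real a) ^ Suc r"
proof (induction r)
  case 0
  show ?case by (simp add: divide_inverse)
next
  case (Suc r)
  have e: "of_nat k / (\<i> * of_real a) = - of_nat k * (\<i> / of_real a)" for k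
    by (simp add: divide_inverse)
  have "osc a (Suc (Suc r)) 0 = of_nat (Suc (Suc r)) / (\<i> * of_real a) * (- osc a (Suc r) 0)"
    by simp
  also have "\<dots> = - fact (Suc (Suc r)) * (\<i> / of_real a) ^ Suc (Suc r)"
    unfolding Suc e fact_Suc[of "Suc r"] by (simp add: mult_ac del: of_nat_Suc fact_Suc)
  finally show ?case .
qed

lemma osc_0_summable: "summable (\<lambda>m. Re (osc (2 * pi * real (Suc m)) r 0))"
proof (cases r)
  case (Suc r')
  show ?thesis
  proof (cases "r' = 0")
    case True
    \<comment> \<open>For r = 1 the terms decay only like 1/m, but they are purely
      imaginary.\<close>
    have "Re (osc (2 * pi * real (Suc m)) r 0) = 0" for m
      unfolding Suc True osc_0 by (simp add: Re_divide_of_real del: of_nat_Suc of_real_mult)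
    thus ?thesis by simp
  next
    case False
    show ?thesis
    proof (rule summable_comparison_test)
      show "summable (\<lambda>m. fact r * (1 / real (Suc m) ^ 2))"
        using inverse_power_summable[of 2, where ?'a = real] 
        by (intro summable_mult) (subst summable_Suc_iff, simp add: divide_inverse)
      have "norm (Re (osc (2 * pi * real (Suc m)) r 0)) \<le> fact r * (1 / real (Suc m) ^ 2)" for m
      proof -
        have "norm (Re (osc (2 * pi * real (Suc m)) r 0)) \<le> norm (osc (2 * pi * real (Suc m)) r 0)"
          using abs_Re_le_cmod by simp
        also have "\<dots> = fact r * (1 / (2 * pi * real (Suc m))) ^ r"
          unfolding Suc osc_0 by (simp add: norm_mult norm_power norm_divide del: of_nat_Suc)
        also have "(1 / (2 * pi * real (Suc m))) ^ r \<le> (1 / real (Suc m)) ^ r"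
          using pi_gt3 by (intro power_mono divide_left_mono) auto
        also have "(1 / real (Suc m)) ^ r \<le> (1 / real (Suc m)) ^ 2"
          using False Suc by (intro power_decreasing) auto
        finally show ?thesis by (simp add: power_one_over)
      qed
      thus "\<exists>N. \<forall>m\<ge>N. norm (Re (osc (2 * pi * real (Suc m)) r 0)) \<le> fact r * (1 / real (Suc m) ^ 2)"
        by blast
    qed
  qed
qed simp

lemma osc_increment:
  assumes a: "a = 2 * pi * real (Suc m)"
  shows "Re (osc a r 1 - osc a r 0) = integral {0..1} (\<lambda>y. real r * y ^ (r - 1) * cos (a * y))"
proof -
  have a0: "a \<noteq> 0" using a by simp
  let ?F = "\<lambda>z. exp (\<i> * of_real a * z) * osc a r z"
  have F: "(?F has_field_derivative exp (\<i> * of_real a * z) * (of_nat r * z ^ (r - 1))) (at z)" for z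
    by (rule derivative_eq_intros osc_deriv a0 refl)+ (simp add: algebra_simps)
  have "((\<lambda>y. 1 * (exp (\<i> * of_real a * of_real y) * (of_nat r * of_real y ^ (r - 1)))) has_integral ?F (of_real 1) - ?F (of_real 0)) {0..1}"
    by (rule has_integral_curve[OF _ F]) (auto intro!: derivative_eq_intros)
  from has_integral_linear[OF this bounded_linear_Re]
  have "((\<lambda>y. Re (exp (\<i> * of_real (a * y)) * of_real (real r * y ^ (r - 1)))) has_integral Re (?F 1 - ?F 0)) {0..1}"
    by (simp add: o_def mult.assoc)
  moreover have "exp (\<i> * of_real a) = 1"
    using exp_integer_2pi[of "of_nat (Suc m)"] unfolding a by (simp add: mult_ac del: of_nat_Suc)
  ultimately have "((\<lambda>y. real r * y ^ (r - 1) * cos (a * y)) has_integral Re (osc a r 1 - osc a r 0)) {0..1}"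
    by (simp add: Re_exp mult_ac)
  thus ?thesis by (simp only: integral_unique)
qed

text \<open>The binomial sum over k telescopes, by the Appell shift, to the increment of
  \<open>osc\<close> over [0, 1], which is a cosine coefficient of (r + 1) y^r;
  \<open>cos_integral_sums\<close> then sums over m. Hence the corrected sums satisfy the Bernoulli
  recurrence.\<close>

lemma bernoulli_num_osc_sums:
  "(\<lambda>m. 2 * Re (osc (2 * pi * real (Suc m)) r 0)) sums
     (bernoulli_num r - (if r = 0 then 1 else 0) + (if r = 1 then 1/2 else 0))"
proof -
  define e where "e = (\<lambda>r. \<Sum>m. 2 * Re (osc (2 * pi * real (Suc m)) r 0))"
  have e: "(\<lambda>m. 2 * Re (osc (2 * pi * real (Suc m)) r 0)) sums e r" for r
    unfolding e_def by (intro summable_sums summable_mult osc_0_summable)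
  \<comment> \<open>For r = 0 and r = 1 all terms of the series vanish, whereas the Bernoulli
    numbers are 1 and -1/2.\<close>
  define b where "b = (\<lambda>r. e r + (if r = 0 then 1 else 0) - (if r = 1 then 1/2 else 0))"
  have "b r = bernoulli_num r" for r
  proof (rule bernoulli_num_unique)
    fix r
    let ?f = "\<lambda>y. real (Suc r) * y ^ r"
    have "(\<Sum>k\<le>r. real (Suc r choose k) * (2 * Re (osc (2 * pi * real (Suc m)) k 0)))
        = 2 * integral {0..1} (\<lambda>y. ?f y * cos (2 * pi * real (Suc m) * y))" for m
    proof -
      let ?a = "2 * pi * real (Suc m)"
      have "(\<Sum>k\<le>r. real (Suc r choose k) * (2 * Re (osc ?a k 0))) = 2 * Re (\<Sum>k\<le>r. of_nat (Suc r choose k) * osc ?a k 0)"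
        by (simp add: Re_sum sum_distrib_left mult_ac)
      also have "(\<Sum>k\<le>r. of_nat (Suc r choose k) * osc ?a k 0) = osc ?a (Suc r) 1 - osc ?a (Suc r) 0"
        using osc_shift[of ?a "Suc r" 0] by (simp del: osc.simps)
      finally show ?thesis unfolding osc_increment[OF refl] by simp
    qed
    moreover have "(\<lambda>m. \<Sum>k\<le>r. real (Suc r choose k) * (2 * Re (osc (2 * pi * real (Suc m)) k 0)))
        sums (\<Sum>k\<le>r. real (Suc r choose k) * e k)"
      by (intro sums_sum sums_mult e)
    moreover have "(\<lambda>m. 2 * integral {0..1} (\<lambda>y. ?f y * cos (2 * pi * real (Suc m) * y)))
        sums ((?f 0 + ?f 1) / 2 - integral {0..1} ?f)"
      by (rule cos_integral_sums[where f' = "\<lambda>y. real (Suc r) * (real r * y ^ (r - 1))"])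
         (auto intro!: derivative_eq_intros continuous_intros simp del: of_nat_Suc)
    ultimately have "(\<Sum>k\<le>r. real (Suc r choose k) * e k) = (?f 0 + ?f 1) / 2 - integral {0..1} ?f"
      using sums_unique2 by (simp only:)
    also have "integral {0..1} ?f = 1"
    proof -
      have "(?f has_integral (1 ^ Suc r - 0 ^ Suc r)) {0..1::real}"
        by (rule fundamental_theorem_of_calculus)
           (auto intro!: derivative_eq_intros simp del: power_Suc simp flip: has_real_derivative_iff_has_vector_derivative)
      from integral_unique[OF this] show ?thesis by simp
    qed
    finally have E: "(\<Sum>k\<le>r. real (Suc r choose k) * e k) = (?f 0 + ?f 1) / 2 - 1" .
    have "(\<Sum>k\<le>r. real (Suc r choose k) * b k) = (\<Sum>k\<le>r. real (Suc r choose k) * e k)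
       + (\<Sum>k\<le>r. if k = 0 then 1 else 0) - (\<Sum>k\<le>r. if k = 1 then real (Suc r) / 2 else 0)"
      unfolding sum.distrib[symmetric] sum_subtractf[symmetric]
      by (intro sum.cong refl) (auto simp: b_def algebra_simps)
    thus "(\<Sum>k\<le>r. real (Suc r choose k) * b k) = (if r = 0 then 1 else 0)"
      unfolding E by (cases r) (auto simp: sum.delta)
  qed
  hence "e r = bernoulli_num r - (if r = 0 then 1 else 0) + (if r = 1 then 1/2 else 0)"
    by (auto simp: b_def algebra_simps)
  thus ?thesis using e by metis
qed

lemma bernoulli_lin_osc_sums:
  "(\<lambda>m. 2 * Re (\<Sum>r\<le>degree q. of_real (coeff q r) * osc (2 * pi * real (Suc m)) r 0)) sums
     (bernoulli_lin q - poly q 0 + poly (pderiv q) 0 / 2)"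
proof -
  have "(\<lambda>m. \<Sum>r\<le>degree q. coeff q r * (2 * Re (osc (2 * pi * real (Suc m)) r 0))) sums
     (\<Sum>r\<le>degree q. coeff q r * (bernoulli_num r - (if r = 0 then 1 else 0) + (if r = 1 then 1/2 else 0)))"
    by (intro sums_sum sums_mult bernoulli_num_osc_sums)
  also have "(\<lambda>m. \<Sum>r\<le>degree q. coeff q r * (2 * Re (osc (2 * pi * real (Suc m)) r 0))) =
      (\<lambda>m. 2 * Re (\<Sum>r\<le>degree q. of_real (coeff q r) * osc (2 * pi * real (Suc m)) r 0))"
    by (simp add: Re_sum sum_distrib_left mult_ac)
  also have "(\<Sum>r\<le>degree q. coeff q r * (bernoulli_num r - (if r = 0 then 1 else 0) + (if r = 1 then 1/2 else 0)))
     = bernoulli_lin q - poly_lin (\<lambda>r. if r = 0 then 1 else 0) q + poly_lin (\<lambda>r. if r = 1 then 1 else 0) q / 2"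
    unfolding poly_lin_def sum_subtractf[symmetric] sum.distrib[symmetric] sum_divide_distrib
    by (intro sum.cong refl) (auto simp: algebra_simps)
  also have "poly_lin (\<lambda>r. if r = 0 then 1 else 0) q = poly q 0"
    by (rule poly_lin_unique[symmetric]) (auto simp: poly_monom)
  also have "poly_lin (\<lambda>r. if r = 1 then 1 else 0) q = poly (pderiv q) 0"
    by (rule poly_lin_unique[symmetric]) (auto simp: pderiv_add pderiv_smult pderiv_monom poly_monom)
  finally show ?thesis .
qed

section \<open>A Fresnel integral\<close>

lemma integral_halfline_FTC_interior:
  fixes f :: "real \<Rightarrow> real"
  assumes "f absolutely_integrable_on {a..}" "continuous_on {a..} F"
    and "\<And>t. t > a \<Longrightarrow> (F has_real_derivative f t) (at t)"
    and "(F \<longlongrightarrow> l) at_top"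
  shows "integral {a..} f = l - F a"
proof (rule tendsto_unique[OF _ integral_halfline_tendsto[OF assms(1)]])
  have "integral {a..R} f = F R - F a" if "R \<ge> a" for R
    by (rule integral_unique, rule fundamental_theorem_of_calculus_interior[OF that])
       (use assms(2,3) in \<open>auto intro: continuous_on_subset simp flip: has_real_derivative_iff_has_vector_derivative\<close>)
  moreover have "((\<lambda>R. F R - F a) \<longlongrightarrow> l - F a) at_top"
    by (intro tendsto_intros assms)
  ultimately show "((\<lambda>R. integral {a..R} f) \<longlongrightarrow> l - F a) at_top"
    by (elim Lim_transform_eventually) (auto intro: eventually_mono[OF eventually_ge_at_top[of a]])
qed simp

lemma absolutely_integrable_halfline_open:
  fixes f :: "real \<Rightarrow> real"
  shows "f absolutely_integrable_on {a<..} \<longleftrightarrow> f absolutely_integrable_on {a..}"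
    and "integral {a<..} f = integral {a..} f"
proof -
  have n: "negligible {x \<in> {a<..} - {a..}. P x}" "negligible {x \<in> {a..} - {a<..}. P x}" for P
    by (auto intro: negligible_subset[of "{a}"])
  show "f absolutely_integrable_on {a<..} \<longleftrightarrow> f absolutely_integrable_on {a..}"
    by (rule absolutely_integrable_spike_set_eq) (rule n)+
  show "integral {a<..} f = integral {a..} f"
    by (rule integral_spike_set) (rule n)+
qed

lemma absolutely_integrable_powr_bound:
  fixes f :: "real \<Rightarrow> real"
  assumes cont: "continuous_on {0<..} f" and p: "p > -1" and q: "q < -1"
    and b0: "\<And>y. 0 < y \<Longrightarrow> y \<le> 1 \<Longrightarrow> \<bar>f y\<bar> \<le> A * y powr p"
    and b1: "\<And>y. 1 \<le> y \<Longrightarrow> \<bar>f y\<bar> \<le> B * y powr q"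
  shows "f absolutely_integrable_on {0<..}"
proof -
  have 0: "f absolutely_integrable_on {0<..1}"
  proof (rule measurable_bounded_by_integrable_imp_absolutely_integrable)
    show "f \<in> borel_measurable (lebesgue_on {0<..1})"
      by (rule continuous_imp_measurable_on_sets_lebesgue) (auto intro: continuous_on_subset[OF cont])
    show "(\<lambda>y. A * y powr p) integrable_on {0<..1}"
      by (intro integrable_on_mult_right integrable_on_powr_from_0' p) auto
  qed (use b0 in auto)
  have 1: "f absolutely_integrable_on {1..}"
  proof (rule measurable_bounded_by_integrable_imp_absolutely_integrable)
    show "f \<in> borel_measurable (lebesgue_on {1..})"
      by (rule continuous_imp_measurable_on_sets_lebesgue) (auto intro: continuous_on_subset[OF cont])
    show "(\<lambda>y. B * y powr q) integrable_on {1..}"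
      using has_integral_powr_to_inf[of q 1] q
      by (intro integrable_on_mult_right) (auto simp: integrable_on_def)
  qed (use b1 in auto)
  have "f absolutely_integrable_on ({0<..1} \<union> {1..})"
    by (rule set_integrable_Un[OF 0 1]) auto
  also have "{0<..1} \<union> {1..} = {0::real<..}" by auto
  finally show ?thesis .
qed

text \<open>A regularized Gamma(-1/2): integration by parts with -2 u^(-1/2) (1 - exp(-u)), which
  vanishes at both ends, reduces it to 2 Gamma(1/2).\<close>

lemma integral_one_minus_exp_powr:
  defines "f \<equiv> \<lambda>u::real. (1 - exp (- u)) * u powr (-3/2)"
  shows "f absolutely_integrable_on {0<..}" "integral {0<..} f = 2 * sqrt pi"
proof -
  show ai: "f absolutely_integrable_on {0<..}"
  proof (rule absolutely_integrable_powr_bound[where p = "-1/2" and q = "-3/2" and A = 1 and B = 1])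
    show "continuous_on {0<..} f" unfolding f_def by (intro continuous_intros) auto
    fix y :: real
    {
      assume y: "0 < y" "y \<le> 1"
      have "1 - exp (- y) \<le> y" using exp_ge_add_one_self[of "- y"] by linarith
      hence "(1 - exp (- y)) * y powr (-3/2) \<le> y * y powr (-3/2)"
        by (intro mult_right_mono) auto
      also have "y * y powr (-3/2) = y powr (-1/2)"
        using y powr_add[of y 1 "-3/2"] by simp
      finally show "\<bar>f y\<bar> \<le> 1 * y powr (-1/2)"
        using y by (simp add: f_def abs_mult)
    }
    assume y: "1 \<le> y"
    have "(1 - exp (- y)) * y powr (-3/2) \<le> 1 * y powr (-3/2)"
      by (intro mult_right_mono) auto
    thus "\<bar>f y\<bar> \<le> 1 * y powr (-3/2)"
      using y by (simp add: f_def abs_mult)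
  qed auto
  let ?g = "\<lambda>u::real. u powr (-1/2) / exp u"
  have G: "(?g has_integral sqrt pi) {0..}"
    using Gamma_integral_real[of "1/2"] by (simp add: Gamma_one_half_real)
  hence gai: "?g absolutely_integrable_on {0..}"
    by (intro nonnegative_absolutely_integrable_1) auto
  let ?F = "\<lambda>u::real. - 2 * (u powr (-1/2) * (1 - exp (- u)))"
  have "integral {0..} (\<lambda>u. f u - 2 * ?g u) = 0 - ?F 0"
  proof (rule integral_halfline_FTC_interior)
    show "(\<lambda>u. f u - 2 * ?g u) absolutely_integrable_on {0..}"
      using ai gai by (intro set_integral_diff set_integrable_mult_right) (auto simp: absolutely_integrable_halfline_open)
    show "(?F \<longlongrightarrow> 0) at_top" by real_asymp
    show "continuous_on {0..} ?F"
    proof (rule continuous_on_eq_continuous_within[THEN iffD2], intro ballI)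
      fix x :: real assume "x \<in> {0..}"
      show "continuous (at x within {0..}) ?F"
      proof (cases "x = 0")
        case True
        have "(?F \<longlongrightarrow> 0) (at_right 0)" by real_asymp
        moreover have "at 0 within {0::real..} = at_right 0" by (rule at_within_Ici_at_right)
        ultimately show ?thesis using True by (simp add: continuous_within)
      next
        case False
        thus ?thesis using \<open>x \<in> {0..}\<close> by (intro continuous_intros) auto
      qed
    qed
    fix u :: real assume u: "u > 0"
    show "(?F has_real_derivative f u - 2 * ?g u) (at u)"
      using u by (auto intro!: derivative_eq_intros simp: f_def exp_minus field_simps)
  qed
  moreover have "((\<lambda>u. f u - 2 * ?g u) has_integral integral {0..} f - 2 * sqrt pi) {0..}"
    using ai by (intro has_integral_diff has_integral_mult_right integrable_integral G
        set_lebesgue_integral_eq_integral(1)) (simp add: absolutely_integrable_halfline_open)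
  ultimately show "integral {0<..} f = 2 * sqrt pi"
    by (simp add: absolutely_integrable_halfline_open integral_unique)
qed

section \<open>Rotation of the half-line for the Fresnel integral\<close>

lemma integral_UNIV_tendsto:
  fixes f :: "real \<Rightarrow> real"
  assumes "f absolutely_integrable_on UNIV"
  shows "(\<lambda>n. integral {- real n..real n} f) \<longlonglongrightarrow> integral UNIV f"
proof -
  have sub: "f integrable_on {- real n..real n}" for n
    by (rule set_lebesgue_integral_eq_integral(1)[OF set_integrable_subset[OF assms]]) auto
  have "(\<lambda>n. integral UNIV (\<lambda>x. if x \<in> {- real n..real n} then f x else 0)) \<longlonglongrightarrow> integral UNIV f"
  proof (rule dominated_convergence(2)[where h = "\<lambda>x. norm (f x)"])
    show "(\<lambda>x. if x \<in> {- real n..real n} then f x else 0) integrable_on UNIV" for n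
      unfolding integrable_restrict_UNIV by (rule sub)
    show "(\<lambda>x. norm (f x)) integrable_on UNIV"
      using assms by (simp add: absolutely_integrable_on_def)
    fix x :: real
    have "\<forall>\<^sub>F n in sequentially. \<bar>x\<bar> \<le> real n"
      by (rule eventually_mono[OF eventually_ge_at_top[of "nat \<lceil>\<bar>x\<bar>\<rceil>"]]) linarith
    hence "\<forall>\<^sub>F n in sequentially. (if x \<in> {- real n..real n} then f x else 0) = f x"
      by (rule eventually_mono) auto
    thus "(\<lambda>n. if x \<in> {- real n..real n} then f x else 0) \<longlonglongrightarrow> f x"
      by (rule tendsto_eventually)
  qed auto
  thus ?thesis by (simp only: integral_restrict_UNIV)
qed

lemma integral_exp_substitution:
  fixes f :: "real \<Rightarrow> real"
  assumes "f absolutely_integrable_on {0<..}"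
  shows "(\<lambda>t. exp t * f (exp t)) absolutely_integrable_on UNIV"
        "integral UNIV (\<lambda>t. exp t * f (exp t)) = integral {0<..} f"
proof -
  have img: "range exp = {0::real<..}"
    by (auto simp: image_iff) (metis exp_ln)
  have "(\<lambda>t. \<bar>exp t\<bar> * f (exp t)) absolutely_integrable_on UNIV \<and>
        integral UNIV (\<lambda>t. \<bar>exp t\<bar> * f (exp t)) = integral {0<..} f"
    by (subst has_absolute_integral_change_of_variables_1'[where S = UNIV and g = exp and g' = exp and f = f])
       (use assms img in \<open>auto intro!: derivative_eq_intros injI\<close>)
  thus "(\<lambda>t. exp t * f (exp t)) absolutely_integrable_on UNIV"
       "integral UNIV (\<lambda>t. exp t * f (exp t)) = integral {0<..} f" by simp_all
qed

text \<open>Rotation of (exp(iz) - 1) z^(-3/2) from the positive real to the positive imaginary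
  axis. In z = exp w the branch point disappears and the rotation is a shift to Im w = pi/2 of an
  entire function. The subtracted 1 gives integrability at z = 0 and leaves the imaginary part on
  the real axis unchanged.\<close>

lemma integral_sin_powr_1:
  defines "f \<equiv> \<lambda>y::real. sin y * y powr (-3/2)"
  shows "f absolutely_integrable_on {0<..}" "integral {0<..} f = sqrt (2 * pi)"
proof -
  show ai: "f absolutely_integrable_on {0<..}"
  proof (rule absolutely_integrable_powr_bound[where p = "-1/2" and q = "-3/2" and A = 1 and B = 1])
    show "continuous_on {0<..} f" unfolding f_def by (intro continuous_intros) auto
    fix y :: real
    {
      assume y: "0 < y" "y \<le> 1"
      have "\<bar>sin y\<bar> * y powr (-3/2) \<le> y * y powr (-3/2)"
        using abs_sin_x_le_abs_x[of y] y by (intro mult_right_mono) auto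
      also have "y * y powr (-3/2) = y powr (-1/2)"
        using y powr_add[of y 1 "-3/2"] by simp
      finally show "\<bar>f y\<bar> \<le> 1 * y powr (-1/2)"
        by (simp add: f_def abs_mult)
    }
    assume y: "1 \<le> y"
    have "\<bar>sin y\<bar> * y powr (-3/2) \<le> 1 * y powr (-3/2)"
      by (intro mult_right_mono) auto
    thus "\<bar>f y\<bar> \<le> 1 * y powr (-3/2)"
      by (simp add: f_def abs_mult)
  qed auto
  let ?h = "\<lambda>w. (exp (\<i> * exp w) - 1) * exp (- w / 2) :: complex"
  let ?b = "\<lambda>t::real. exp t * (sin (exp t) * exp t powr (-3/2))"
  let ?t = "\<lambda>t::real. exp t * ((1 - exp (- exp t)) * exp t powr (-3/2))"
  have pw: "exp t * (s * exp t powr (-3/2)) = s * exp (- t / 2)" for s t :: real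
    by (simp add: exp_powr_real flip: exp_add)
  have hol: "?h holomorphic_on UNIV" by (intro holomorphic_intros) auto
  have cont: "continuous_on A ?h" for A
    using hol holomorphic_on_imp_continuous_on continuous_on_subset by blast
  define E where "E = (\<lambda>T. integral {0..pi/2} (\<lambda>\<phi>. Re (?h (Complex T \<phi>))))"
  have eq: "integral {-T..T} ?b = sqrt 2 / 2 * integral {-T..T} ?t + E (- T) - E T" if "T \<ge> 0" for T
  proof -
    have io1: "(\<lambda>t. ?h (Complex t y)) integrable_on {-T..T}" for y
      by (intro integrable_continuous_interval continuous_on_compose2[OF cont])
         (auto simp: Complex_eq intro!: continuous_intros)
    have io2: "(\<lambda>\<phi>. ?h (Complex T \<phi>)) integrable_on {0..pi/2}" for T
      by (intro integrable_continuous_interval continuous_on_compose2[OF cont])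
         (auto simp: Complex_eq intro!: continuous_intros)
    have "Im (?h (Complex t 0)) = ?b t" for t
      unfolding pw by (simp add: Im_exp Re_exp)
    hence i1: "Im (integral {-T..T} (\<lambda>t. ?h (Complex t 0))) = integral {-T..T} ?b"
      unfolding Im_integral[OF io1] by (simp only:)
    have "Im (?h (Complex t (pi/2))) = sqrt 2 / 2 * ?t t" for t
      unfolding pw by (simp add: Im_exp Re_exp sin_45 cos_45 algebra_simps)
    hence i2: "Im (integral {-T..T} (\<lambda>t. ?h (Complex t (pi/2)))) = sqrt 2 / 2 * integral {-T..T} ?t"
      unfolding Im_integral[OF io1] by (simp only: integral_mult_right)
    have "integral {-T..T} ?b + E T = sqrt 2 / 2 * integral {-T..T} ?t + E (- T)"
      unfolding i1[symmetric] i2[symmetric] E_def Re_integral[OF io2, symmetric]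
      using arg_cong[OF entire_rectangle[OF hol, of "-T" T 0 "pi/2"], of Im] that
      by (simp only: plus_complex.sel Im_i_times) simp
    thus ?thesis by simp
  qed
  have bound: "\<bar>E T\<bar> \<le> B * (pi / 2)" if "\<And>\<phi>. \<phi> \<in> {0..pi/2} \<Longrightarrow> norm (?h (Complex T \<phi>)) \<le> B" for T B
  proof -
    have "norm (E T) \<le> B * (pi / 2 - 0)"
      unfolding E_def
    proof (rule integral_bound)
      show "continuous_on {0..pi/2} (\<lambda>\<phi>. Re (?h (Complex T \<phi>)))"
        by (intro continuous_on_Re continuous_on_compose2[OF cont])
           (auto simp: Complex_eq intro!: continuous_intros)
      show "norm (Re (?h (Complex T \<phi>))) \<le> B" if "\<phi> \<in> {0..pi/2}" for \<phi>
        unfolding real_norm_def using \<open>_ \<Longrightarrow> _ \<le> B\<close>[OF that] abs_Re_le_cmod order_trans by blast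
    qed simp
    thus ?thesis by simp
  qed
  have lim1: "(\<lambda>n. E (real n)) \<longlonglongrightarrow> 0"
  proof (rule Lim_null_comparison)
    have "norm (?h (Complex T \<phi>)) \<le> 2 * exp (- T / 2)" if "\<phi> \<in> {0..pi/2}" for T \<phi>
    proof -
      have "sin \<phi> \<ge> 0" using that by (intro sin_ge_zero) auto
      hence "norm (exp (\<i> * exp (Complex T \<phi>))) \<le> 1"
        by (simp add: Im_exp)
      hence "norm (exp (\<i> * exp (Complex T \<phi>)) - 1) \<le> 1 + 1"
        by (intro order_trans[OF norm_triangle_ineq4]) simp
      thus ?thesis unfolding norm_mult by (intro mult_mono) auto
    qed
    from bound[OF this] show "\<forall>\<^sub>F n in sequentially. norm (E (real n)) \<le> 2 * exp (- real n / 2) * (pi / 2)"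
      by simp
    show "(\<lambda>n. 2 * exp (- real n / 2) * (pi / 2)) \<longlonglongrightarrow> 0" by real_asymp
  qed
  have lim2: "(\<lambda>n. E (- real n)) \<longlonglongrightarrow> 0"
  proof (rule Lim_null_comparison)
    have hyp: "norm (?h (Complex (-T) \<phi>)) \<le> 3 / 2 * exp (- T) * exp (T / 2)" if "T \<ge> 1" for T \<phi>
    proof -
      let ?z = "\<i> * exp (Complex (-T) \<phi>)"
      have nz: "norm ?z = exp (- T)" by (simp add: norm_mult)
      have "exp T \<ge> 2" using exp_ge_add_one_self[of T] that by linarith
      hence "norm ?z \<le> 1 / 2" unfolding nz by (simp add: exp_minus field_simps)
      hence "norm (exp ?z - 1) \<le> 3 / 2 * norm ?z"
        by (rule norm_exp_bounds)
      thus ?thesis unfolding norm_mult nz by (intro mult_mono) auto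
    qed
    have hyp_n: "norm (?h (Complex (- real n) \<phi>)) \<le> 3 / 2 * exp (- real n) * exp (real n / 2)" if "n \<ge> 1" for n \<phi>
      by (rule hyp) (use that in simp)
    have "norm (E (- real n)) \<le> 3 / 2 * exp (- real n) * exp (real n / 2) * (pi / 2)" if "n \<ge> 1" for n
      using bound[OF hyp_n[OF that]] by (simp only: real_norm_def)
    thus "\<forall>\<^sub>F n in sequentially. norm (E (- real n)) \<le> 3 / 2 * exp (- real n) * exp (real n / 2) * (pi / 2)"
      by (intro eventually_mono[OF eventually_ge_at_top[of 1]])
    show "(\<lambda>n. 3 / 2 * exp (- real n) * exp (real n / 2) * (pi / 2)) \<longlonglongrightarrow> 0" by real_asymp
  qed
  note t = integral_exp_substitution[OF integral_one_minus_exp_powr(1)]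
  note b = integral_exp_substitution[OF ai]
  have "(\<lambda>n. sqrt 2 / 2 * integral {- real n..real n} ?t + E (- real n) - E (real n))
     \<longlonglongrightarrow> sqrt 2 / 2 * (2 * sqrt pi) + 0 - 0"
    using integral_UNIV_tendsto[OF t(1)] unfolding t(2) integral_one_minus_exp_powr(2)
    by (intro tendsto_intros lim1 lim2)
  hence "(\<lambda>n. integral {- real n..real n} ?b) \<longlonglongrightarrow> sqrt 2 / 2 * (2 * sqrt pi) + 0 - 0"
    by (simp only: eq of_nat_0_le_iff)
  moreover have "(\<lambda>n. integral {- real n..real n} ?b) \<longlonglongrightarrow> integral {0<..} f"
    using integral_UNIV_tendsto[OF b(1)] unfolding b(2) by (simp only: f_def)
  ultimately have "integral {0<..} f = sqrt 2 / 2 * (2 * sqrt pi) + 0 - 0"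
    using LIMSEQ_unique by blast
  thus "integral {0<..} f = sqrt (2 * pi)" by (simp add: real_sqrt_mult)
qed

lemma integral_sin_powr:
  assumes a: "a > 0"
  defines "f \<equiv> \<lambda>y::real. sin (a * y) * y powr (-3/2)"
  shows "f absolutely_integrable_on {0<..}" "integral {0<..} f = sqrt (2 * pi * a)"
proof -
  let ?g = "\<lambda>y::real. sin y * y powr (-3/2)"
  have img: "(*) a ` {0<..} = {0<..}"
    using a by (auto simp: image_iff intro!: bexI[of _ "_ / a"])
  have "(\<lambda>t. \<bar>a\<bar> * ?g (a * t)) absolutely_integrable_on {0<..} \<and>
        integral {0<..} (\<lambda>t. \<bar>a\<bar> * ?g (a * t)) = sqrt (2 * pi)"
    by (subst has_absolute_integral_change_of_variables_1'[where g' = "\<lambda>_. a"])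
       (use a img integral_sin_powr_1 in \<open>auto intro!: derivative_eq_intros simp: inj_on_def\<close>)
  hence 1: "(\<lambda>t. sqrt a * (\<bar>a\<bar> * ?g (a * t))) absolutely_integrable_on {0<..}"
    and 2: "integral {0<..} (\<lambda>t. sqrt a * (\<bar>a\<bar> * ?g (a * t))) = sqrt a * sqrt (2 * pi)"
    by (auto intro: set_integrable_mult_right)
  have e: "sqrt a * (\<bar>a\<bar> * ?g (a * t)) = f t" for t
  proof -
    have "a powr (1/2) * a powr 1 * a powr (-3/2) = 1"
      using a by (simp only: powr_add[symmetric]) simp
    hence "sqrt a * a * a powr (-3/2) = 1"
      using a by (simp add: powr_half_sqrt)
    thus ?thesis using a by (simp add: f_def powr_mult mult_ac)
  qed
  show "f absolutely_integrable_on {0<..}" "integral {0<..} f = sqrt (2 * pi * a)"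
    using 1 2 unfolding e by (simp_all add: real_sqrt_mult mult_ac)
qed

section \<open>The zeta value\<close>

lemma sqrt_step:
  "2 * (sqrt (real (Suc (Suc k))) - sqrt (real (Suc k))) \<le> 1 / sqrt (real (Suc k))"
  "1 / sqrt (real (Suc k)) \<le> 2 * (sqrt (real (Suc k)) - sqrt (real k))"
proof -
  have *: "sqrt (x + 1) - sqrt x = 1 / (sqrt (x + 1) + sqrt x)" if "x \<ge> 0" for x :: real
  proof -
    have "(sqrt (x + 1) - sqrt x) * (sqrt (x + 1) + sqrt x) = sqrt (x + 1) * sqrt (x + 1) - sqrt x * sqrt x"
      by (simp only: square_diff_square_factored mult.commute)
    hence "(sqrt (x + 1) - sqrt x) * (sqrt (x + 1) + sqrt x) = 1"
      using that by simp
    moreover have "sqrt (x + 1) + sqrt x > 0" using that by (simp add: add_pos_nonneg)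
    ultimately show ?thesis by (intro eq_divide_imp) auto
  qed
  have "1 / (sqrt (real (Suc k) + 1) + sqrt (real (Suc k))) \<le> 1 / (sqrt (real (Suc k)) + sqrt (real (Suc k)))"
    by (intro divide_left_mono mult_pos_pos) (auto intro: add_pos_nonneg)
  with *[of "real (Suc k)"] show "2 * (sqrt (real (Suc (Suc k))) - sqrt (real (Suc k))) \<le> 1 / sqrt (real (Suc k))"
    by (simp add: add_ac)
  have "1 / (sqrt (real k + 1) + sqrt (real k + 1)) \<le> 1 / (sqrt (real k + 1) + sqrt (real k))"
    by (intro divide_left_mono mult_pos_pos) (auto intro: add_pos_nonneg)
  with *[of "real k"] show "1 / sqrt (real (Suc k)) \<le> 2 * (sqrt (real (Suc k)) - sqrt (real k))"
    by (simp add: add_ac)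
qed

lemma inverse_sqrt_sum_converges:
  "convergent (\<lambda>K. (\<Sum>k<K. 1 / sqrt (real (Suc k))) - 2 * sqrt (real K))"
proof -
  let ?X = "\<lambda>K. (\<Sum>k<K. 1 / sqrt (real (Suc k))) - 2 * sqrt (real K)"
  have dec: "decseq ?X"
  proof (rule decseq_SucI)
    fix K
    show "?X (Suc K) \<le> ?X K"
    proof -
      have "s + a - 2 * b \<le> s - 2 * c" if "a \<le> 2 * (b - c)" for s a b c :: real
        using that by (simp add: right_diff_distrib)
      from this[OF sqrt_step(2)] show ?thesis by (simp only: sum.lessThan_Suc)
    qed
  qed
  have lb: "- 2 \<le> ?X K" for K
  proof -
    have "(\<Sum>k<K. 2 * sqrt (real (Suc (Suc k))) - 2 * sqrt (real (Suc k))) \<le> (\<Sum>k<K. 1 / sqrt (real (Suc k)))"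
    proof (rule sum_mono)
      fix k
      show "2 * sqrt (real (Suc (Suc k))) - 2 * sqrt (real (Suc k)) \<le> 1 / sqrt (real (Suc k))"
        using sqrt_step(1)[of k] by (simp only: right_diff_distrib)
    qed
    moreover have "(\<Sum>k<K. 2 * sqrt (real (Suc (Suc k))) - 2 * sqrt (real (Suc k))) = 2 * sqrt (real (Suc K)) - 2"
      using sum_lessThan_telescope[of "\<lambda>k. 2 * sqrt (real (Suc k))" K] by simp
    moreover have "sqrt (real K) \<le> sqrt (real (Suc K))" by simp
    ultimately show ?thesis by linarith
  qed
  from decseq_convergent[OF dec, of "- 2"] lb obtain L where "?X \<longlonglongrightarrow> L"
    by blast
  thus ?thesis by (rule convergentI)
qed

text \<open>The alternating sum of 2K terms is H(2K) - sqrt 2 H(K). The square-root corrections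
  cancel in this combination, so its limit is (1 - sqrt 2) c, and 1 - sqrt 2 is the denominator in
  \<open>zeta_real\<close> at 1/2.\<close>

lemma zeta_half_tendsto:
  "(\<lambda>K. (\<Sum>k<K. 1 / sqrt (real (Suc k))) - 2 * sqrt (real K)) \<longlonglongrightarrow> zeta_real (1/2)"
proof -
  define H where "H = (\<lambda>K. \<Sum>k<K. 1 / sqrt (real (Suc k)))"
  define X where "X = (\<lambda>K. H K - 2 * sqrt (real K))"
  obtain c where c: "X \<longlonglongrightarrow> c"
    using inverse_sqrt_sum_converges unfolding convergent_def X_def H_def by blast
  let ?a = "\<lambda>k. (-1) ^ k / real (k + 1) powr (1/2)"
  have "(\<Sum>k<2 * K. ?a k) = H (2 * K) - sqrt 2 * H K" for K
    unfolding H_def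
  proof (induction K)
    case (Suc K)
    have e: "real (Suc (Suc (2 * K))) = 2 * real (Suc K)" by simp
    have "1 / (sqrt 2 * s) - sqrt 2 * (1 / s) = - 1 / (sqrt 2 * s)" if "s > 0" for s
      using that by (simp add: divide_simps)
    from this[of "sqrt (real (Suc K))"]
    have "1 / sqrt (real (Suc (Suc (2 * K)))) - sqrt 2 * (1 / sqrt (real (Suc K))) = - 1 / sqrt (real (Suc (Suc (2 * K))))"
      unfolding e real_sqrt_mult by simp
    moreover have "(\<Sum>k<2 * Suc K. ?a k) = (\<Sum>k<2 * K. ?a k) + 1 / sqrt (real (Suc (2 * K))) - 1 / sqrt (real (Suc (Suc (2 * K))))"
      by (simp add: powr_half_sqrt add_ac)
    moreover have "(\<Sum>k<2 * Suc K. 1 / sqrt (real (Suc k))) = (\<Sum>k<2 * K. 1 / sqrt (real (Suc k)))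
       + 1 / sqrt (real (Suc (2 * K))) + 1 / sqrt (real (Suc (Suc (2 * K))))"
      by simp
    ultimately show ?case using Suc
      by (simp only: sum.lessThan_Suc distrib_left)
  qed simp
  also have "H (2 * K) - sqrt 2 * H K = X (2 * K) - sqrt 2 * X K" for K
    by (simp add: X_def real_sqrt_mult algebra_simps)
  finally have "(\<lambda>K. \<Sum>k<2 * K. ?a k) = (\<lambda>K. X (2 * K) - sqrt 2 * X K)" by (rule ext)
  moreover have "(\<lambda>K. X (2 * K)) \<longlonglongrightarrow> c"
    using LIMSEQ_subseq_LIMSEQ[OF c, of "\<lambda>K. 2 * K"] by (simp add: strict_mono_def o_def)
  ultimately have "(\<lambda>K. \<Sum>k<2 * K. ?a k) \<longlonglongrightarrow> c - sqrt 2 * c"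
    using c by (auto intro!: tendsto_intros)
  moreover have "summable (\<lambda>k. (-1) ^ k * (1 / real (k + 1) powr (1/2)))"
  proof (rule summable_Leibniz'(1))
    show "(\<lambda>k. 1 / real (k + 1) powr (1/2)) \<longlonglongrightarrow> 0" by real_asymp
    show "1 / real (Suc n + 1) powr (1/2) \<le> 1 / real (n + 1) powr (1/2)" for n
      by (rule divide_left_mono) (simp_all add: powr_mono2)
  qed simp
  hence "(\<lambda>K. \<Sum>k<K. ?a k) \<longlonglongrightarrow> suminf ?a"
    using summable_LIMSEQ[of ?a] by simp
  hence "(\<lambda>K. \<Sum>k<2 * K. ?a k) \<longlonglongrightarrow> suminf ?a"
    using LIMSEQ_subseq_LIMSEQ[of "\<lambda>K. \<Sum>k<K. ?a k" _ "\<lambda>K. 2 * K"] by (simp add: strict_mono_def o_def)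
  ultimately have "suminf ?a = c - sqrt 2 * c"
    using LIMSEQ_unique by blast
  hence "zeta_real (1/2) = (c * (1 - sqrt 2)) / (1 - sqrt 2)"
    by (simp add: zeta_real_def powr_half_sqrt algebra_simps)
  hence "zeta_real (1/2) = c" by simp
  thus ?thesis using c by (simp add: X_def[abs_def] H_def)
qed

section \<open>Euler-Maclaurin summation of the kernel\<close>

text \<open>Bounded variation in a form closed under sums and products. The derivative is prescribed
  for y > 0 only and must be integrable rather than bounded, since that of the kernel blows up like
  1 / sqrt y at 0.\<close>

definition bv_halfline :: "(real \<Rightarrow> real) \<Rightarrow> (real \<Rightarrow> real) \<Rightarrow> bool" where
  "bv_halfline f f' \<longleftrightarrow> continuous_on {0..} f \<and> bounded (f ` {0..}) \<and>
     (\<forall>y>0. (f has_real_derivative f' y) (at y)) \<and> f' absolutely_integrable_on {0..}"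

text \<open>A nonnegative derivative is integrable as soon as its primitive has a limit, so monotone
  pieces need no estimate of the derivative near 0 or at infinity.\<close>

lemma bv_halfline_monotone:
  assumes cont: "continuous_on {0..} f" and bnd: "\<And>y. y \<ge> 0 \<Longrightarrow> \<bar>f y\<bar> \<le> B"
    and deriv: "\<And>y. y > 0 \<Longrightarrow> (f has_real_derivative f' y) (at y)"
    and nonneg: "\<And>y. y > 0 \<Longrightarrow> f' y \<ge> 0" and lim: "(f \<longlongrightarrow> l) at_top"
  shows "bv_halfline f f'"
proof -
  \<comment> \<open>The value of f' at 0 is unconstrained and could be negative; nonnegativity is
    wanted on all of the closed half-line.\<close>
  let ?g = "\<lambda>y. if y = 0 then 0 else f' y"
  have I: "(?g has_integral f y - f 0) {0..y}" if "y \<ge> 0" for y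
    by (rule fundamental_theorem_of_calculus_interior[OF that])
       (use deriv cont in \<open>auto intro: continuous_on_subset simp flip: has_real_derivative_iff_has_vector_derivative\<close>)
  have "(?g has_integral l - f 0) {0..}"
  proof (rule has_integral_to_inf)
    show "?g integrable_on {0..y}" for y
      by (cases "y \<ge> 0") (use I in \<open>auto simp: integrable_on_def\<close>)
    have "((\<lambda>y. f y - f 0) \<longlongrightarrow> l - f 0) at_top" by (intro tendsto_intros lim)
    moreover have "\<forall>\<^sub>F y in at_top. f y - f 0 = integral {0..y} ?g"
      by (rule eventually_mono[OF eventually_ge_at_top[of 0]]) (simp only: integral_unique[OF I])
    ultimately show "((\<lambda>y. integral {0..y} ?g) \<longlongrightarrow> l - f 0) at_top"
      by (rule Lim_transform_eventually)
  qed (use nonneg in auto)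
  hence "?g absolutely_integrable_on {0..}"
    by (intro nonnegative_absolutely_integrable_1) (use nonneg in \<open>auto simp: integrable_on_def\<close>)
  hence "f' absolutely_integrable_on {0..}"
    by (rule absolutely_integrable_spike[where S = "{0}"]) auto
  moreover have "bounded (f ` {0..})"
    using bnd by (auto intro!: boundedI)
  ultimately show ?thesis using cont deriv by (simp add: bv_halfline_def)
qed

lemma bv_halfline_const: "bv_halfline (\<lambda>_. c) (\<lambda>_. 0)"
  by (auto simp: bv_halfline_def intro!: boundedI[where B = "\<bar>c\<bar>"])

lemma bv_halfline_add:
  assumes "bv_halfline f f'" "bv_halfline g g'"
  shows "bv_halfline (\<lambda>y. f y + g y) (\<lambda>y. f' y + g' y)"
  using assms unfolding bv_halfline_def
  by (auto intro!: continuous_intros derivative_intros set_integral_add bounded_plus_comp)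

lemma bv_halfline_mult:
  assumes "bv_halfline f f'" "bv_halfline g g'"
  shows "bv_halfline (\<lambda>y. f y * g y) (\<lambda>y. f' y * g y + g' y * f y)"
proof -
  have prod: "(\<lambda>y. f' y * g y) absolutely_integrable_on {0..}"
    if "bv_halfline f f'" "bv_halfline g g'" for f g f' g'
    unfolding mult.commute[of "f' _"]
    by (rule absolutely_integrable_bounded_measurable_product_real)
       (use that in \<open>auto simp: bv_halfline_def intro: continuous_imp_measurable_on_sets_lebesgue\<close>)
  from assms have "bounded (f ` {0..})" "bounded (g ` {0..})"
    by (auto simp: bv_halfline_def)
  then obtain A B where A: "\<And>y. y \<ge> 0 \<Longrightarrow> \<bar>f y\<bar> \<le> A" and B: "\<And>y. y \<ge> 0 \<Longrightarrow> \<bar>g y\<bar> \<le> B"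
    unfolding bounded_iff by auto
  have "\<bar>f y * g y\<bar> \<le> A * B" if "y \<ge> 0" for y
    unfolding abs_mult using A[OF that] B[OF that] by (intro mult_mono) auto
  hence "bounded ((\<lambda>y. f y * g y) ` {0..})"
    by (auto intro!: boundedI)
  moreover have "continuous_on {0..} (\<lambda>y. f y * g y)"
    using assms by (intro continuous_intros) (auto simp: bv_halfline_def)
  moreover have "((\<lambda>y. f y * g y) has_real_derivative f' y * g y + g' y * f y) (at y)" if "y > 0" for y
    using assms that by (intro DERIV_mult) (auto simp: bv_halfline_def)
  ultimately show ?thesis
    using set_integral_add(1)[OF prod[OF assms] prod[OF assms(2,1)]] by (simp add: bv_halfline_def)
qed

lemma integral_sawtooth_halfline:
  assumes f: "bv_halfline f f'"
  shows "(\<lambda>K. integral {0..real K} f - (\<Sum>k<K. (f (real k) + f (real (Suc k))) / 2))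
           \<longlonglongrightarrow> integral {0..} (\<lambda>y. f' y * sawtooth y)"
proof -
  have ai: "f' absolutely_integrable_on {0..}" and cont: "continuous_on {0..} f"
    and deriv: "\<And>y. y > 0 \<Longrightarrow> (f has_real_derivative f' y) (at y)"
    using f by (auto simp: bv_halfline_def)
  let ?s = "\<lambda>y. f' y * sawtooth y"
  have sai: "?s absolutely_integrable_on {0..}"
    by (intro integral_sawtooth_sums(3) ai) auto
  have sio: "?s integrable_on {a..b}" if "a \<ge> 0" for a b
    by (rule set_lebesgue_integral_eq_integral(1)[OF set_integrable_subset[OF sai]]) (use that in auto)
  have fio: "f integrable_on {a..b}" if "a \<ge> 0" for a b
    by (intro integrable_continuous_interval continuous_on_subset[OF cont]) (use that in auto)
  have "integral {0..real K} ?s = integral {0..real K} f - (\<Sum>k<K. (f (real k) + f (real (Suc k))) / 2)" for K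
  proof (induction K)
    case (Suc K)
    have split: "integral {0..real (Suc K)} h = integral {0..real K} h + integral {real K..real K + 1} h"
      if "h integrable_on {0..real (Suc K)}" for h :: "real \<Rightarrow> real"
      using that by (subst Henstock_Kurzweil_Integration.integral_combine) (auto simp: add.commute)
    have "integral {real K..real K + 1} ?s = integral {real K..real K + 1} f - (f (real K) + f (real K + 1)) / 2"
      by (rule integral_sawtooth_unit)
         (use deriv in \<open>auto intro!: continuous_on_subset[OF cont] set_integrable_subset[OF ai]\<close>)
    hence "integral {real K..real K + 1} ?s = integral {real K..real K + 1} f - (f (real K) + f (real (Suc K))) / 2"
      by (simp add: add.commute)
    moreover have "integral {0..real (Suc K)} ?s = integral {0..real K} ?s + integral {real K..real K + 1} ?s"
      by (rule split[OF sio]) simp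
    moreover have "integral {0..real (Suc K)} f = integral {0..real K} f + integral {real K..real K + 1} f"
      by (rule split[OF fio]) simp
    ultimately show ?case using Suc by (simp only: sum.lessThan_Suc)
  qed simp
  moreover have "(\<lambda>K. integral {0..real K} ?s) \<longlonglongrightarrow> integral {0..} ?s"
    by (rule filterlim_compose[OF integral_halfline_tendsto[OF sai] filterlim_real_sequentially])
  ultimately show ?thesis by simp
qed

text \<open>With \<open>y = 4 (cosh u - 1)\<close> one has \<open>wroot y = 4 sinh u\<close> and \<open>vroot y = exp (-u)\<close>;
  \<open>rker n\<close> is \<open>gker n\<close> without its singular part \<open>sqrt 2 / sqrt y\<close>.\<close>

definition wroot :: "real \<Rightarrow> real" where "wroot y = sqrt (y * (y + 8))"

definition vroot :: "real \<Rightarrow> real" where "vroot y = 4 / (y + 4 + wroot y)"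

definition gker :: "nat \<Rightarrow> real \<Rightarrow> real" where "gker n y = 4 * vroot y ^ (2 * n) / wroot y"

definition rker :: "nat \<Rightarrow> real \<Rightarrow> real" where
  "rker n y = - 2 * (\<Sum>j<n. vroot y ^ (2 * j + 1))
     - sqrt 2 * sqrt (y / (y + 8)) * (1 / (sqrt (y + 8) + sqrt 8))"

section \<open>Algebra, derivatives and bounded variation of the kernel\<close>

lemma wroot_pos: "y > 0 \<Longrightarrow> wroot y > 0"
  by (simp add: wroot_def)

lemma wroot_nonneg: "y \<ge> 0 \<Longrightarrow> wroot y \<ge> 0"
  by (simp add: wroot_def)

lemma wroot_sq: "y \<ge> 0 \<Longrightarrow> wroot y * wroot y = y * (y + 8)"
  by (simp add: wroot_def)

lemma vroot_pos: "y \<ge> 0 \<Longrightarrow> vroot y > 0"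
  using wroot_nonneg[of y] by (simp add: vroot_def)

lemma vroot_le_1: "y \<ge> 0 \<Longrightarrow> vroot y \<le> 1"
  using wroot_nonneg[of y] by (simp add: vroot_def divide_simps)

lemma vroot_altdef:
  assumes "y \<ge> 0"
  shows "vroot y = (y + 4 - wroot y) / 4"
proof -
  have "(y + 4 - wroot y) * (y + 4 + wroot y) = 16"
    using wroot_sq[OF assms] by (simp add: algebra_simps)
  thus ?thesis using wroot_nonneg[OF assms] assms
    unfolding vroot_def by (simp add: divide_simps)
qed

lemma wroot_deriv: "y > 0 \<Longrightarrow> (wroot has_real_derivative (y + 4) / wroot y) (at y)"
proof -
  assume y: "y > 0"
  hence p: "y * (y + 8) > 0" by simp
  have "((\<lambda>y. sqrt (y * (y + 8))) has_real_derivative (inverse (sqrt (y * (y + 8))) / 2) * (2 * y + 8)) (at y)"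
    by (rule DERIV_chain2[where f = sqrt and g = "\<lambda>y. y * (y + 8)"], rule DERIV_real_sqrt[OF p]) (auto intro!: derivative_eq_intros)
  also have "(inverse (sqrt (y * (y + 8))) / 2) * (2 * y + 8) = (y + 4) / wroot y"
  proof -
    have "(inverse w / 2) * (2 * y + 8) = (y + 4) / w" for w :: real
      by (cases "w = 0") (simp_all add: field_simps)
    thus ?thesis by (simp only: wroot_def)
  qed
  finally show "(wroot has_real_derivative (y + 4) / wroot y) (at y)"
    by (simp add: wroot_def[abs_def])
qed

lemma vroot_deriv:
  assumes "y > 0"
  shows "(vroot has_real_derivative - (vroot y / wroot y)) (at y)"
proof -
  have p: "y + 4 + wroot y > 0" using wroot_pos[OF assms] assms by simp
  have "(vroot has_real_derivative - (4 * (1 + (y + 4) / wroot y)) / (y + 4 + wroot y)\<^sup>2) (at y)"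
    unfolding vroot_def[abs_def]
    using p by (auto intro!: derivative_eq_intros wroot_deriv assms simp: power2_eq_square)
  moreover have "1 + (y + 4) / wroot y = (y + 4 + wroot y) / wroot y"
    using wroot_pos[OF assms] by (simp add: field_simps)
  moreover have "- (4 * (D / w)) / D\<^sup>2 = - (4 / D / w)" if "D \<noteq> 0" for D w :: real
    using that by (simp add: power2_eq_square)
  from this[of "y + 4 + wroot y" "wroot y"]
  have "- (4 * ((y + 4 + wroot y) / wroot y)) / (y + 4 + wroot y)\<^sup>2 = - (vroot y / wroot y)"
    using p by (simp only: vroot_def)
  ultimately show ?thesis by simp
qed

lemma vroot_continuous: "continuous_on {0..} vroot"
proof -
  have "y + 4 + sqrt (y * (y + 8)) \<noteq> 0" if "y \<ge> 0" for y :: real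
    using that real_sqrt_ge_zero[of "y * (y + 8)"] by (smt (verit) mult_nonneg_nonneg)
  thus ?thesis unfolding vroot_def[abs_def] wroot_def
    by (intro continuous_intros) auto
qed

lemma bv_vroot: "bv_halfline vroot (\<lambda>y. - (vroot y / wroot y))"
proof -
  have "bv_halfline (\<lambda>y. - vroot y) (\<lambda>y. vroot y / wroot y)"
  proof (rule bv_halfline_monotone[where B = 1])
    show "((\<lambda>y. - vroot y) \<longlongrightarrow> 0) at_top"
      unfolding vroot_def wroot_def by real_asymp
    show "((\<lambda>y. - vroot y) has_real_derivative vroot y / wroot y) (at y)" if "y > 0" for y
      using DERIV_minus[OF vroot_deriv[OF that]] by simp
  qed (use vroot_pos vroot_le_1 wroot_pos in \<open>auto intro!: continuous_intros vroot_continuous divide_nonneg_nonneg less_imp_le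
         simp: abs_if less_eq_real_def\<close>)
  from bv_halfline_mult[OF bv_halfline_const[of "-1"] this] show ?thesis by simp
qed

lemma bv_power: "bv_halfline f f' \<Longrightarrow> \<exists>g'. bv_halfline (\<lambda>y. f y ^ k) g'"
  by (induction k) (auto intro: bv_halfline_const bv_halfline_mult)

lemma bv_sum:
  fixes n :: nat
  shows "(\<And>j. j < n \<Longrightarrow> \<exists>g'. bv_halfline (f j) g') \<Longrightarrow> \<exists>g'. bv_halfline (\<lambda>y. \<Sum>j<n. f j y) g'"
proof (induction n)
  case (Suc n)
  then obtain g' h' where "bv_halfline (\<lambda>y. \<Sum>j<n. f j y) g'" "bv_halfline (f n) h'"
    by (metis less_SucI lessI)
  from bv_halfline_add[OF this] show ?case by auto
qed (auto intro: bv_halfline_const)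

lemma bv_rker: "\<exists>r'. bv_halfline (rker n) r'"
proof -
  have b: "bv_halfline (\<lambda>y. sqrt (y / (y + 8))) (\<lambda>y. 8 / (y + 8)\<^sup>2 / (2 * sqrt (y / (y + 8))))"
  proof (rule bv_halfline_monotone[where B = 1])
    show "continuous_on {0..} (\<lambda>y::real. sqrt (y / (y + 8)))" by (intro continuous_intros) auto
    show "((\<lambda>y::real. sqrt (y / (y + 8))) \<longlongrightarrow> 1) at_top" by real_asymp
    show "((\<lambda>y::real. sqrt (y / (y + 8))) has_real_derivative 8 / (y + 8)\<^sup>2 / (2 * sqrt (y / (y + 8)))) (at y)" if "y > 0" for y
      using that by (auto intro!: derivative_eq_intros simp: power2_eq_square divide_simps)
  qed auto
  have c: "bv_halfline (\<lambda>y. - (1 / (sqrt (y + 8) + sqrt 8))) (\<lambda>y. 1 / (2 * sqrt (y + 8)) / (sqrt (y + 8) + sqrt 8)\<^sup>2)"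
  proof (rule bv_halfline_monotone[where B = 1])
    have p: "sqrt (y + 8) + sqrt 8 \<ge> 1" if "y \<ge> 0" for y :: real
      using that real_sqrt_ge_1_iff[of 8] real_sqrt_ge_zero[of "y + 8"] by linarith
    hence nz: "sqrt (y + 8) + sqrt 8 \<noteq> 0" if "y \<ge> 0" for y :: real
      using that by (metis not_one_le_zero)
    show "continuous_on {0..} (\<lambda>y::real. - (1 / (sqrt (y + 8) + sqrt 8)))"
      using nz by (intro continuous_intros) auto
    show "((\<lambda>y::real. - (1 / (sqrt (y + 8) + sqrt 8))) \<longlongrightarrow> 0) at_top" by real_asymp
    show "((\<lambda>y::real. - (1 / (sqrt (y + 8) + sqrt 8))) has_real_derivative 1 / (2 * sqrt (y + 8)) / (sqrt (y + 8) + sqrt 8)\<^sup>2) (at y)"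
      if "y > 0" for y
      using that nz[of y] by (auto intro!: derivative_eq_intros simp: power2_eq_square divide_simps)
    show "\<bar>- (1 / (sqrt (y + 8) + sqrt 8))\<bar> \<le> 1" if "y \<ge> 0" for y :: real
      using p[OF that] by (simp add: divide_simps)
  qed auto
  obtain s' where s: "bv_halfline (\<lambda>y. \<Sum>j<n. vroot y ^ (2 * j + 1)) s'"
    using bv_sum[of n "\<lambda>j y. vroot y ^ (2 * j + 1)"] bv_power[OF bv_vroot] by blast
  have "rker n = (\<lambda>y. (- 2) * (\<Sum>j<n. vroot y ^ (2 * j + 1)) + sqrt 2 * (sqrt (y / (y + 8)) * - (1 / (sqrt (y + 8) + sqrt 8))))"
    by (rule ext) (simp add: rker_def)
  with bv_halfline_add[OF bv_halfline_mult[OF bv_halfline_const[of "- 2"] s]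
        bv_halfline_mult[OF bv_halfline_const[of "sqrt 2"] bv_halfline_mult[OF b c]]]
  show ?thesis by (simp only:) (rule exI)
qed

text \<open>In hyperbolic terms 4 sinh u exp(-u) = 2 (1 - exp(-2u)), that is w v = 2 (1 - v^2). A
  geometric sum then gives 4 (1 - v^(2n)) / w = 2 times the sum of the odd powers of v, which leaves
  4/w; rationalizing its difference from sqrt 2 / sqrt y gives the last term of
  \<open>rker\<close>.\<close>

lemma gker_eq:
  assumes y: "y > 0"
  shows "gker n y = rker n y + sqrt 2 / sqrt y"
proof -
  have w: "wroot y > 0" and v: "vroot y > 0" using wroot_pos vroot_pos y by auto
  have wv: "wroot y * vroot y = 2 * (1 - vroot y * vroot y)"
  proof -
    have "4 / D * D = 4" if "D \<noteq> 0" for D :: real using that by simp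
    from this[of "y + 4 + wroot y"] have "vroot y * (y + 4 + wroot y) = 4"
      using w y by (simp only: vroot_def)
    moreover have "y + 4 = wroot y + 4 * vroot y" using vroot_altdef[of y] y by simp
    ultimately have "vroot y * (wroot y + 4 * vroot y + wroot y) = 4" by simp
    thus ?thesis by (simp add: algebra_simps)
  qed
  have "(1 - vroot y * vroot y) * (\<Sum>j<n. vroot y ^ (2 * j + 1)) = vroot y * (1 - vroot y ^ (2 * n))"
  proof (induction n)
    case (Suc n)
    have "(1 - vroot y * vroot y) * ((\<Sum>j<n. vroot y ^ (2 * j + 1)) + vroot y ^ (2 * n + 1))
        = vroot y * (1 - vroot y ^ (2 * n)) + (1 - vroot y * vroot y) * vroot y ^ (2 * n + 1)"
      by (simp only: distrib_left Suc)
    also have "\<dots> = vroot y * (1 - vroot y ^ (2 * Suc n))"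
      by (simp add: algebra_simps)
    finally show ?case by (simp only: sum.lessThan_Suc)
  qed simp
  hence "wroot y * vroot y * (\<Sum>j<n. vroot y ^ (2 * j + 1)) = 2 * vroot y * (1 - vroot y ^ (2 * n))"
    unfolding wv by (simp only: mult.assoc)
  hence "wroot y * (\<Sum>j<n. vroot y ^ (2 * j + 1)) = 2 * (1 - vroot y ^ (2 * n))"
    using v by simp
  hence 1: "gker n y = 4 / wroot y - 2 * (\<Sum>j<n. vroot y ^ (2 * j + 1))"
    using w by (simp add: gker_def field_simps)
  define s where "s = sqrt y"
  define t where "t = sqrt (y + 8)"
  define u where "u = sqrt (8 :: real)"
  have st: "s > 0" "t > 0" "u > 0" "t * t - u * u = s * s" using y by (auto simp: s_def t_def u_def)
  have u2: "sqrt 2 * u = 4" unfolding u_def by (simp flip: real_sqrt_mult)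
  have "4 / wroot y = 4 / (s * t)" by (simp add: wroot_def s_def t_def real_sqrt_mult)
  also have "\<dots> = sqrt 2 / s - sqrt 2 * (s / t) * (1 / (t + u))"
  proof -
    have "t + u \<noteq> 0" using st by simp
    hence "sqrt 2 / s - sqrt 2 * (s / t) * (1 / (t + u)) = (sqrt 2 * t * (t + u) - sqrt 2 * (s * s)) / (s * t * (t + u))"
      using st by (simp add: divide_simps)
    also have "sqrt 2 * t * (t + u) - sqrt 2 * (s * s) = (sqrt 2 * u) * (t + u)"
      unfolding st(4)[symmetric] by (simp add: algebra_simps)
    also have "(sqrt 2 * u) * (t + u) / (s * t * (t + u)) = 4 / (s * t)"
      unfolding u2 using \<open>t + u \<noteq> 0\<close> by (rule nonzero_mult_divide_mult_cancel_right)
    finally show ?thesis by (rule sym)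
  qed
  also have "sqrt 2 * (s / t) = sqrt 2 * sqrt (y / (y + 8))" by (simp add: s_def t_def real_sqrt_divide)
  finally show ?thesis unfolding 1 rker_def s_def t_def u_def by simp
qed

lemma rker_0: "rker n 0 = - 2 * real n"
  by (simp add: rker_def vroot_def wroot_def)

text \<open>For y = 4 (cosh u - 1) one has dy = \<open>wroot y\<close> du, so the kernel becomes 4
  exp(-2nu) du.\<close>

lemma gker_substitution:
  assumes "(\<lambda>u. c (4 * (cosh u - 1)) * exp (- 2 * real n * u)) absolutely_integrable_on {0..}"
  shows "(\<lambda>y. gker n y * c y) absolutely_integrable_on {0..}"
    and "integral {0..} (\<lambda>y. gker n y * c y) = 4 * integral {0..} (\<lambda>u. c (4 * (cosh u - 1)) * exp (- 2 * real n * u))"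
proof -
  let ?g = "\<lambda>u::real. 4 * (cosh u - 1)"
  have img: "?g ` {0<..} = {0<..}"
  proof (intro equalityI subsetI)
    fix y assume "y \<in> ?g ` {0<..}"
    thus "y \<in> {0<..}" using cosh_real_nonneg_less_iff[of 0] by auto
  next
    fix y :: real assume y: "y \<in> {0<..}"
    hence "y = ?g (arcosh (1 + y / 4))" "arcosh (1 + y / 4) > 0" by auto
    thus "y \<in> ?g ` {0<..}" by blast
  qed
  have inj: "inj_on ?g {0<..}"
    by (intro inj_onI) (use arcosh_cosh_real in \<open>force dest: arg_cong[of _ _ arcosh]\<close>)
  have w: "wroot (?g u) = 4 * sinh u" if "u > 0" for u
  proof -
    have "?g u * (?g u + 8) = (4 * sinh u)\<^sup>2"
      using cosh_square_eq[of u] by (simp add: power2_eq_square algebra_simps)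
    thus ?thesis using that by (simp only: wroot_def real_sqrt_abs) simp
  qed
  have v: "vroot (?g u) = exp (- u)" if "u > 0" for u
  proof -
    have "?g u + 4 + 4 * sinh u = 4 * exp u"
      unfolding cosh_plus_sinh[of u, symmetric] by simp
    thus ?thesis unfolding vroot_def w[OF that] by (simp add: exp_minus inverse_eq_divide)
  qed
  have e: "\<bar>4 * sinh u\<bar> * (gker n (?g u) * c (?g u)) = 4 * (c (?g u) * exp (- 2 * real n * u))" if "u > 0" for u
  proof -
    have "sinh u > 0" using that by simp
    moreover have "exp (- u) ^ (2 * n) = exp (- 2 * real n * u)"
      by (simp flip: exp_of_nat_mult)
    ultimately show ?thesis unfolding gker_def w[OF that] v[OF that] by simp
  qed
  let ?h = "\<lambda>u. 4 * (c (?g u) * exp (- 2 * real n * u))"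
  have h: "?h absolutely_integrable_on {0<..}"
    unfolding absolutely_integrable_halfline_open(1) by (intro set_integrable_mult_right assms)
  have "(\<lambda>u. \<bar>4 * sinh u\<bar> * (gker n (?g u) * c (?g u))) absolutely_integrable_on {0<..}"
    by (rule absolutely_integrable_spike[OF h, of "{}"]) (use e in auto)
  moreover have "integral {0<..} (\<lambda>u. \<bar>4 * sinh u\<bar> * (gker n (?g u) * c (?g u))) = integral {0<..} ?h"
    by (rule integral_cong) (use e in auto)
  ultimately have "(\<lambda>y. gker n y * c y) absolutely_integrable_on ?g ` {0<..} \<and>
      integral (?g ` {0<..}) (\<lambda>y. gker n y * c y) = integral {0<..} ?h"
    by (subst has_absolute_integral_change_of_variables_1'[where S = "{0<..}" and g = ?g and g' = "\<lambda>u. 4 * sinh u", symmetric])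
       (use inj in \<open>auto intro!: derivative_eq_intros\<close>)
  thus "(\<lambda>y. gker n y * c y) absolutely_integrable_on {0..}"
    "integral {0..} (\<lambda>y. gker n y * c y) = 4 * integral {0..} (\<lambda>u. c (4 * (cosh u - 1)) * exp (- 2 * real n * u))"
    unfolding img absolutely_integrable_halfline_open by simp_all
qed

section \<open>Cosine transform and summation of the kernel\<close>

lemma gker_bound:
  assumes y: "y > 0"
  shows "\<bar>gker n y\<bar> \<le> 4 / wroot y"
  using vroot_pos[of y] vroot_le_1[of y] wroot_pos[OF y] y
  by (simp add: gker_def abs_mult divide_simps power_le_one)

text \<open>Integration by parts against sin(ay)/a. The regular part contributes r', and the
  singular part sqrt 2 / sqrt y contributes the integral of sin(ay) y^(-3/2), which converges
  absolutely and equals sqrt(2 pi a).\<close>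

lemma integral_gker_cos:
  assumes n: "n \<ge> 1" and a: "a > 0" and r: "bv_halfline (rker n) r'"
    and ai: "(\<lambda>u. cos (a * (4 * (cosh u - 1))) * exp (- 2 * real n * u)) absolutely_integrable_on {0..}"
  shows "integral {0..} (\<lambda>y. gker n y * cos (a * y)) =
           sqrt (pi / a) - integral {0..} (\<lambda>y. r' y * sin (a * y)) / a"
proof -
  let ?c = "\<lambda>y. gker n y * cos (a * y)"
  let ?s = "\<lambda>y. r' y * sin (a * y)"
  let ?p = "\<lambda>y::real. sin (a * y) * y powr (-3/2)"
  have r': "r' absolutely_integrable_on {0..}" and cont: "continuous_on {0..} (rker n)"
    and deriv: "\<And>y. y > 0 \<Longrightarrow> (rker n has_real_derivative r' y) (at y)"
    using r by (auto simp: bv_halfline_def)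
  have c_ai: "?c absolutely_integrable_on {0..}" by (rule gker_substitution(1)[OF ai])
  have s_ai: "?s absolutely_integrable_on {0..}" by (intro integral_sawtooth_sums(2) r') auto
  have p_ai: "?p absolutely_integrable_on {0..}"
    using integral_sin_powr(1)[OF a] by (simp add: absolutely_integrable_halfline_open)
  let ?f = "\<lambda>y. (?s y - sqrt 2 / 2 * ?p y) / a + ?c y"
  \<comment> \<open>At 0 the quotient sin(ay) / sqrt y is 0/0 = 0, which is also its limit from the
    right.\<close>
  let ?F = "\<lambda>y. (rker n y * sin (a * y) + sqrt 2 * (sin (a * y) / sqrt y)) / a"
  have "integral {0..} ?f = 0 - ?F 0"
  proof (rule integral_halfline_FTC_interior)
    show "?f absolutely_integrable_on {0..}"
      by (intro set_integral_add set_integral_diff set_integrable_divide set_integrable_mult_right s_ai p_ai c_ai)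
    show "continuous_on {0..} ?F"
    proof -
      have "continuous_on {0..} (\<lambda>y. sin (a * y) / sqrt y)"
      proof (rule continuous_on_eq_continuous_within[THEN iffD2], intro ballI)
        fix x :: real assume "x \<in> {0..}"
        show "continuous (at x within {0..}) (\<lambda>y. sin (a * y) / sqrt y)"
        proof (cases "x = 0")
          case True
          have "((\<lambda>y. sin (a * y) / sqrt y) \<longlongrightarrow> 0) (at_right 0)" by real_asymp
          moreover have "at 0 within {0::real..} = at_right 0" by (rule at_within_Ici_at_right)
          ultimately show ?thesis using True by (simp add: continuous_within)
        next
          case False
          thus ?thesis using \<open>x \<in> {0..}\<close> by (intro continuous_intros) auto
        qed
      qed
      thus ?thesis using a
        by (intro continuous_on_divide[OF continuous_on_add[OF continuous_on_mult[OF cont]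
              continuous_on_mult[OF continuous_on_const]] continuous_on_const]) (auto intro!: continuous_intros)
    qed
    show "(?F has_real_derivative ?f y) (at y)" if y: "y > 0" for y
    proof -
      have "((\<lambda>y. y powr (-1/2)) has_real_derivative - (1/2) * y powr (-3/2)) (at y)"
        using y by (auto intro!: derivative_eq_intros simp: powr_diff field_simps)
      moreover have "\<forall>\<^sub>F z in nhds y. z powr (-1/2) = 1 / sqrt z"
        using eventually_nhds_in_open[of "{0<..}" y] y
        by (auto elim!: eventually_mono simp: powr_minus_divide powr_half_sqrt)
      ultimately have sq: "((\<lambda>y. 1 / sqrt y) has_real_derivative - (1/2) * y powr (-3/2)) (at y)"
        by (subst (asm) DERIV_cong_ev[OF refl _ refl])
      have "((\<lambda>y. (rker n y * sin (a * y) + sqrt 2 * (sin (a * y) * (1 / sqrt y))) / a) has_real_derivative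
         (r' y * sin (a * y) + cos (a * y) * a * rker n y
           + sqrt 2 * (cos (a * y) * a * (1 / sqrt y) + - (1/2) * y powr (-3/2) * sin (a * y))) / a) (at y)"
        by (intro DERIV_cdivide DERIV_add DERIV_cmult DERIV_mult deriv y sq) (auto intro!: derivative_eq_intros)
      also have "(r' y * sin (a * y) + cos (a * y) * a * rker n y
           + sqrt 2 * (cos (a * y) * a * (1 / sqrt y) + - (1/2) * y powr (-3/2) * sin (a * y))) / a = ?f y"
        unfolding gker_eq[OF y] using a y by (simp add: field_simps)
      finally show ?thesis by simp
    qed
    show "(?F \<longlongrightarrow> 0) at_top"
    proof (rule Lim_null_comparison)
      show "((\<lambda>y. 4 / wroot y / a) \<longlongrightarrow> 0) at_top"
        unfolding wroot_def using a by real_asymp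
      have "norm (?F y) \<le> 4 / wroot y / a" if y: "y > 0" for y
      proof -
        have "?F y = gker n y * sin (a * y) / a"
          unfolding gker_eq[OF y] by (simp add: ring_distribs)
        moreover have "\<bar>gker n y\<bar> * \<bar>sin (a * y)\<bar> \<le> 4 / wroot y * 1"
          using gker_bound[OF y] wroot_pos[OF y] by (intro mult_mono) auto
        hence "\<bar>gker n y\<bar> * \<bar>sin (a * y)\<bar> / a \<le> 4 / wroot y * 1 / a"
          using a by (intro divide_right_mono) auto
        ultimately show ?thesis using a by (simp add: abs_mult)
      qed
      thus "\<forall>\<^sub>F y in at_top. norm (?F y) \<le> 4 / wroot y / a"
        by (rule eventually_mono[OF eventually_gt_at_top[of 0]])
    qed
  qed
  moreover have "(?f has_integral (integral {0..} ?s - sqrt 2 / 2 * sqrt (2 * pi * a)) / a + integral {0..} ?c) {0..}"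
  proof (intro has_integral_add has_integral_divide has_integral_diff has_integral_mult_right)
    show "(?p has_integral sqrt (2 * pi * a)) {0..}"
      using p_ai integral_sin_powr(2)[OF a] set_lebesgue_integral_eq_integral(1)[OF p_ai]
      by (simp add: absolutely_integrable_halfline_open has_integral_iff)
  qed (use s_ai c_ai in \<open>auto intro!: integrable_integral set_lebesgue_integral_eq_integral(1)\<close>)
  ultimately have "(integral {0..} ?s - sqrt 2 / 2 * sqrt (2 * pi * a)) / a + integral {0..} ?c = 0"
    by (simp add: integral_unique)
  moreover have "sqrt 2 / 2 * sqrt (2 * pi * a) / a = sqrt (pi / a)"
  proof -
    have "sqrt 2 * sqrt (2 * pi * a) = 2 * sqrt (pi * a)"
      by (simp add: real_sqrt_mult)
    moreover have "sqrt (pi * a) / a = sqrt (pi / a)"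
      using a real_sqrt_mult_self[of a] by (simp add: real_sqrt_mult real_sqrt_divide divide_simps)
    ultimately show ?thesis by simp
  qed
  ultimately show ?thesis by (simp add: diff_divide_distrib)
qed

text \<open>Euler-Maclaurin for \<open>rker\<close> plus the asymptotics of the sum of 1 / sqrt k;
  the divergent 2 sqrt 2 sqrt K is absorbed into the integral of \<open>gker\<close>. The term 2/n
  is the full integral of \<open>gker\<close>, and n is the trapezoidal end correction
  -\<open>rker n 0\<close> / 2.\<close>

lemma gker_summation:
  assumes n: "n \<ge> 1" and r: "bv_halfline (rker n) r'"
  shows "(\<lambda>k. gker n (real (Suc k))) sums
    (2 / real n + sqrt 2 * zeta_real (1/2) + real n - integral {0..} (\<lambda>y. r' y * sawtooth y))"
proof -
  let ?E = "\<lambda>u. exp (- 2 * real n * u)"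
  have E1: "?E absolutely_integrable_on {0..}"
  proof (rule absolutely_integrable_exp_decay[where K = 1])
    show "norm (?E t) \<le> 1 * exp (- t)" if "t \<ge> 0" for t
      using n that mult_right_mono[of 1 "2 * real n" t] by simp
  qed (intro continuous_intros)
  have "integral {0..} ?E = 0 - (- 1 / (2 * real n)) * exp (- 2 * real n * 0)"
  proof (rule integral_halfline_FTC_interior[OF E1])
    show "((\<lambda>u. (- 1 / (2 * real n)) * exp (- 2 * real n * u)) \<longlongrightarrow> 0) at_top"
      using n by real_asymp
  qed (use n in \<open>auto intro!: continuous_intros derivative_eq_intros\<close>)
  with E1 have E: "?E absolutely_integrable_on {0..}" "integral {0..} ?E = 1 / (2 * real n)"
    by simp_all
  have G: "gker n absolutely_integrable_on {0..}" "integral {0..} (gker n) = 2 / real n"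
    using gker_substitution[of "\<lambda>_. 1" n] E by simp_all
  have cont: "continuous_on {0..} (rker n)" using r by (auto simp: bv_halfline_def)
  have I: "integral {0..real K} (gker n) = integral {0..real K} (rker n) + 2 * sqrt 2 * sqrt (real K)" for K
  proof -
    have "((\<lambda>y. sqrt 2 / sqrt y) has_integral 2 * sqrt 2 * sqrt (real K) - 2 * sqrt 2 * sqrt 0) {0..real K}"
      by (rule fundamental_theorem_of_calculus_interior)
         (auto intro!: continuous_intros derivative_eq_intros
           simp: field_simps simp flip: has_real_derivative_iff_has_vector_derivative)
    moreover have "rker n integrable_on {0..real K}"
      by (intro integrable_continuous_interval continuous_on_subset[OF cont]) auto
    ultimately have "((\<lambda>y. rker n y + sqrt 2 / sqrt y) has_integral
        integral {0..real K} (rker n) + (2 * sqrt 2 * sqrt (real K) - 2 * sqrt 2 * sqrt 0)) {0..real K}"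
      by (intro has_integral_add integrable_integral)
    hence "(gker n has_integral
        integral {0..real K} (rker n) + (2 * sqrt 2 * sqrt (real K) - 2 * sqrt 2 * sqrt 0)) {0..real K}"
      by (rule has_integral_spike_finite[where S = "{0}", rotated 2]) (auto simp: gker_eq)
    thus ?thesis by (simp add: integral_unique)
  qed
  have S: "(\<Sum>k<K. (rker n (real k) + rker n (real (Suc k))) / 2) =
      (\<Sum>k<K. rker n (real (Suc k))) + (rker n 0 - rker n (real K)) / 2" for K
    by (induction K) (auto simp: field_simps)
  have S2: "(\<Sum>k<K. rker n (real (Suc k))) = (\<Sum>k<K. gker n (real (Suc k))) - sqrt 2 * (\<Sum>k<K. 1 / sqrt (real (Suc k)))" for K
    unfolding sum_distrib_left sum_subtractf[symmetric] by (intro sum.cong refl) (simp add: gker_eq)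
  let ?H = "\<lambda>K. (\<Sum>k<K. 1 / sqrt (real (Suc k))) - 2 * sqrt (real K)"
  let ?D = "\<lambda>K. integral {0..real K} (rker n) - (\<Sum>k<K. (rker n (real k) + rker n (real (Suc k))) / 2)"
  have eq: "(\<Sum>k<K. gker n (real (Suc k))) = integral {0..real K} (gker n) + sqrt 2 * ?H K + real n
      + rker n (real K) / 2 - ?D K" for K
    unfolding I S S2 rker_0 by (simp add: field_simps)
  have "(rker n \<longlongrightarrow> 0) at_top"
  proof (rule Lim_null_comparison)
    show "((\<lambda>y. 4 / wroot y + sqrt 2 / sqrt y) \<longlongrightarrow> 0) at_top"
      unfolding wroot_def by real_asymp
    have "norm (rker n y) \<le> 4 / wroot y + sqrt 2 / sqrt y" if y: "y > 0" for y
    proof -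
      have "sqrt 2 / sqrt y \<ge> 0" using y by simp
      thus ?thesis using gker_bound[OF y, of n] gker_eq[OF y, of n] unfolding real_norm_def by linarith
    qed
    thus "\<forall>\<^sub>F y in at_top. norm (rker n y) \<le> 4 / wroot y + sqrt 2 / sqrt y"
      by (rule eventually_mono[OF eventually_gt_at_top[of 0]])
  qed
  from filterlim_compose[OF this filterlim_real_sequentially]
  have "(\<lambda>K. rker n (real K)) \<longlonglongrightarrow> 0" .
  hence "(\<lambda>K. integral {0..real K} (gker n) + sqrt 2 * ?H K + real n + rker n (real K) / 2 - ?D K) \<longlonglongrightarrow>
     2 / real n + sqrt 2 * zeta_real (1/2) + real n + 0 / 2 - integral {0..} (\<lambda>y. r' y * sawtooth y)"
    using filterlim_compose[OF integral_halfline_tendsto[OF G(1)] filterlim_real_sequentially]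
    unfolding G(2) by (intro tendsto_intros zeta_half_tendsto integral_sawtooth_halfline r) simp_all
  thus ?thesis unfolding sums_def eq by simp
qed

section \<open>The Bessel series\<close>

text \<open>On the positive imaginary axis the exponential is exp(-xs) and beats the polynomial
  factor; this supplies the hypothesis \<open>F0\<close> of \<open>bessel_Y_even\<close>.\<close>

lemma osc_exp_decay:
  assumes x: "x > 0"
  shows "((\<lambda>s. exp (\<i> * of_real x * (\<i> * of_real s)) * osc a r (4 * (\<i> * of_real s - 1))) \<longlongrightarrow> 0) at_top"
proof (induction r)
  case (Suc r)
  let ?e = "\<lambda>s::real. exp (\<i> * of_real x * (\<i> * of_real s))"
  let ?y = "\<lambda>s::real. 4 * (\<i> * of_real s - 1) :: complex"
  have "((\<lambda>s. ?e s * ?y s ^ r) \<longlongrightarrow> 0) at_top"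
  proof (rule Lim_null_comparison)
    have "((\<lambda>s. (x * (s + 1)) ^ r / exp (x * (s + 1))) \<longlongrightarrow> 0) at_top"
      by (rule filterlim_compose[OF tendsto_power_div_exp_0]) (use x in real_asymp)
    thus "((\<lambda>s. 4 ^ r * exp x / x ^ r * ((x * (s + 1)) ^ r / exp (x * (s + 1)))) \<longlongrightarrow> 0) at_top"
      by (rule tendsto_mult_right_zero)
    have "norm (?e s * ?y s ^ r) \<le> 4 ^ r * exp x / x ^ r * ((x * (s + 1)) ^ r / exp (x * (s + 1)))"
      if "s \<ge> 0" for s
    proof -
      have "norm (\<i> * of_real s - 1) \<le> s + 1"
        using norm_triangle_ineq4[of "\<i> * of_real s" 1] that by (simp add: norm_mult)
      hence "norm (?y s) \<le> 4 * (s + 1)"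
        by (simp only: norm_mult norm_numeral) simp
      hence "norm (?y s) ^ r \<le> (4 * (s + 1)) ^ r"
        by (intro power_mono) auto
      hence "exp (- (x * s)) * norm (?y s) ^ r \<le> exp (- (x * s)) * (4 * (s + 1)) ^ r"
        by (intro mult_left_mono) auto
      also have "\<dots> = 4 ^ r * exp x / x ^ r * ((x * (s + 1)) ^ r / exp (x * (s + 1)))"
      proof -
        have "exp (- b) * (4 ^ r * w) = 4 ^ r * exp x / x ^ r * (x ^ r * w / (exp b * exp x))" for b w
          using x by (simp add: exp_minus field_simps)
        moreover have "exp (x * (s + 1)) = exp (x * s) * exp x"
          by (simp add: distrib_left exp_add)
        ultimately show ?thesis by (simp only: power_mult_distrib)
      qed
      also have "exp (- (x * s)) * norm (?y s) ^ r = norm (?e s * ?y s ^ r)"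
        by (simp add: norm_mult norm_power)
      finally show ?thesis .
    qed
    thus "\<forall>\<^sub>F s in at_top. norm (?e s * ?y s ^ r) \<le> 4 ^ r * exp x / x ^ r * ((x * (s + 1)) ^ r / exp (x * (s + 1)))"
      by (rule eventually_mono[OF eventually_ge_at_top[of 0]])
  qed
  from tendsto_mult_left[OF tendsto_diff[OF this Suc], of "of_nat (Suc r) / (\<i> * of_real a)"]
  have "((\<lambda>s. of_nat (Suc r) / (\<i> * of_real a) * (?e s * ?y s ^ r - ?e s * osc a r (?y s))) \<longlongrightarrow> 0) at_top"
    by simp
  moreover have "(\<lambda>s. ?e s * osc a (Suc r) (?y s)) =
      (\<lambda>s. of_nat (Suc r) / (\<i> * of_real a) * (?e s * ?y s ^ r - ?e s * osc a r (?y s)))"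
    by (rule ext) (simp only: osc.simps right_diff_distrib mult.left_commute)
  ultimately show ?case by (simp only:)
qed simp

text \<open>The first term on the right is the osc form of the Fourier term of q, coming from the
  primitive F at 1. The remaining cosine integral splits by \<open>integral_gker_cos\<close>: half
  of sqrt(pi/a) = 1 / sqrt(2 (m + 1)) is the term added on the left, the rest is a sine coefficient
  of r'.\<close>

lemma bessel_Y_kernel:
  fixes n m :: nat
  assumes n: "n \<ge> 1" and r: "bv_halfline (rker n) r'"
  defines "q \<equiv> pcompose (zpoly (2 * n)) [:0, 1/2:]"
  shows "(-1) ^ n * pi * bessel_Y (2 * n) (8 * pi * real (Suc m)) + 1 / (2 * sqrt (2 * real (Suc m))) =
     2 * Re (\<Sum>r\<le>degree q. of_real (coeff q r) * osc (2 * pi * real (Suc m)) r 0)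
     + integral {0..} (\<lambda>y. r' y * sin (2 * pi * real (Suc m) * y)) / (pi * real (Suc m)) / 4"
proof -
  define a where "a = 2 * pi * real (Suc m)"
  define x where "x = 8 * pi * real (Suc m)"
  have a: "a > 0" and x: "x > 0" and xa: "x = 4 * a"
    by (simp_all add: a_def x_def)
  define D where "D = (\<lambda>y. \<Sum>r\<le>degree q. of_real (coeff q r) * osc a r y)"
  define D' where "D' = (\<lambda>y :: complex. \<Sum>r\<le>degree q. of_real (coeff q r) * (of_nat r * y ^ (r - 1)))"
  \<comment> \<open>Since x = 4a, the derivative of the exponential cancels the term -i a D in the
    derivative of D, and 4 D' is left. As D' is q' and q(4 (z - 1)) = T_2n(z) / (2n), this is
    U_(2n-1)(z).\<close>
  define F where "F = (\<lambda>z. exp (\<i> * of_real x * z) * D (4 * (z - 1)))"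
  have D: "(D has_field_derivative (D' y - \<i> * of_real a * D y)) (at y)" for y
  proof -
    have "(D has_field_derivative (\<Sum>r\<le>degree q. of_real (coeff q r) * (of_nat r * y ^ (r - 1) - \<i> * of_real a * osc a r y))) (at y)"
      unfolding D_def by (intro DERIV_sum DERIV_cmult osc_deriv) (use a in simp)
    also have "(\<Sum>r\<le>degree q. of_real (coeff q r) * (of_nat r * y ^ (r - 1) - \<i> * of_real a * osc a r y)) = D' y - \<i> * of_real a * D y"
      by (simp add: D_def D'_def sum_subtractf sum_distrib_left algebra_simps)
    finally show ?thesis .
  qed
  have deg: "degree q \<le> 2 * n"
    using degree_pcompose_le[of "zpoly (2 * n)" "[:0, 1/2:]"] degree_zpoly[of "2 * n"] by (simp add: q_def)
  have D'_U: "4 * D' (4 * (z - 1)) = cheb_U (2 * n - 1) z" for z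
  proof -
    have "D' (4 * (z - 1)) = (\<Sum>r\<le>2 * n. of_real (coeff q r) * (of_nat r * (4 * (z - 1)) ^ (r - 1)))"
      unfolding D'_def by (rule sum.mono_neutral_left) (use deg in \<open>auto simp: coeff_eq_0\<close>)
    also have "\<dots> = (\<Sum>r\<le>2 * n. of_real (coeff (zpoly (2 * n)) r) * (of_nat r * (2 * z - 2) ^ (r - 1))) / 2"
      unfolding sum_divide_distrib
    proof (intro sum.cong refl)
      fix r
      show "of_real (coeff q r) * (of_nat r * (4 * (z - 1)) ^ (r - 1)) =
        of_real (coeff (zpoly (2 * n)) r) * (of_nat r * (2 * z - 2) ^ (r - 1)) / 2"
      proof (cases r)
        case (Suc k)
        have "4 * (z - 1) = 2 * (2 * z - 2)" by simp
        hence p: "(4 * (z - 1)) ^ k = 2 ^ k * (2 * z - 2) ^ k" by (simp only: power_mult_distrib)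
        have "(1/2) ^ k * 2 ^ k = (1 :: complex)" by (simp flip: power_mult_distrib)
        hence h: "of_real ((1/2) ^ Suc k) * 2 ^ k = (1/2 :: complex)" by simp
        have R: "of_real ((1/2) ^ Suc k * A) * (of_nat (Suc k) * (2 ^ k * P))
            = (of_real ((1/2) ^ Suc k) * 2 ^ k) * (of_real A * (of_nat (Suc k) * P))" for A and P :: complex
          by (simp only: of_real_mult mult_ac)
        show ?thesis unfolding q_def coeff_pcompose_linear Suc diff_Suc_1 p R h by simp
      qed simp
    qed
    also have "(\<Sum>r\<le>2 * n. of_real (coeff (zpoly (2 * n)) r) * (of_nat r * (2 * z - 2) ^ (r - 1))) = cheb_U (2 * n - 1) z / 2"
    proof -
      have "2 * n \<ge> 1" using n by simp
      from zpoly_deriv_expand[OF this, of "2 * z - 2"] show ?thesis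
        by (simp only: cheb_U_expand[OF order.refl])
    qed
    finally have e: "D' (4 * (z - 1)) = cheb_U (2 * n - 1) z / 2 / 2" .
    show ?thesis unfolding e by simp
  qed
  have Y: "(-1) ^ n * pi * bessel_Y (2 * n) x = 2 * Re (F 1) - 2 * integral {0..} (\<lambda>u. cos (x * cosh u) * exp (- 2 * real n * u))"
  proof (rule bessel_Y_even[OF x n])
    show "cheb_U (2 * n - 1) (cosh w) * sinh w = sinh (2 * of_nat n * w)" for w :: complex
      using cheb_U_cosh[of "2 * n - 1" w] n by simp
    show "(F has_field_derivative exp (\<i> * of_real x * z) * cheb_U (2 * n - 1) z) (at z)" for z
    proof -
      have "((\<lambda>z. exp (\<i> * of_real x * z)) has_field_derivative exp (\<i> * of_real x * z) * (\<i> * of_real x)) (at z)"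
        by (auto intro!: derivative_eq_intros)
      moreover have "((\<lambda>z. D (4 * (z - 1))) has_field_derivative (D' (4 * (z - 1)) - \<i> * of_real a * D (4 * (z - 1))) * 4) (at z)"
        by (rule DERIV_chain2[OF D]) (auto intro!: derivative_eq_intros)
      ultimately have "(F has_field_derivative exp (\<i> * of_real x * z) * (\<i> * of_real x) * D (4 * (z - 1))
          + (D' (4 * (z - 1)) - \<i> * of_real a * D (4 * (z - 1))) * 4 * exp (\<i> * of_real x * z)) (at z)"
        unfolding F_def by (rule DERIV_mult)
      also have "exp (\<i> * of_real x * z) * (\<i> * of_real x) * D (4 * (z - 1))
          + (D' (4 * (z - 1)) - \<i> * of_real a * D (4 * (z - 1))) * 4 * exp (\<i> * of_real x * z)
          = exp (\<i> * of_real x * z) * (4 * D' (4 * (z - 1)))"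
        by (simp add: xa algebra_simps)
      finally show ?thesis unfolding D'_U .
    qed
    have "((\<lambda>s. \<Sum>r\<le>degree q. of_real (coeff q r) * (exp (\<i> * of_real x * (\<i> * of_real s)) * osc a r (4 * (\<i> * of_real s - 1)))) \<longlongrightarrow> 0) at_top"
      by (intro tendsto_null_sum tendsto_mult_right_zero osc_exp_decay x)
    thus "((\<lambda>s. F (\<i> * of_real s)) \<longlongrightarrow> 0) at_top"
      by (simp only: F_def D_def sum_distrib_left mult.left_commute)
  qed
  have xi: "x = 2 * pi * of_int (int (4 * Suc m))"
    by (simp add: x_def)
  have csx: "cos x = 1" "sin x = 0"
    unfolding xi by (rule cos_int_2pin sin_int_2pin)+
  hence ex: "exp (\<i> * of_real x) = 1"
    by (simp only: cis_conv_exp[symmetric] complex_eq_iff cis.sel one_complex.sel)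
  have F1: "F 1 = D 0" using ex by (simp add: F_def)
  have X: "4 * integral {0..} (\<lambda>u. cos (x * cosh u) * exp (- 2 * real n * u))
      = 1 / sqrt (2 * real (Suc m)) - integral {0..} (\<lambda>y. r' y * sin (a * y)) / a"
  proof -
    have c: "cos (a * (4 * (cosh u - 1))) = cos (x * cosh u)" for u :: real
    proof -
      have "a * (4 * (cosh u - 1)) = x * cosh u - x"
        by (simp add: xa algebra_simps)
      thus ?thesis using csx by (simp only: cos_diff mult_1_right mult_zero_right add_0_right)
    qed
    have ai: "(\<lambda>u. cos (a * (4 * (cosh u - 1))) * exp (- 2 * real n * u)) absolutely_integrable_on {0..}"
      unfolding c by (rule integral_exp_i_cosh(1)[OF x n])
    have "sqrt (pi / a) = 1 / sqrt (2 * real (Suc m))"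
      by (simp add: a_def real_sqrt_divide real_sqrt_mult field_simps del: of_nat_Suc)
    thus ?thesis
      using gker_substitution(2)[OF ai] integral_gker_cos[OF n a r ai] unfolding c by simp
  qed
  have "(-1) ^ n * pi * bessel_Y (2 * n) x = 2 * Re (D 0) - (1 / sqrt (2 * real (Suc m)) - integral {0..} (\<lambda>y. r' y * sin (a * y)) / a) / 2"
    unfolding Y F1 X[symmetric] by simp
  moreover have "integral {0..} (\<lambda>y. r' y * sin (a * y)) / a / 2 = integral {0..} (\<lambda>y. r' y * sin (a * y)) / (pi * real (Suc m)) / 4"
    by (simp add: a_def del: of_nat_Suc)
  ultimately show ?thesis
    unfolding x_def[symmetric] a_def[symmetric] D_def by (simp add: diff_divide_distrib del: of_nat_Suc)
qed

theorem theorem1p5: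
  fixes n :: nat
  assumes "n \<ge> 1"
  shows "zagier_poly (2 * n) (-3/2) + zagier_poly (2 * n) 0 =
    2 * (\<Sum>m. (-1) ^ n * pi * bessel_Y (2 * n) (8 * pi * real (Suc m))
                 + 1 / (2 * sqrt (2 * real (Suc m))))
    - real n
    - (1/2) * (chebyshev_U (2 * n - 1) (1/4) + chebyshev_U (2 * n - 1) (3/4))
    - (1 / sqrt 2) * zeta_real (1/2)
    + (1 / 2 ^ (4 * n - 1)) *
      (\<Sum>m. (real (Suc m) + 4 - sqrt (real (Suc m) * (real (Suc m) + 8))) ^ (2 * n)
              / sqrt (real (Suc m) * (real (Suc m) + 8)))"
proof -
  obtain r' where r: "bv_halfline (rker n) r'" using bv_rker by blast
  hence r': "r' absolutely_integrable_on {0..}" by (simp add: bv_halfline_def)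
  define I where "I = integral {0..} (\<lambda>y. r' y * sawtooth y)"
  define q where "q = pcompose (zpoly (2 * n)) [:0, 1/2:]"
  \<comment> \<open>With N = 2n these are q(0) = T_N(1)/N and q'(0) = U_(N-1)(1)/4 = N/4.\<close>
  have q0: "poly q 0 = 1 / (2 * real n)"
    by (simp add: q_def poly_pcompose poly_0_coeff_0 coeff_zpoly)
  have q1: "poly (pderiv q) 0 = real n / 2"
    using pderiv_zpoly[of "2 * n" 1] assms
    by (simp add: q_def pderiv_pcompose poly_pcompose pderiv_pCons chebyshev_U_eq cheb_U_1)
  have "(\<lambda>m. (-1) ^ n * pi * bessel_Y (2 * n) (8 * pi * real (Suc m)) + 1 / (2 * sqrt (2 * real (Suc m))))
     sums (bernoulli_lin q - poly q 0 + poly (pderiv q) 0 / 2 + I / 4)"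
    unfolding bessel_Y_kernel[OF assms r] q_def[symmetric] I_def
    by (intro sums_add bernoulli_lin_osc_sums sums_divide integral_sawtooth_sums(1) r') auto
  hence Y: "(\<Sum>m. (-1) ^ n * pi * bessel_Y (2 * n) (8 * pi * real (Suc m)) + 1 / (2 * sqrt (2 * real (Suc m))))
     = bernoulli_lin q - 1 / (2 * real n) + real n / 4 + I / 4"
    unfolding q0 q1 by (simp add: sums_iff)
  have gk: "(real (Suc m) + 4 - sqrt (real (Suc m) * (real (Suc m) + 8))) ^ (2 * n)
              / sqrt (real (Suc m) * (real (Suc m) + 8)) = 4 ^ (2 * n) / 4 * gker n (real (Suc m))" for m
  proof -
    have "real (Suc m) + 4 - sqrt (real (Suc m) * (real (Suc m) + 8)) = 4 * vroot (real (Suc m))"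
      by (subst vroot_altdef) (simp_all add: wroot_def)
    thus ?thesis by (simp only: gker_def wroot_def power_mult_distrib) simp
  qed
  have "(\<lambda>m. 4 ^ (2 * n) / 4 * gker n (real (Suc m))) sums
      (4 ^ (2 * n) / 4 * (2 / real n + sqrt 2 * zeta_real (1/2) + real n - I))"
    unfolding I_def by (intro sums_mult gker_summation assms r)
  hence G: "(\<Sum>m. (real (Suc m) + 4 - sqrt (real (Suc m) * (real (Suc m) + 8))) ^ (2 * n)
              / sqrt (real (Suc m) * (real (Suc m) + 8)))
      = 4 ^ (2 * n) / 4 * (2 / real n + sqrt 2 * zeta_real (1/2) + real n - I)"
    unfolding gk by (rule sums_unique[symmetric])
  have "(4 :: real) ^ (2 * n) = 2 ^ (2 * (2 * n))"
    unfolding power_mult by simp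
  also have "2 * (2 * n) = Suc (4 * n - 1)" using assms by simp
  finally have "(4 :: real) ^ (2 * n) = 2 * 2 ^ (4 * n - 1)"
    by (simp only: power_Suc)
  hence pw: "(1 / 2 ^ (4 * n - 1)) * (4 ^ (2 * n) / 4 * s) = s / 2" for s :: real
    by simp
  have U: "poly (pderiv (zpoly (2 * n))) (-1/2) = chebyshev_U (2 * n - 1) (3/4) / 2"
          "poly (pderiv (zpoly (2 * n))) (-3/2) = chebyshev_U (2 * n - 1) (1/4) / 2"
    using pderiv_zpoly[of "2 * n" "3/4"] pderiv_zpoly[of "2 * n" "1/4"] assms by simp_all
  have "sqrt 2 * zeta_real (1/2) / 2 = (1 / sqrt 2) * zeta_real (1/2)"
    by (simp add: real_div_sqrt field_simps)
  \<comment> \<open>The parts of the balance: 2 q(0) = 1/n equals half of the integral 2/n of the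
    kernel, -n/2 from -q'(0) and n/2 from half the end correction account for -n, the zeta terms
    cancel, and so does \<open>I\<close>, with I/2 from twice the Bessel series and -I/2 from the
    algebraic one.\<close>
  thus ?thesis
    unfolding Y G pw zagier_poly_pair U q_def[symmetric]
    by (simp add: field_simps)
qed

end
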